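(* Let $n\ge1$ be an integer and let $\Lambda\subset\mathbb{R}^2$ be a lattice. Then $\Gamma_\Lambda$ is an interpolating sequence for $\mathbf{F}^n(\mathbb{C})$ if and only if $D(\Lambda)<n$.
   Context: The polyanalytic Fock space $\mathbf{F}^n(\mathbb{C})$ is the space of functions $F(z)=\sum_{k=0}^{n-1}\bar z^k\varphi_k(z)$ with $\varphi_k$ entire on $\mathbb{C}$ and $\int_{\mathbb{C}}|F(z)|^2e^{-\pi|z|^2}dz<\infty$. A lattice is $\Lambda=A\mathbb{Z}^2$ with $A$ an invertible real $2\times2$ matrix, with density $D(\Lambda)=|\det A|^{-1}$; $\Gamma_\Lambda=\{x+i\omega:(x,\omega)\in\Lambda\}$. $\Gamma$ is an interpolating sequence for $\mathbf{F}^n(\mathbb{C})$ if for every $(\alpha_z)_{z\in\Gamma}\in\ell^2$ there is $F\in\mathbf{F}^n(\mathbb{C})$ with $e^{-\frac{\pi}{2}|z|^2}F(z)=\alpha_z$ for every $z\in\Gamma$. *)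

theory Defs
  imports "HOL-Analysis.Analysis"
begin

definition poly_fock :: "nat \<Rightarrow> (complex \<Rightarrow> complex) set" where
  "poly_fock n = {F. (\<exists>\<phi> :: nat \<Rightarrow> complex \<Rightarrow> complex.
        (\<forall>k<n. \<phi> k holomorphic_on UNIV) \<and>
        (\<forall>z. F z = (\<Sum>k<n. (cnj z) ^ k * \<phi> k z))) \<and>
      integrable lborel (\<lambda>z::complex. (cmod (F z))\<^sup>2 * exp (- pi * (cmod z)\<^sup>2))}"

definition lattice :: "real^2^2 \<Rightarrow> (real^2) set" where
  "lattice A = {A *v vector [real_of_int a, real_of_int b] | a b. True}"

definition lattice_density :: "real^2^2 \<Rightarrow> real" where
  "lattice_density A = 1 / \<bar>det A\<bar>"

definition Gamma_lattice :: "real^2^2 \<Rightarrow> complex set" where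
  "Gamma_lattice A = (\<lambda>v. Complex (v $ 1) (v $ 2)) ` lattice A"

definition interpolating :: "complex set \<Rightarrow> nat \<Rightarrow> bool" where
  "interpolating \<Gamma> n \<longleftrightarrow>
     (\<forall>\<alpha> :: complex \<Rightarrow> complex. (\<lambda>z. (cmod (\<alpha> z))\<^sup>2) summable_on \<Gamma> \<longrightarrow>
        (\<exists>F \<in> poly_fock n. \<forall>z \<in> \<Gamma>. exp (- (pi / 2) * (cmod z)\<^sup>2) * F z = \<alpha> z))"

end

theory Submission
  imports Defs "HOL-Complex_Analysis.Complex_Analysis"
begin

text \<open>
Write \<open>\<Lambda>\<close> for the lattice of nodes and \<open>M = \<Lambda> / area\<close> for its dual under the pairing \<open>chi\<close>. Let \<open>s = \<sigma>^n\<close>,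
where \<open>\<sigma>\<close> is a Weierstrass sigma function of \<open>M\<close> normalised so that \<open>|s(z)| exp(- \<pi> \<beta> |z|^2 / 2)\<close> is
\<open>M\<close>-periodic; here \<open>\<beta> = n / area(M) = n / D(\<Lambda>)\<close>.

Sufficiency. If \<open>\<beta> > 1\<close>, put \<open>F0 z = \<integral> exp(- \<pi> z cnj v - \<pi> \<beta> |v|^2) R(z, v) dv\<close>, where
\<open>R(z, v)\<close> is \<open>2 \<pi> i\<close> times the residue at \<open>t = 0\<close> of
\<open>s(-v) exp(- \<pi> (\<beta> cnj v + cnj z) t) / (s(t) (t + v))\<close>. The pole at \<open>0\<close> has order \<open>n\<close>, so \<open>F0\<close> is
polyanalytic of order \<open>n\<close>, and \<open>\<beta> > 1\<close> gives it growth \<open>exp(a |z|^2)\<close> with \<open>a < \<pi> / 2\<close>. For \<open>z\<close> in \<open>\<Lambda>\<close>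
the integral is unfolded over translates of a cell of \<open>M\<close>. The integrals of the above function of \<open>t\<close> over
opposite sides of the period parallelogram cancel in the sum over translates, only the residue at \<open>t = -v\<close> survives, and
it contributes the integral of a character over the cell. Hence \<open>F0\<close> vanishes on \<open>\<Lambda>\<close> except at \<open>0\<close>, and
interpolation follows by superposing Weyl translates of \<open>F0\<close>.

Necessity. Suppose \<open>\<beta> \<le> 1\<close> and that \<open>F = \<Sum> cnj z ^ k \<phi>(k)\<close> in the Fock space vanishes on \<open>\<Lambda>\<close> except at \<open>0\<close>. Let \<open>h\<close> be
\<open>s(z - u) (1 / (z - \<nu>) - 1 / (z - u))\<close> times an exponential, where \<open>\<nu> - u\<close> is in \<open>M\<close>. Periodising \<open>h F exp(- \<pi> |z|^2)\<close>
over \<open>\<Lambda>\<close> gives a continuous function whose Fourier coefficients are multiples of \<open>\<phi>(n - 1)\<close> at the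
points of \<open>u + M\<close> and vanish unless the point is \<open>u\<close> or \<open>\<nu>\<close>. Evaluating the Fourier series at \<open>0\<close> shows that the
suitably weighted values of \<open>\<phi>(n - 1)\<close> on \<open>u + M\<close> have modulus \<open>|a - \<kappa> / \<nu>|\<close> with \<open>\<kappa> \<noteq> 0\<close>, while finiteness of the
norm of \<open>F\<close> makes them square summable; this is impossible over a planar lattice.
\<close>

text \<open>The threshold is a comparison of Gaussian exponents. \<open>s\<close> grows like exp(pi
  beta |z|^2 / 2), and D < n means beta > 1. In the sufficiency part the integrand decays like
  exp(-pi beta |v|^2 / 2) up to polynomial factors, so its transform grows about like exp(pi |z|^2 /
  (2 beta)), below the Fock rate exp(pi |z|^2 / 2) exactly when beta > 1. In the necessity part the
  obstacle is the critical case beta = 1, where h F exp(-pi |z|^2) has no Gaussian decay to spare. A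
  single pole would give h only the factor 1/|z|, which is not square integrable at infinity in the
  plane; the difference of two poles gives 1/|z|^2, which is. The contradiction sits on the same
  borderline: 1/|nu| tends to 0 but is not square summable over a planar lattice. The n-th power
  matters because h then vanishes to order at least n - 1 on u + M. Recentred at such a point, the
  integrand is z^(n-1) times a polyanalytic function times a radial weight, and averaging over
  rotations keeps only the top coefficient, which recentring does not change.\<close>

unbundle no fps_syntax

section \<open>Local bounds for polyanalytic functions\<close>

text \<open>Used by \<open>distr_lborel_rotation\<close>, which carries a box to
  \<open>real^2\<close>, applies the invariance of Lebesgue measure under orthogonal maps there, and
  returns.\<close>

lemma distr_lborel_vec2_complex:
  "distr lborel borel (\<lambda>v::real^2. Complex (v $ 1) (v $ 2)) = lborel"
proof (rule lborel_eqI[symmetric])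
  fix l u :: complex
  assume le: "\<And>b. b \<in> Basis \<Longrightarrow> l \<bullet> b \<le> u \<bullet> b"
  have le': "Re l \<le> Re u" "Im l \<le> Im u"
    using le[of 1] le[of \<i>] by (auto simp: Basis_complex_def)
  have cont: "continuous_on UNIV (\<lambda>v::real^2. Complex (v $ 1) (v $ 2))"
    unfolding Complex_eq by (intro continuous_intros)
  then have [measurable]: "(\<lambda>v::real^2. Complex (v $ 1) (v $ 2)) \<in> borel \<rightarrow>\<^sub>M borel"
    by (rule borel_measurable_continuous_onI)
  have eq: "(\<lambda>v::real^2. Complex (v $ 1) (v $ 2)) -` box l u = box (vector [Re l, Im l]) (vector [Re u, Im u])"
    by (auto simp: box_def Basis_complex_def Basis_vec_def inner_axis forall_2 vector_def)
  have "emeasure (distr lborel borel (\<lambda>v::real^2. Complex (v $ 1) (v $ 2))) (box l u) =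
        emeasure lborel (box (vector [Re l, Im l]) (vector [Re u, Im u]) :: (real^2) set)"
    by (subst emeasure_distr) (auto simp: eq)
  also have "\<dots> = (\<Prod>b\<in>Basis. (u - l) \<bullet> b)"
  proof -
    have "(\<Prod>b\<in>(Basis::(real^2) set). (vector [Re u, Im u] - vector [Re l, Im l]) \<bullet> b) = (Re u - Re l) * (Im u - Im l)"
      by (simp add: Basis_vec_def inner_axis UNIV_2 vector_def axis_eq_axis)
    moreover have "(\<Prod>b\<in>Basis. (u - l) \<bullet> b) = (Re u - Re l) * (Im u - Im l)"
      by (simp add: Basis_complex_def complex_eq_iff)
    moreover have "\<And>b. b \<in> (Basis::(real^2) set) \<Longrightarrow> vector [Re l, Im l] \<bullet> b \<le> vector [Re u, Im u] \<bullet> b"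
      using le' by (auto simp: Basis_vec_def inner_axis exhaust_2 UNIV_2 vector_def)
    ultimately show ?thesis
      by (subst emeasure_lborel_box) auto
  qed
  finally show "emeasure (distr lborel borel (\<lambda>v::real^2. Complex (v $ 1) (v $ 2))) (box l u)
      = ennreal (\<Prod>b\<in>Basis. (u - l) \<bullet> b)" .
qed simp

lemma distr_lborel_rotation:
  assumes c: "cmod c = 1"
  shows "distr lborel borel (\<lambda>z. c * z) = lborel"
proof (rule lborel_eqI[symmetric])
  fix l u :: complex
  assume le: "\<And>b. b \<in> Basis \<Longrightarrow> l \<bullet> b \<le> u \<bullet> b"
  define \<phi> where "\<phi> = (\<lambda>v::real^2. Complex (v $ 1) (v $ 2))"
  \<comment> \<open>\<open>T\<close> is multiplication by \<open>c\<close> in coordinates and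
    \<open>T'\<close> multiplication by its conjugate. Since \<open>c\<close> has modulus one they
    are inverse to each other and orthogonal, so a preimage under multiplication by \<open>c\<close>
    is an image under \<open>T'\<close>.\<close>
  define T where "T = (\<lambda>v::real^2. (vector [Re c * v $ 1 - Im c * v $ 2, Im c * v $ 1 + Re c * v $ 2] :: real^2))"
  define T' where "T' = (\<lambda>v::real^2. (vector [Re c * v $ 1 + Im c * v $ 2, - Im c * v $ 1 + Re c * v $ 2] :: real^2))"
  have c2: "Re c * Re c + Im c * Im c = 1"
    using c by (simp add: cmod_def power2_eq_square)
  have \<phi>m [measurable]: "\<phi> \<in> borel \<rightarrow>\<^sub>M borel"
    unfolding \<phi>_def Complex_eq by (intro borel_measurable_continuous_onI continuous_intros)
  have cm [measurable]: "(\<lambda>z. c * z) \<in> borel \<rightarrow>\<^sub>M borel"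
    by (intro borel_measurable_continuous_onI continuous_intros)
  have lin: "linear T'"
    by (rule linearI) (auto simp: T'_def vec_eq_iff forall_2 algebra_simps)
  have orth: "orthogonal_transformation T'"
    unfolding orthogonal_transformation_def
  proof (intro conjI lin allI)
    fix v w
    have "T' v \<bullet> T' w = (Re c * Re c + Im c * Im c) * (v $ 1 * w $ 1 + v $ 2 * w $ 2)"
      by (simp add: T'_def inner_vec_def UNIV_2 algebra_simps)
    then show "T' v \<bullet> T' w = v \<bullet> w"
      by (simp add: c2 inner_vec_def UNIV_2)
  qed
  have TT': "T (T' v) = v" "T' (T v) = v" for v
  proof -
    have "T (T' v) = (Re c * Re c + Im c * Im c) *\<^sub>R v"
      by (simp add: T_def T'_def vec_eq_iff forall_2 algebra_simps)
    then show "T (T' v) = v" by (simp add: c2)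
    have "T' (T v) = (Re c * Re c + Im c * Im c) *\<^sub>R v"
      by (simp add: T_def T'_def vec_eq_iff forall_2 algebra_simps)
    then show "T' (T v) = v" by (simp add: c2)
  qed
  have \<phi>T: "\<phi> (T v) = c * \<phi> v" for v
    by (simp add: \<phi>_def T_def complex_eq_iff)
  define S where "S = \<phi> -` box l u"
  have S_eq: "S = box (vector [Re l, Im l]) (vector [Re u, Im u])"
    by (auto simp: S_def \<phi>_def box_def Basis_complex_def Basis_vec_def inner_axis forall_2 vector_def)
  have Sl: "S \<in> lmeasurable" by (simp add: S_eq)
  have pre: "\<phi> -` ((\<lambda>z. c * z) -` box l u) = T' ` S"
  proof (intro set_eqI iffI)
    fix v assume "v \<in> \<phi> -` ((\<lambda>z. c * z) -` box l u)"
    then have "T v \<in> S" by (simp add: S_def \<phi>T)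
    then show "v \<in> T' ` S" by (metis TT'(2) image_eqI)
  next
    fix v assume "v \<in> T' ` S"
    then obtain x where "x \<in> S" "v = T' x" by auto
    then show "v \<in> \<phi> -` ((\<lambda>z. c * z) -` box l u)"
      by (simp add: S_def \<phi>T[symmetric] TT')
  qed
  have bT: "T' ` S \<in> sets borel"
    using pre[symmetric] measurable_sets_borel[OF \<phi>m] measurable_sets_borel[OF cm] by auto
  have "emeasure (distr lborel borel (\<lambda>z. c * z)) (box l u) = emeasure lborel ((\<lambda>z. c * z) -` box l u)"
    by (subst emeasure_distr) auto
  also have "\<dots> = emeasure (distr lborel borel \<phi>) ((\<lambda>z. c * z) -` box l u)"
    using distr_lborel_vec2_complex by (simp add: \<phi>_def)
  also have "\<dots> = emeasure lborel (T' ` S)"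
    using measurable_sets_borel[OF cm, of "box l u"] by (subst emeasure_distr) (auto simp: pre)
  also have "\<dots> = emeasure lebesgue (T' ` S)" using bT by simp
  also have "\<dots> = emeasure lebesgue S"
    by (simp only: emeasure_eq_measure2[OF Sl] emeasure_eq_measure2[OF measurable_orthogonal_image[OF orth Sl]]
        measure_orthogonal_image[OF orth Sl])
  also have "\<dots> = emeasure lborel S" by (simp add: S_eq)
  also have "\<dots> = emeasure (distr lborel borel \<phi>) (box l u)"
    by (subst emeasure_distr) (auto simp: S_def)
  also have "\<dots> = emeasure lborel (box l u)"
    using distr_lborel_vec2_complex by (simp add: \<phi>_def)
  also have "\<dots> = (\<Prod>b\<in>Basis. (u - l) \<bullet> b)"
    using le by (subst emeasure_lborel_box) auto
  finally show "emeasure (distr lborel borel (\<lambda>z. c * z)) (box l u) = ennreal (\<Prod>b\<in>Basis. (u - l) \<bullet> b)" .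
qed simp

lemma
  fixes f :: "complex \<Rightarrow> 'b::{banach, second_countable_topology}"
  assumes c: "cmod c = 1" and f [measurable]: "f \<in> borel_measurable borel"
  shows integral_lborel_rotation: "(LINT z|lborel. f (c * z)) = (LINT z|lborel. f z)"
    and integrable_lborel_rotation: "integrable lborel (\<lambda>z. f (c * z)) \<longleftrightarrow> integrable lborel f"
proof -
  have [measurable]: "(\<lambda>z. c * z) \<in> borel \<rightarrow>\<^sub>M borel"
    by (intro borel_measurable_continuous_onI continuous_intros)
  show "(LINT z|lborel. f (c * z)) = (LINT z|lborel. f z)"
    by (subst (2) distr_lborel_rotation[OF c, symmetric]) (simp add: integral_distr)
  show "integrable lborel (\<lambda>z. f (c * z)) \<longleftrightarrow> integrable lborel f"
    by (subst (2) distr_lborel_rotation[OF c, symmetric]) (simp add: integrable_distr_eq)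
qed

lemma
  fixes f :: "complex \<Rightarrow> 'b::{banach, second_countable_topology}"
  assumes f [measurable]: "f \<in> borel_measurable borel"
  shows integral_lborel_shift: "(LINT z|lborel. f (c + z)) = (LINT z|lborel. f z)"
    and integrable_lborel_shift: "integrable lborel (\<lambda>z. f (c + z)) \<longleftrightarrow> integrable lborel f"
proof -
  show "(LINT z|lborel. f (c + z)) = (LINT z|lborel. f z)"
    by (subst (2) lborel_distr_plus[of c, symmetric]) (simp add: integral_distr)
  show "integrable lborel (\<lambda>z. f (c + z)) \<longleftrightarrow> integrable lborel f"
    by (subst (2) lborel_distr_plus[of c, symmetric]) (simp add: integrable_distr_eq)
qed

text \<open>Cauchy's integral formula on the unit circle, applied to
  \<open>w ^ m * q (w * z)\<close> at the point 0; the power of \<open>w\<close> kills the value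
  there unless \<open>m = 0\<close>.\<close>

lemma circle_mean_value:
  assumes q: "q holomorphic_on UNIV"
  shows "(LINT x:{0..1}|lborel. cis (2 * pi * x) ^ m * q (cis (2 * pi * x) * z)) = (if m = 0 then q 0 else 0)"
proof -
  define f where "f = (\<lambda>w. w ^ m * q (w * z))"
  have hf: "f holomorphic_on UNIV" unfolding f_def
  proof -
    have "(\<lambda>w. w * z) holomorphic_on UNIV" by (intro holomorphic_intros)
    from holomorphic_on_compose_gen[OF this q] have "(\<lambda>w. q (w * z)) holomorphic_on UNIV"
      by (simp add: o_def)
    then show "(\<lambda>w. w ^ m * q (w * z)) holomorphic_on UNIV" by (intro holomorphic_intros)
  qed
  have cp: "circlepath 0 1 x = cis (2 * pi * x)" for x
    by (simp add: circlepath cis_conv_exp mult_ac)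
  have vd: "vector_derivative (circlepath 0 1) (at x within {0..1}) = 2 * of_real pi * \<i> * cis (2 * pi * x)"
    if "x \<in> {0..1}" for x
    using vector_derivative_circlepath01[of x 0 1] that by (simp add: cis_conv_exp mult_ac)
  have "((\<lambda>u. f u / (u - 0)) has_contour_integral (2 * of_real pi * \<i> * f 0)) (circlepath 0 1)"
    using hf by (intro Cauchy_integral_circlepath) (auto intro: holomorphic_on_subset holomorphic_on_imp_continuous_on)
  then have "((\<lambda>x. f (cis (2 * pi * x)) / cis (2 * pi * x) * (2 * of_real pi * \<i> * cis (2 * pi * x))) has_integral (2 * of_real pi * \<i> * f 0)) {0..1}"
    unfolding has_contour_integral_def
    by (rule has_integral_eq[rotated]) (simp add: cp vd)
  then have "((\<lambda>x. 2 * of_real pi * \<i> * f (cis (2 * pi * x))) has_integral (2 * of_real pi * \<i> * f 0)) {0..1}"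
    by (rule has_integral_eq[rotated]) auto
  then have hi: "((\<lambda>x. f (cis (2 * pi * x))) has_integral f 0) {0..1}"
    using has_integral_mult_right[of "\<lambda>x. 2 * of_real pi * \<i> * f (cis (2 * pi * x))" "2 * of_real pi * \<i> * f 0" "{0..1}" "1 / (2 * of_real pi * \<i>)"]
    by simp
  have "continuous_on {0..1} (\<lambda>x. f (cis (2 * pi * x)))"
    by (intro continuous_on_compose2[OF holomorphic_on_imp_continuous_on[OF hf]] continuous_intros) auto
  then have "set_integrable lborel {0..1} (\<lambda>x. f (cis (2 * pi * x)))"
    by (intro borel_integrable_compact[unfolded set_integrable_def[symmetric]]) auto
  then have "(LINT x:{0..1}|lborel. f (cis (2 * pi * x))) = f 0"
    using set_borel_integral_eq_integral(2) hi by (metis integral_unique)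
  then show ?thesis by (simp add: f_def)
qed

lemma cis_power_mult_cnj_power:
  assumes "k \<le> m"
  shows "cis t ^ m * cnj (cis t) ^ k = cis t ^ (m - k)"
proof -
  have "cis t ^ m = cis t ^ (m - k) * cis t ^ k"
    using assms by (simp flip: power_add)
  moreover have "cis t ^ k * cnj (cis t) ^ k = 1"
    by (simp flip: power_mult_distrib add: cis_cnj cis_mult)
  ultimately show ?thesis by (simp add: mult.assoc)
qed

text \<open>Averaging over rotations: under a rotation of \<open>z\<close> the term of index
  \<open>k\<close> acquires the power \<open>m - k\<close> of the rotation next to a holomorphic
  function, so by \<open>circle_mean_value\<close> only \<open>k = m\<close> survives, through
  \<open>q m 0\<close>. Every later extraction of a top coefficient rests on this.\<close>

lemma integral_radial_polyanalytic:
  fixes q :: "nat \<Rightarrow> complex \<Rightarrow> complex" and \<rho> :: "complex \<Rightarrow> complex"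
  assumes q: "\<And>k. k \<le> m \<Longrightarrow> q k holomorphic_on UNIV"
    and \<rho>: "\<And>c z. cmod c = 1 \<Longrightarrow> \<rho> (c * z) = \<rho> z"
    and int: "integrable lborel (\<lambda>z. z ^ m * (\<Sum>k\<le>m. cnj z ^ k * q k z) * \<rho> z)"
  shows "(LINT z|lborel. z ^ m * (\<Sum>k\<le>m. cnj z ^ k * q k z) * \<rho> z) =
         q m 0 * (LINT z|lborel. of_real (cmod z ^ (2 * m)) * \<rho> z)"
proof -
  define \<Psi> where "\<Psi> = (\<lambda>z. z ^ m * (\<Sum>k\<le>m. cnj z ^ k * q k z) * \<rho> z)"
  define e where "e = (\<lambda>x::real. cis (2 * pi * x))"
  have ne: "cmod (e x) = 1" for x by (simp add: e_def)
  have int\<Psi>: "integrable lborel \<Psi>" using int by (simp add: \<Psi>_def)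
  have [measurable]: "\<Psi> \<in> borel_measurable borel" using int\<Psi> by (simp add: borel_measurable_integrable[of lborel \<Psi>, simplified])
  have [measurable]: "e \<in> borel_measurable borel" unfolding e_def
    by (intro borel_measurable_continuous_onI continuous_intros)
  define F where "F = (\<lambda>(x::real) z. indicat_real {0..1} x *\<^sub>R \<Psi> (e x * z))"
  have [measurable]: "case_prod F \<in> borel_measurable (lborel \<Otimes>\<^sub>M lborel)"
    unfolding F_def by measurable
  have intF: "integrable lborel (F x)" for x
    unfolding F_def using integrable_lborel_rotation[OF ne, of \<Psi> x] int\<Psi> by auto
  have normF: "(LINT z|lborel. norm (F x z)) = indicat_real {0..1} x * (LINT z|lborel. norm (\<Psi> z))" for x
    using integral_lborel_rotation[OF ne, of "\<lambda>z. norm (\<Psi> z)" x] by (simp add: F_def)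
  have "integrable (lborel \<Otimes>\<^sub>M lborel) (case_prod F)"
  proof (rule lborel_pair.Fubini_integrable)
    show "integrable lborel (\<lambda>x. LINT y|lborel. norm (case (x, y) of (x, xa) \<Rightarrow> F x xa))"
      by (simp add: normF)
  qed (use intF in auto)
  \<comment> \<open>Integrated over the plane first, each rotated copy returns the integral of
    \<open>\<Psi>\<close>; integrated over \<open>x\<close> first, \<open>\<Psi>\<close> is replaced
    by its rotational mean.\<close>
  then have swap: "(LINT z|lborel. LINT x|lborel. F x z) = (LINT x|lborel. LINT z|lborel. F x z)"
    by (rule lborel_pair.Fubini_integral)
  have "(LINT z|lborel. F x z) = indicat_real {0..1} x *\<^sub>R (LINT z|lborel. \<Psi> z)" for x
    using integral_lborel_rotation[OF ne, of \<Psi> x] by (simp add: F_def)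
  then have r: "(LINT x|lborel. LINT z|lborel. F x z) = (LINT z|lborel. \<Psi> z)"
    by simp
  have "(LINT x|lborel. F x z) = q m 0 * (of_real (cmod z ^ (2 * m)) * \<rho> z)" for z
  proof -
    have 1: "\<Psi> (e x * z) = (\<Sum>k\<le>m. (z ^ m * \<rho> z * cnj z ^ k) * (cis (2 * pi * x) ^ (m - k) * q k (cis (2 * pi * x) * z)))" for x
    proof -
      have "\<Psi> (e x * z) = (e x * z) ^ m * (\<Sum>k\<le>m. cnj (e x * z) ^ k * q k (e x * z)) * \<rho> z"
        by (simp only: \<Psi>_def \<rho>[OF ne])
      also have "\<dots> = (\<Sum>k\<le>m. (z ^ m * \<rho> z * cnj z ^ k) * ((e x ^ m * cnj (e x) ^ k) * q k (e x * z)))"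
        by (simp add: sum_distrib_left sum_distrib_right power_mult_distrib mult_ac)
      also have "\<dots> = (\<Sum>k\<le>m. (z ^ m * \<rho> z * cnj z ^ k) * (cis (2 * pi * x) ^ (m - k) * q k (cis (2 * pi * x) * z)))"
        unfolding e_def by (intro sum.cong refl) (simp add: cis_power_mult_cnj_power)
      finally show ?thesis .
    qed
    have si: "set_integrable lborel {0..1} (\<lambda>x. cis (2 * pi * x) ^ (m - k) * q k (cis (2 * pi * x) * z))" if "k \<le> m" for k
      unfolding set_integrable_def
      by (intro borel_integrable_compact continuous_on_mult continuous_on_power
          continuous_on_compose2[OF holomorphic_on_imp_continuous_on[OF q[OF that]]] continuous_intros) auto
    have "(LINT x|lborel. F x z) = (LINT x:{0..1}|lborel. \<Psi> (e x * z))"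
      by (simp add: F_def set_lebesgue_integral_def)
    also have "\<dots> = (\<Sum>k\<le>m. (z ^ m * \<rho> z * cnj z ^ k) * (LINT x:{0..1}|lborel. cis (2 * pi * x) ^ (m - k) * q k (cis (2 * pi * x) * z)))"
      unfolding 1 set_lebesgue_integral_def scaleR_sum_right
      using si
      by (subst Bochner_Integration.integral_sum)
         (auto simp: set_integrable_def mult_scaleR_right[symmetric] simp del: mult_scaleR_right)
    also have "\<dots> = (\<Sum>k\<le>m. if k = m then z ^ m * \<rho> z * cnj z ^ m * q m 0 else 0)"
      using q by (intro sum.cong refl) (auto simp: circle_mean_value)
    also have "\<dots> = q m 0 * ((z * cnj z) ^ m * \<rho> z)"
      by (simp add: power_mult_distrib)
    also have "\<dots> = q m 0 * (of_real (cmod z ^ (2 * m)) * \<rho> z)"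
      by (simp add: complex_norm_square[symmetric] power_mult)
    finally show ?thesis .
  qed
  then show ?thesis using swap r by (simp add: \<Psi>_def)
qed

text \<open>Binomial expansion about the new centre. In the inner sum for \<open>p = n - 1\<close>
  only \<open>k = n - 1\<close> has a nonzero binomial coefficient, so the top coefficient is merely
  translated.\<close>

lemma polyanalytic_shift:
  fixes q :: "nat \<Rightarrow> complex \<Rightarrow> complex"
  shows "(\<Sum>k<n. cnj (z + a) ^ k * q k (z + a)) =
         (\<Sum>p<n. cnj z ^ p * (\<Sum>k<n. of_nat (k choose p) * cnj a ^ (k - p) * q k (z + a)))"
proof -
  have "cnj (z + a) ^ k = (\<Sum>p<n. of_nat (k choose p) * cnj z ^ p * cnj a ^ (k - p))" if "k < n" for k
  proof -
    have "cnj (z + a) ^ k = (\<Sum>p\<le>k. of_nat (k choose p) * cnj z ^ p * cnj a ^ (k - p))"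
      by (simp add: binomial_ring)
    also have "\<dots> = (\<Sum>p<n. of_nat (k choose p) * cnj z ^ p * cnj a ^ (k - p))"
      using that by (intro sum.mono_neutral_left) (auto simp: not_le binomial_eq_0)
    finally show ?thesis .
  qed
  then have "(\<Sum>k<n. cnj (z + a) ^ k * q k (z + a)) =
     (\<Sum>k<n. \<Sum>p<n. of_nat (k choose p) * cnj z ^ p * cnj a ^ (k - p) * q k (z + a))"
    by (simp add: sum_distrib_right)
  also have "\<dots> = (\<Sum>p<n. \<Sum>k<n. of_nat (k choose p) * cnj z ^ p * cnj a ^ (k - p) * q k (z + a))"
    by (rule sum.swap)
  finally show ?thesis by (simp add: sum_distrib_left mult_ac)
qed

text \<open>Cauchy-Schwarz against the constant one, read off from the nonnegative variance of
  \<open>f\<close> on \<open>A\<close>.\<close>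

lemma square_set_integral_le:
  fixes f :: "'a \<Rightarrow> real"
  assumes A: "A \<in> sets M" "emeasure M A < \<infinity>"
    and f: "set_integrable M A f" and f2: "set_integrable M A (\<lambda>x. (f x)\<^sup>2)"
  shows "(LINT x:A|M. f x)\<^sup>2 \<le> measure M A * (LINT x:A|M. (f x)\<^sup>2)"
proof (cases "measure M A = 0")
  case True
  then have "emeasure M A = 0" using A(2) by (simp add: emeasure_eq_ennreal_measure)
  then have "AE x in M. x \<notin> A" using A(1) by (simp add: AE_iff_null_sets[symmetric] null_sets_def)
  then have "(LINT x:A|M. f x) = 0" unfolding set_lebesgue_integral_def
    by (intro integral_eq_zero_AE) auto
  then show ?thesis using True by simp
next
  case False
  define V where "V = measure M A"
  define I where "I = (LINT x:A|M. f x)"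
  have V: "V > 0" using False by (simp add: V_def zero_less_measure_iff)
  have si1: "set_integrable M A (\<lambda>x. (c::real))" for c
    using A by (simp add: set_integrable_def)
  have "0 \<le> (LINT x:A|M. (f x - I / V)\<^sup>2)"
    by (auto simp: set_lebesgue_integral_def intro!: integral_nonneg)
  also have "(LINT x:A|M. (f x - I / V)\<^sup>2) = (LINT x:A|M. (f x)\<^sup>2 - (2 * I / V) * f x + (I / V)\<^sup>2)"
    by (simp add: power2_diff algebra_simps)
  also have "\<dots> = (LINT x:A|M. (f x)\<^sup>2) - (2 * I / V) * I + (I / V)\<^sup>2 * V"
    using f f2 si1 A
    by (simp add: set_integral_add set_integral_diff I_def V_def set_integral_const emeasure_eq_ennreal_measure)
  finally have "0 \<le> (LINT x:A|M. (f x)\<^sup>2) - I\<^sup>2 / V"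
    using V by (simp add: field_simps power2_eq_square)
  then show ?thesis using V by (simp add: field_simps I_def V_def)
qed

lemma set_integrable_ball_continuous:
  fixes f :: "complex \<Rightarrow> 'b::{banach, second_countable_topology}"
  assumes "continuous_on UNIV f"
  shows "set_integrable lborel (ball a r) f"
proof (rule set_integrable_subset)
  show "set_integrable lborel (cball a r) f"
    unfolding set_integrable_def by (intro borel_integrable_compact continuous_on_subset[OF assms]) auto
qed auto

lemma continuous_on_polyanalytic:
  assumes "\<And>k. k \<in> K \<Longrightarrow> q k holomorphic_on UNIV"
  shows "continuous_on UNIV (\<lambda>z. \<Sum>k\<in>K. cnj z ^ k * q k z)"
  by (intro continuous_on_sum continuous_on_mult continuous_on_power continuous_intros
      holomorphic_on_imp_continuous_on assms)

lemma holomorphic_on_shift: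
  assumes "f holomorphic_on UNIV"
  shows "(\<lambda>z. f (z + a)) holomorphic_on UNIV"
proof -
  have "(\<lambda>z. z + a) holomorphic_on UNIV" by (intro holomorphic_intros)
  from holomorphic_on_compose_gen[OF this assms] show ?thesis by (simp add: o_def)
qed

lemma set_integral_ball_shift:
  fixes f :: "complex \<Rightarrow> 'b::{banach, second_countable_topology}"
  assumes [measurable]: "f \<in> borel_measurable borel"
  shows "(LINT z:ball 0 r|lborel. f (z + a)) = (LINT z:ball a r|lborel. f z)"
proof -
  have "indicat_real (ball a r) (a + z) = indicat_real (ball 0 r) z" for z
    by (auto simp: indicator_def dist_norm norm_minus_commute)
  moreover have "(\<lambda>z. indicat_real (ball a r) z *\<^sub>R f z) \<in> borel_measurable borel"
    by (intro borel_measurable_scaleR borel_measurable_indicator assms) auto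
  ultimately show ?thesis
    using integral_lborel_shift[of "\<lambda>z. indicat_real (ball a r) z *\<^sub>R f z" a]
    by (simp add: set_lebesgue_integral_def add.commute)
qed

text \<open>Pairing with \<open>z ^ m\<close> over the disc returns \<open>q m 0\<close> times the
  moment \<open>c\<close> of \<open>cmod z ^ (2 * m)\<close>; Cauchy-Schwarz then bounds
  \<open>q m 0\<close> by the mean square.\<close>

lemma top_coefficient_bound_0:
  assumes r: "r > 0"
  shows "\<exists>C\<ge>0. \<forall>q. (\<forall>k\<le>m. q k holomorphic_on UNIV) \<longrightarrow>
    (cmod (q m 0))\<^sup>2 \<le> C * (LINT z:ball 0 r|lborel. (cmod (\<Sum>k\<le>m. cnj z ^ k * q k z))\<^sup>2)"
proof -
  define c where "c = (LINT z:ball 0 r|lborel. cmod z ^ (2 * m))"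
  define V where "V = measure lborel (ball (0::complex) r)"
  have c: "c > 0"
  proof -
    \<comment> \<open>On this off-centre disc \<open>cmod z\<close> is at least
      \<open>r / 4\<close>, which makes the moment \<open>c\<close> strictly positive.\<close>
    define U where "U = ball (complex_of_real (r / 2)) (r / 4)"
    have U: "U \<subseteq> ball 0 r"
    proof
      fix z assume "z \<in> U"
      moreover have "cmod z \<le> cmod (complex_of_real (r / 2)) + cmod (complex_of_real (r / 2) - z)"
        using norm_triangle_ineq4[of "complex_of_real (r / 2)" "complex_of_real (r / 2) - z"] by simp
      ultimately show "z \<in> ball 0 r" using r by (simp add: U_def dist_norm)
    qed
    have Ub: "cmod z \<ge> r / 4" if "z \<in> U" for z
    proof -
      have "r / 2 = cmod (complex_of_real (r / 2))" using r by simp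
      also have "\<dots> \<le> cmod z + cmod (complex_of_real (r / 2) - z)"
        using norm_triangle_ineq[of z "complex_of_real (r / 2) - z"] by simp
      finally show ?thesis using that by (simp add: U_def dist_norm)
    qed
    have "0 < (r / 4) ^ (2 * m) * measure lborel U"
      using r content_ball_pos[of "r / 4" "complex_of_real (r / 2)"] by (simp add: U_def)
    also have "\<dots> = (LINT z:U|lborel. (r / 4) ^ (2 * m))"
      using emeasure_lborel_ball_finite[of "complex_of_real (r / 2)" "r / 4"]
      by (subst set_integral_const) (auto simp: U_def)
    also have "\<dots> \<le> c"
      unfolding c_def set_lebesgue_integral_def
    proof (rule integral_mono)
      show "integrable lborel (\<lambda>z. indicat_real U z *\<^sub>R (r / 4) ^ (2 * m))"
        using set_integrable_ball_continuous[of "\<lambda>z. (r / 4) ^ (2 * m)"]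
        by (simp add: U_def set_integrable_def)
      show "integrable lborel (\<lambda>z. indicat_real (ball 0 r) z *\<^sub>R cmod z ^ (2 * m))"
        using set_integrable_ball_continuous[of "\<lambda>z. cmod z ^ (2 * m)"]
        by (simp add: set_integrable_def continuous_intros)
      show "indicat_real U z *\<^sub>R (r / 4) ^ (2 * m) \<le> indicat_real (ball 0 r) z *\<^sub>R cmod z ^ (2 * m)" for z
        using U Ub[of z] r by (auto simp: indicator_def intro!: power_mono)
    qed
    finally show ?thesis .
  qed
  show ?thesis
  proof (intro exI[of _ "(r ^ m / c)\<^sup>2 * V"] conjI allI impI)
    show "0 \<le> (r ^ m / c)\<^sup>2 * V" by (simp add: V_def)
    fix q assume q: "\<forall>k\<le>m. q k holomorphic_on (UNIV :: complex set)"
    define Q where "Q = (\<lambda>z. \<Sum>k\<le>m. cnj z ^ k * q k z)"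
    have contQ: "continuous_on UNIV Q" unfolding Q_def
      using q by (intro continuous_on_polyanalytic) auto
    have "(LINT z|lborel. z ^ m * (\<Sum>k\<le>m. cnj z ^ k * q k z) * of_real (indicat_real (ball 0 r) z)) =
         q m 0 * (LINT z|lborel. of_real (cmod z ^ (2 * m)) * of_real (indicat_real (ball 0 r) z))"
    proof (rule integral_radial_polyanalytic)
      show "complex_of_real (indicat_real (ball 0 r) (c * z)) = of_real (indicat_real (ball 0 r) z)" if "cmod c = 1" for c z
        using that by (auto simp: indicator_def norm_mult)
      have "continuous_on UNIV (\<lambda>z. z ^ m * Q z)" by (intro continuous_intros contQ)
      from set_integrable_ball_continuous[OF this, of 0 r]
      show "complex_integrable lborel (\<lambda>z. z ^ m * (\<Sum>k\<le>m. cnj z ^ k * q k z) * of_real (indicat_real (ball 0 r) z))"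
        by (simp add: set_integrable_def Q_def scaleR_conv_of_real mult.commute)
    qed (use q in auto)
    also have "(LINT z|lborel. of_real (cmod z ^ (2 * m)) * complex_of_real (indicat_real (ball 0 r) z)) = of_real c"
    proof -
      have "c = (LINT z|lborel. cmod z ^ (2 * m) * indicat_real (ball 0 r) z)"
        by (simp add: c_def set_lebesgue_integral_def mult.commute)
      then show ?thesis by (simp flip: of_real_mult of_real_power)
    qed
    also have "(LINT z|lborel. z ^ m * (\<Sum>k\<le>m. cnj z ^ k * q k z) * of_real (indicat_real (ball 0 r) z)) =
       (LINT z:ball 0 r|lborel. z ^ m * Q z)"
      by (simp add: set_lebesgue_integral_def Q_def scaleR_conv_of_real mult.commute)
    finally have "cmod (q m 0) * c = cmod (LINT z:ball 0 r|lborel. z ^ m * Q z)"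
      using c by (metis abs_of_pos norm_mult norm_of_real)
    also have "\<dots> \<le> (LINT z:ball 0 r|lborel. cmod (z ^ m * Q z))"
      by (intro set_integral_norm_bound set_integrable_ball_continuous continuous_intros contQ)
    also have "\<dots> \<le> (LINT z:ball 0 r|lborel. r ^ m * cmod (Q z))"
      by (intro set_integral_mono set_integrable_ball_continuous continuous_intros contQ)
         (auto simp: norm_mult norm_power intro!: mult_right_mono power_mono)
    finally have "cmod (q m 0) * c \<le> r ^ m * (LINT z:ball 0 r|lborel. cmod (Q z))" by simp
    then have "cmod (q m 0) \<le> r ^ m / c * (LINT z:ball 0 r|lborel. cmod (Q z))"
      using c by (simp add: field_simps)
    then have "(cmod (q m 0))\<^sup>2 \<le> (r ^ m / c * (LINT z:ball 0 r|lborel. cmod (Q z)))\<^sup>2"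
      by (intro power_mono) auto
    also have "\<dots> = (r ^ m / c)\<^sup>2 * (LINT z:ball 0 r|lborel. cmod (Q z))\<^sup>2"
      by (rule power_mult_distrib)
    also have "\<dots> \<le> (r ^ m / c)\<^sup>2 * (V * (LINT z:ball 0 r|lborel. (cmod (Q z))\<^sup>2))"
      unfolding V_def using emeasure_lborel_ball_finite[of "0::complex" r]
      by (intro mult_left_mono square_set_integral_le set_integrable_ball_continuous continuous_intros contQ)
         (auto simp: less_top)
    finally show "(cmod (q m 0))\<^sup>2 \<le> (r ^ m / c)\<^sup>2 * V * (LINT z:ball 0 r|lborel. (cmod (\<Sum>k\<le>m. cnj z ^ k * q k z))\<^sup>2)"
      by (simp add: Q_def mult.assoc)
  qed
qed

text \<open>Recentring at \<open>a\<close> does not touch the top coefficient, so one constant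
  serves all centres; this uniformity is what allows summation over lattice points.\<close>

lemma top_coefficient_bound:
  assumes r: "r > 0"
  shows "\<exists>C\<ge>0. \<forall>q a. (\<forall>k<Suc m. q k holomorphic_on UNIV) \<longrightarrow>
    (cmod (q m a))\<^sup>2 \<le> C * (LINT z:ball a r|lborel. (cmod (\<Sum>k<Suc m. cnj z ^ k * q k z))\<^sup>2)"
proof -
  from top_coefficient_bound_0[OF r, of m] obtain C where C: "C \<ge> 0"
    "\<And>q. (\<forall>k\<le>m. q k holomorphic_on UNIV) \<Longrightarrow>
    (cmod (q m 0))\<^sup>2 \<le> C * (LINT z:ball 0 r|lborel. (cmod (\<Sum>k\<le>m. cnj z ^ k * q k z))\<^sup>2)"
    by blast
  show ?thesis
  proof (intro exI[of _ C] conjI allI impI C(1))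
    fix q a assume q: "\<forall>k<Suc m. q k holomorphic_on (UNIV :: complex set)"
    define q' where "q' = (\<lambda>p z. \<Sum>k<Suc m. of_nat (k choose p) * cnj a ^ (k - p) * q k (z + a))"
    have "q' m 0 = (\<Sum>k<Suc m. if k = m then q m a else 0)"
      unfolding q'_def by (intro sum.cong refl) (auto simp: binomial_eq_0)
    then have q'm: "q' m 0 = q m a" by (simp del: sum.lessThan_Suc)
    have "\<forall>k\<le>m. q' k holomorphic_on UNIV"
      unfolding q'_def using q by (intro allI impI holomorphic_intros holomorphic_on_shift) auto
    from C(2)[OF this] have "(cmod (q m a))\<^sup>2 \<le> C * (LINT z:ball 0 r|lborel. (cmod (\<Sum>k<Suc m. cnj z ^ k * q' k z))\<^sup>2)"
      by (simp add: q'm lessThan_Suc_atMost)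
    also have "(\<lambda>z. \<Sum>k<Suc m. cnj z ^ k * q' k z) = (\<lambda>z. \<Sum>k<Suc m. cnj (z + a) ^ k * q k (z + a))"
      unfolding q'_def by (rule ext, rule polyanalytic_shift[symmetric])
    also have "(LINT z:ball 0 r|lborel. (cmod (\<Sum>k<Suc m. cnj (z + a) ^ k * q k (z + a)))\<^sup>2) =
      (LINT z:ball a r|lborel. (cmod (\<Sum>k<Suc m. cnj z ^ k * q k z))\<^sup>2)"
      using q by (intro set_integral_ball_shift[where f = "\<lambda>z. (cmod (\<Sum>k<Suc m. cnj z ^ k * q k z))\<^sup>2"]
        borel_measurable_continuous_onI continuous_intros continuous_on_polyanalytic) auto
    finally show "(cmod (q m a))\<^sup>2 \<le> C * (LINT z:ball a r|lborel. (cmod (\<Sum>k<Suc m. cnj z ^ k * q k z))\<^sup>2)" .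
  qed
qed

lemma square_cmod_add_le: "(cmod (x + y))\<^sup>2 \<le> 2 * (cmod x)\<^sup>2 + 2 * (cmod y)\<^sup>2"
proof -
  have "(cmod (x + y))\<^sup>2 \<le> (cmod x + cmod y)\<^sup>2"
    by (intro power_mono norm_triangle_ineq) auto
  also have "\<dots> \<le> 2 * (cmod x)\<^sup>2 + 2 * (cmod y)\<^sup>2"
    using zero_le_power2[of "cmod x - cmod y"] by (simp add: power2_eq_square algebra_simps)
  finally show ?thesis .
qed

lemma set_integral_ball_mono:
  fixes f :: "complex \<Rightarrow> real"
  assumes "continuous_on UNIV f" "\<And>z. f z \<ge> 0" "ball a r \<subseteq> ball b s"
  shows "(LINT z:ball a r|lborel. f z) \<le> (LINT z:ball b s|lborel. f z)"
  unfolding set_lebesgue_integral_def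
  using set_integrable_ball_continuous[OF assms(1)] assms(2,3)
  by (intro integral_mono) (auto simp: set_integrable_def indicator_def)

text \<open>Induction on the order: the top coefficient is controlled on a smaller disc, and subtracting it
  leaves a polyanalytic function of lower order.\<close>

lemma polyanalytic_bound_0:
  assumes r: "r > 0"
  shows "\<exists>C\<ge>0. \<forall>q. (\<forall>k<n. q k holomorphic_on UNIV) \<longrightarrow>
    (cmod (\<Sum>k<n. cnj 0 ^ k * q k 0))\<^sup>2 \<le> C * (LINT z:ball 0 r|lborel. (cmod (\<Sum>k<n. cnj z ^ k * q k z))\<^sup>2)"
  using r
proof (induction n arbitrary: r)
  case 0
  then show ?case by auto
next
  case (Suc n)
  have r2: "r / 2 > 0" using Suc.prems by simp
  from Suc.IH[OF r2] obtain C3 where C3: "C3 \<ge> 0"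
    "\<And>q. (\<forall>k<n. q k holomorphic_on UNIV) \<Longrightarrow>
    (cmod (\<Sum>k<n. cnj 0 ^ k * q k 0))\<^sup>2 \<le> C3 * (LINT z:ball 0 (r/2)|lborel. (cmod (\<Sum>k<n. cnj z ^ k * q k z))\<^sup>2)"
    by blast
  from top_coefficient_bound[OF r2, of n] obtain C1 where C1: "C1 \<ge> 0"
    "\<And>q a. (\<forall>k<Suc n. q k holomorphic_on UNIV) \<Longrightarrow>
    (cmod (q n a))\<^sup>2 \<le> C1 * (LINT z:ball a (r/2)|lborel. (cmod (\<Sum>k<Suc n. cnj z ^ k * q k z))\<^sup>2)"
    by blast
  define V where "V = measure lborel (ball (0::complex) (r / 2))"
  have V: "V \<ge> 0" by (simp add: V_def)
  \<comment> \<open>From \<open>F' = F - cnj z ^ n * q n z\<close> and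
    \<open>square_cmod_add_le\<close>, integrated over the disc of radius \<open>r / 2\<close>,
    whose measure is \<open>V\<close>.\<close>
  define C2 where "C2 = 2 + 2 * (r ^ (2 * n) * C1) * V"
  have C2: "C2 \<ge> 0" using Suc.prems C1(1) V by (simp add: C2_def)
  show ?case
  proof (intro exI[of _ "2 * (C3 * C2) + 2 * C1"] conjI allI impI)
    show "0 \<le> 2 * (C3 * C2) + 2 * C1" using C1(1) C2 C3(1) by simp
    fix q assume q: "\<forall>k<Suc n. q k holomorphic_on (UNIV :: complex set)"
    define F where "F = (\<lambda>z. \<Sum>k<Suc n. cnj z ^ k * q k z)"
    define F' where "F' = (\<lambda>z. \<Sum>k<n. cnj z ^ k * q k z)"
    define I where "I = (LINT z:ball 0 r|lborel. (cmod (F z))\<^sup>2)"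
    have contF: "continuous_on UNIV F" unfolding F_def
      using q by (intro continuous_on_polyanalytic) auto
    have contF': "continuous_on UNIV F'" unfolding F'_def
      using q by (intro continuous_on_polyanalytic) auto
    have FF': "F z = F' z + cnj z ^ n * q n z" for z by (simp add: F_def F'_def)
    have I: "I \<ge> 0" by (auto simp: I_def set_lebesgue_integral_def intro!: integral_nonneg)
    \<comment> \<open>For such \<open>a\<close> the disc of radius \<open>r / 2\<close> about
      \<open>a\<close> lies in the disc of radius \<open>r\<close> about 0, so the single integral
      \<open>I\<close> controls the top coefficient throughout the half disc.\<close>
    have qn: "(cmod (q n a))\<^sup>2 \<le> C1 * I" if "cmod a < r / 2" for a
    proof -
      have "(cmod (q n a))\<^sup>2 \<le> C1 * (LINT z:ball a (r/2)|lborel. (cmod (F z))\<^sup>2)"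
        unfolding F_def by (rule C1(2)[OF q])
      also have "\<dots> \<le> C1 * I"
        unfolding I_def using that
        by (intro mult_left_mono C1(1) set_integral_ball_mono continuous_intros contF)
           (auto simp: ball_subset_ball_iff)
      finally show ?thesis .
    qed
    have "(LINT z:ball 0 (r/2)|lborel. (cmod (F' z))\<^sup>2) \<le>
       (LINT z:ball 0 (r/2)|lborel. 2 * (cmod (F z))\<^sup>2 + 2 * (r ^ (2 * n) * (C1 * I)))"
    proof (intro set_integral_mono set_integrable_ball_continuous continuous_intros contF contF')
      fix z :: complex assume z: "z \<in> ball 0 (r/2)"
      have "(cmod (F' z))\<^sup>2 = (cmod (F z + - (cnj z ^ n * q n z)))\<^sup>2" by (simp add: FF')
      also have "\<dots> \<le> 2 * (cmod (F z))\<^sup>2 + 2 * (cmod (- (cnj z ^ n * q n z)))\<^sup>2"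
        by (rule square_cmod_add_le)
      also have "(cmod (- (cnj z ^ n * q n z)))\<^sup>2 = cmod z ^ (2 * n) * (cmod (q n z))\<^sup>2"
        by (simp add: norm_mult norm_power power_mult_distrib power_mult[symmetric] mult.commute)
      also have "\<dots> \<le> r ^ (2 * n) * (C1 * I)"
        using z Suc.prems by (intro mult_mono power_mono qn) auto
      finally show "(cmod (F' z))\<^sup>2 \<le> 2 * (cmod (F z))\<^sup>2 + 2 * (r ^ (2 * n) * (C1 * I))" by simp
    qed
    also have "\<dots> = 2 * (LINT z:ball 0 (r/2)|lborel. (cmod (F z))\<^sup>2) + 2 * (r ^ (2 * n) * (C1 * I)) * V"
      using emeasure_lborel_ball_finite[of "0::complex" "r / 2"]
        set_integrable_ball_continuous[of "\<lambda>z. (cmod (F z))\<^sup>2"]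
      by (subst set_integral_add)
         (auto simp: V_def set_integral_const less_top intro!: set_integrable_ball_continuous continuous_intros contF)
    also have "\<dots> \<le> 2 * I + 2 * (r ^ (2 * n) * (C1 * I)) * V"
      unfolding I_def by (intro add_mono mult_left_mono set_integral_ball_mono continuous_intros contF)
        (use Suc.prems I[unfolded I_def] C1(1) in \<open>auto simp: ball_subset_ball_iff V_def intro!: mult_nonneg_nonneg\<close>)
    also have "\<dots> = C2 * I" by (simp add: C2_def algebra_simps)
    finally have *: "(LINT z:ball 0 (r/2)|lborel. (cmod (F' z))\<^sup>2) \<le> C2 * I" .
    have "(cmod (F 0))\<^sup>2 \<le> 2 * (cmod (F' 0))\<^sup>2 + 2 * (cmod (0 ^ n * q n 0))\<^sup>2"
      using square_cmod_add_le[of "F' 0" "0 ^ n * q n 0"] by (simp add: FF')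
    also have "(cmod (0 ^ n * q n 0))\<^sup>2 \<le> (cmod (q n 0))\<^sup>2"
      by (cases "n = 0") (auto simp: power_0_left)
    also have "(cmod (q n 0))\<^sup>2 \<le> C1 * I" using Suc.prems by (intro qn) auto
    also have "(cmod (F' 0))\<^sup>2 \<le> C3 * (C2 * I)"
    proof -
      have "(cmod (F' 0))\<^sup>2 \<le> C3 * (LINT z:ball 0 (r/2)|lborel. (cmod (F' z))\<^sup>2)"
        unfolding F'_def using q by (intro C3(2)) auto
      also have "\<dots> \<le> C3 * (C2 * I)" by (intro mult_left_mono * C3(1))
      finally show ?thesis .
    qed
    finally show "(cmod (\<Sum>k<Suc n. cnj 0 ^ k * q k 0))\<^sup>2 \<le> (2 * (C3 * C2) + 2 * C1) *
       (LINT z:ball 0 r|lborel. (cmod (\<Sum>k<Suc n. cnj z ^ k * q k z))\<^sup>2)"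
      by (simp add: F_def I_def algebra_simps)
  qed
qed

lemma polyanalytic_bound:
  assumes r: "r > 0"
  shows "\<exists>C\<ge>0. \<forall>q a. (\<forall>k<n. q k holomorphic_on UNIV) \<longrightarrow>
    (cmod (\<Sum>k<n. cnj a ^ k * q k a))\<^sup>2 \<le> C * (LINT z:ball a r|lborel. (cmod (\<Sum>k<n. cnj z ^ k * q k z))\<^sup>2)"
proof -
  from polyanalytic_bound_0[OF r, of n] obtain C where C: "C \<ge> 0"
    "\<And>q. (\<forall>k<n. q k holomorphic_on UNIV) \<Longrightarrow>
    (cmod (\<Sum>k<n. cnj 0 ^ k * q k 0))\<^sup>2 \<le> C * (LINT z:ball 0 r|lborel. (cmod (\<Sum>k<n. cnj z ^ k * q k z))\<^sup>2)"
    by blast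
  show ?thesis
  proof (intro exI[of _ C] conjI allI impI C(1))
    fix q a assume q: "\<forall>k<n. q k holomorphic_on (UNIV :: complex set)"
    define q' where "q' = (\<lambda>p z. \<Sum>k<n. of_nat (k choose p) * cnj a ^ (k - p) * q k (z + a))"
    have sh: "(\<Sum>k<n. cnj z ^ k * q' k z) = (\<Sum>k<n. cnj (z + a) ^ k * q k (z + a))" for z
      unfolding q'_def by (rule polyanalytic_shift[symmetric])
    have "\<forall>k<n. q' k holomorphic_on UNIV"
      unfolding q'_def using q by (intro allI impI holomorphic_intros holomorphic_on_shift) auto
    from C(2)[OF this] have "(cmod (\<Sum>k<n. cnj (0 + a) ^ k * q k (0 + a)))\<^sup>2 \<le>
        C * (LINT z:ball 0 r|lborel. (cmod (\<Sum>k<n. cnj (z + a) ^ k * q k (z + a)))\<^sup>2)"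
      by (simp only: sh)
    also have "(LINT z:ball 0 r|lborel. (cmod (\<Sum>k<n. cnj (z + a) ^ k * q k (z + a)))\<^sup>2) =
      (LINT z:ball a r|lborel. (cmod (\<Sum>k<n. cnj z ^ k * q k z))\<^sup>2)"
      using q by (intro set_integral_ball_shift[where f = "\<lambda>z. (cmod (\<Sum>k<n. cnj z ^ k * q k z))\<^sup>2"]
        borel_measurable_continuous_onI continuous_intros continuous_on_polyanalytic) auto
    finally show "(cmod (\<Sum>k<n. cnj a ^ k * q k a))\<^sup>2 \<le> C * (LINT z:ball a r|lborel. (cmod (\<Sum>k<n. cnj z ^ k * q k z))\<^sup>2)"
      by simp
  qed
qed

text \<open>Multiplying by $e^{-\pi\bar a z}$ centres the Gaussian weight at $a$.\<close>

lemma cmod_exp_gauss_centre: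
  "(cmod (exp (- (of_real pi * cnj a * z))))\<^sup>2 =
     exp (pi * (cmod (z - a))\<^sup>2 - pi * (cmod a)\<^sup>2) * exp (- pi * (cmod z)\<^sup>2)"
proof -
  have "(cmod (z - a))\<^sup>2 = (cmod z)\<^sup>2 + (cmod a)\<^sup>2 - 2 * Re (cnj a * z)"
    unfolding cmod_power2 by (simp add: power2_eq_square algebra_simps)
  then have "2 * Re (cnj a * z) = (cmod z)\<^sup>2 + (cmod a)\<^sup>2 - (cmod (z - a))\<^sup>2" by linarith
  moreover have "2 * Re (- (of_real pi * cnj a * z)) = - (pi * (2 * Re (cnj a * z)))"
    by (simp add: algebra_simps)
  ultimately have "2 * Re (- (of_real pi * cnj a * z)) = (pi * (cmod (z - a))\<^sup>2 - pi * (cmod a)\<^sup>2) + - pi * (cmod z)\<^sup>2"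
    by (simp only:) (simp add: algebra_simps)
  moreover have "(cmod (exp (- (of_real pi * cnj a * z))))\<^sup>2 = exp (2 * Re (- (of_real pi * cnj a * z)))"
    by (simp only: norm_exp_eq_Re exp_double)
  ultimately show ?thesis by (simp only: exp_add)
qed

text \<open>The exponential of \<open>cmod_exp_gauss_centre\<close> is holomorphic, so multiplying
  by it keeps the polyanalytic form. Afterwards the Gaussian weight varies over the disc by at most
  the factor \<open>exp (pi * r\<^sup>2)\<close>, and the unweighted bounds apply.\<close>

lemma polyanalytic_fock_bound:
  assumes r: "r > 0"
  obtains C where "C \<ge> 0"
    "\<And>q a. (\<forall>k<n. q k holomorphic_on UNIV) \<Longrightarrow>
       (cmod (\<Sum>k<n. cnj a ^ k * q k a))\<^sup>2 * exp (- pi * (cmod a)\<^sup>2) \<le>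
       C * (LINT z:ball a r|lborel. (cmod (\<Sum>k<n. cnj z ^ k * q k z))\<^sup>2 * exp (- pi * (cmod z)\<^sup>2))"
    "\<And>q a m. n = Suc m \<Longrightarrow> (\<forall>k<n. q k holomorphic_on UNIV) \<Longrightarrow>
       (cmod (q m a))\<^sup>2 * exp (- pi * (cmod a)\<^sup>2) \<le>
       C * (LINT z:ball a r|lborel. (cmod (\<Sum>k<n. cnj z ^ k * q k z))\<^sup>2 * exp (- pi * (cmod z)\<^sup>2))"
proof -
  from polyanalytic_bound[OF r, of n] obtain C1 where C1: "C1 \<ge> 0"
    "\<And>q a. (\<forall>k<n. q k holomorphic_on UNIV) \<Longrightarrow> (cmod (\<Sum>k<n. cnj a ^ k * q k a))\<^sup>2 \<le>
      C1 * (LINT z:ball a r|lborel. (cmod (\<Sum>k<n. cnj z ^ k * q k z))\<^sup>2)" by blast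
  \<comment> \<open>\<open>Suc (n - 1)\<close> equals \<open>n\<close> in the only case for which
    this bound is claimed, \<open>n = Suc m\<close>.\<close>
  from top_coefficient_bound[OF r, of "n - 1"] obtain C2 where C2: "C2 \<ge> 0"
    "\<And>q a. (\<forall>k<Suc (n - 1). q k holomorphic_on UNIV) \<Longrightarrow> (cmod (q (n - 1) a))\<^sup>2 \<le>
      C2 * (LINT z:ball a r|lborel. (cmod (\<Sum>k<Suc (n - 1). cnj z ^ k * q k z))\<^sup>2)" by blast
  define C where "C = max C1 C2 * exp (pi * r\<^sup>2)"
  have main: "X * exp (- pi * (cmod a)\<^sup>2) \<le>
       C * (LINT z:ball a r|lborel. (cmod (\<Sum>k<n. cnj z ^ k * q k z))\<^sup>2 * exp (- pi * (cmod z)\<^sup>2))"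
    if q: "\<forall>k<n. q k holomorphic_on UNIV" and
      X: "X * (cmod (exp (- (of_real pi * cnj a * a))))\<^sup>2 \<le> max C1 C2 *
       (LINT z:ball a r|lborel. (cmod (\<Sum>k<n. cnj z ^ k * (q k z * exp (- (of_real pi * cnj a * z)))))\<^sup>2)"
    for X q a
  proof -
    define F where "F = (\<lambda>z. \<Sum>k<n. cnj z ^ k * q k z)"
    have contF: "continuous_on UNIV F" unfolding F_def
      using q by (intro continuous_on_polyanalytic) auto
    have eq: "(\<Sum>k<n. cnj z ^ k * (q k z * exp (- (of_real pi * cnj a * z)))) = F z * exp (- (of_real pi * cnj a * z))" for z
      by (simp add: F_def sum_distrib_right mult.assoc)
    have "X * exp (- pi * (cmod a)\<^sup>2) = X * (cmod (exp (- (of_real pi * cnj a * a))))\<^sup>2 * exp (pi * (cmod a)\<^sup>2)"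
      unfolding cmod_exp_gauss_centre by (simp add: exp_minus field_simps)
    also have "\<dots> \<le> max C1 C2 * (LINT z:ball a r|lborel. (cmod (F z * exp (- (of_real pi * cnj a * z))))\<^sup>2) * exp (pi * (cmod a)\<^sup>2)"
      using X unfolding eq by (intro mult_right_mono) auto
    also have "\<dots> = max C1 C2 * (LINT z:ball a r|lborel. (cmod (F z * exp (- (of_real pi * cnj a * z))))\<^sup>2 * exp (pi * (cmod a)\<^sup>2))"
      by simp
    also have "\<dots> \<le> max C1 C2 * (LINT z:ball a r|lborel. exp (pi * r\<^sup>2) * ((cmod (F z))\<^sup>2 * exp (- pi * (cmod z)\<^sup>2)))"
    proof (intro mult_left_mono set_integral_mono set_integrable_ball_continuous continuous_intros contF)
      fix z assume z: "z \<in> ball a r"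
      have "(cmod (F z * exp (- (of_real pi * cnj a * z))))\<^sup>2 * exp (pi * (cmod a)\<^sup>2) =
        ((cmod (F z))\<^sup>2 * exp (- pi * (cmod z)\<^sup>2)) * exp (pi * (cmod (z - a))\<^sup>2)"
        unfolding norm_mult power_mult_distrib cmod_exp_gauss_centre
        by (simp add: exp_diff field_simps)
      also have "\<dots> \<le> ((cmod (F z))\<^sup>2 * exp (- pi * (cmod z)\<^sup>2)) * exp (pi * r\<^sup>2)"
        using z by (intro mult_left_mono) (auto simp: dist_norm norm_minus_commute intro!: power_mono)
      finally show "(cmod (F z * exp (- (of_real pi * cnj a * z))))\<^sup>2 * exp (pi * (cmod a)\<^sup>2) \<le>
        exp (pi * r\<^sup>2) * ((cmod (F z))\<^sup>2 * exp (- pi * (cmod z)\<^sup>2))" by (simp add: mult_ac)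
    qed (use C1(1) in auto)
    finally show ?thesis by (simp add: C_def F_def mult_ac)
  qed
  show thesis
  proof (rule that[of C])
    show "C \<ge> 0" using C1(1) by (simp add: C_def)
  next
    fix q a assume q: "\<forall>k<n. q k holomorphic_on (UNIV :: complex set)"
    define q' where "q' = (\<lambda>k z. q k z * exp (- (of_real pi * cnj a * z)))"
    have q': "\<forall>k<n. q' k holomorphic_on UNIV"
      unfolding q'_def using q by (auto intro!: holomorphic_intros)
    have nn: "0 \<le> (LINT z:ball a r|lborel. (cmod (\<Sum>k<n. cnj z ^ k * q' k z))\<^sup>2)"
      by (auto simp: set_lebesgue_integral_def intro!: integral_nonneg)
    show "(cmod (\<Sum>k<n. cnj a ^ k * q k a))\<^sup>2 * exp (- pi * (cmod a)\<^sup>2) \<le>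
       C * (LINT z:ball a r|lborel. (cmod (\<Sum>k<n. cnj z ^ k * q k z))\<^sup>2 * exp (- pi * (cmod z)\<^sup>2))"
    proof (rule main[OF q])
      have "(cmod (\<Sum>k<n. cnj a ^ k * q k a))\<^sup>2 * (cmod (exp (- (of_real pi * cnj a * a))))\<^sup>2 =
          (cmod (\<Sum>k<n. cnj a ^ k * q' k a))\<^sup>2"
        unfolding q'_def mult.assoc[symmetric] sum_distrib_right[symmetric] norm_mult power_mult_distrib ..
      also have "\<dots> \<le> C1 * (LINT z:ball a r|lborel. (cmod (\<Sum>k<n. cnj z ^ k * q' k z))\<^sup>2)"
        by (rule C1(2)[OF q'])
      also have "\<dots> \<le> max C1 C2 * (LINT z:ball a r|lborel. (cmod (\<Sum>k<n. cnj z ^ k * q' k z))\<^sup>2)"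
        using nn by (intro mult_right_mono) auto
      finally show "(cmod (\<Sum>k<n. cnj a ^ k * q k a))\<^sup>2 * (cmod (exp (- (of_real pi * cnj a * a))))\<^sup>2 \<le>
        max C1 C2 * (LINT z:ball a r|lborel. (cmod (\<Sum>k<n. cnj z ^ k * (q k z * exp (- (of_real pi * cnj a * z)))))\<^sup>2)"
        by (simp add: q'_def)
    qed
    show "(cmod (q m a))\<^sup>2 * exp (- pi * (cmod a)\<^sup>2) \<le>
       C * (LINT z:ball a r|lborel. (cmod (\<Sum>k<n. cnj z ^ k * q k z))\<^sup>2 * exp (- pi * (cmod z)\<^sup>2))"
      if m: "n = Suc m" for m
    proof (rule main[OF q])
      have "(cmod (q m a))\<^sup>2 * (cmod (exp (- (of_real pi * cnj a * a))))\<^sup>2 = (cmod (q' m a))\<^sup>2"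
        by (simp add: q'_def norm_mult power_mult_distrib)
      also have "\<dots> \<le> C2 * (LINT z:ball a r|lborel. (cmod (\<Sum>k<n. cnj z ^ k * q' k z))\<^sup>2)"
        using C2(2)[of q' a] q' m by simp
      also have "\<dots> \<le> max C1 C2 * (LINT z:ball a r|lborel. (cmod (\<Sum>k<n. cnj z ^ k * q' k z))\<^sup>2)"
        using nn by (intro mult_right_mono) auto
      finally show "(cmod (q m a))\<^sup>2 * (cmod (exp (- (of_real pi * cnj a * a))))\<^sup>2 \<le>
        max C1 C2 * (LINT z:ball a r|lborel. (cmod (\<Sum>k<n. cnj z ^ k * (q k z * exp (- (of_real pi * cnj a * z)))))\<^sup>2)"
        by (simp add: q'_def)
    qed
  qed
qed

section \<open>Lattices and period cells\<close>

lemma summable_on_int_inverse_square: "(\<lambda>a::int. 1 / (1 + (real_of_int a)\<^sup>2)) summable_on UNIV"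
proof -
  have s: "summable (\<lambda>n::nat. 1 / (1 + (real n)\<^sup>2))"
  proof (rule summable_comparison_test'[where N = 1])
    show "summable (\<lambda>n. inverse (real n ^ 2))" by (rule inverse_power_summable) simp
  qed (auto simp: inverse_eq_divide intro!: frac_le)
  then have s': "summable (\<lambda>n::nat. 1 / (1 + (real (Suc n))\<^sup>2))"
    by (subst summable_Suc_iff)
  have p: "(\<lambda>a::int. 1 / (1 + (real_of_int a)\<^sup>2)) summable_on (range int)"
    using s by (subst summable_on_reindex) (auto simp: o_def intro!: norm_summable_imp_summable_on)
  have m: "(\<lambda>a::int. 1 / (1 + (real_of_int a)\<^sup>2)) summable_on (range (\<lambda>n. - int (Suc n)))"
  proof -
    have "(- 1 - real n)\<^sup>2 = (real (Suc n))\<^sup>2" for n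
      by (simp add: power2_eq_square algebra_simps)
    then show ?thesis
      using s' by (subst summable_on_reindex) (auto simp: o_def inj_on_def intro!: norm_summable_imp_summable_on)
  qed
  have "(UNIV :: int set) = range int \<union> range (\<lambda>n. - int (Suc n))"
  proof safe
    fix x :: int assume x: "x \<notin> range (\<lambda>n. - int (Suc n))"
    show "x \<in> range int"
    proof (cases x)
      case (neg n)
      then show ?thesis using x by blast
    qed auto
  qed auto
  then show ?thesis
    using summable_on_Un_disjoint[OF p m] by fastforce
qed

text \<open>The common majorant for lattice sums and plane integrals: decay of order -4 is summable
  over a planar lattice, and this is the square of the decay
  \<open>1 / (1 + (cmod z)\<^sup>2)\<close> of the test function in the necessity part.\<close>

definition invquart :: "complex \<Rightarrow> real" where
  "invquart z = 1 / (1 + (cmod z)\<^sup>2)\<^sup>2"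

lemma invquart_pos: "invquart z > 0"
  unfolding invquart_def by (intro divide_pos_pos zero_less_power add_pos_nonneg) auto

lemma continuous_on_invquart [continuous_intros]:
  "continuous_on S f \<Longrightarrow> continuous_on S (\<lambda>z. invquart (f z))"
proof -
  have ne: "(1 + (cmod z)\<^sup>2)\<^sup>2 \<noteq> 0" for z
    by (metis add_pos_nonneg less_irrefl power_not_zero zero_le_power2 zero_less_one)
  assume "continuous_on S f"
  then show "continuous_on S (\<lambda>z. invquart (f z))"
    unfolding invquart_def
    by (intro continuous_on_divide continuous_on_const continuous_on_power continuous_on_add continuous_on_norm ballI ne)
qed

text \<open>Peetre's inequality: a shift by \<open>w\<close> costs only a factor polynomial in
  \<open>cmod w\<close>, so bounded shifts leave the weight comparable.\<close>

lemma invquart_shift_le: "invquart z \<le> 4 * (1 + (cmod w)\<^sup>2)\<^sup>2 * invquart (z + w)"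
proof -
  have "(cmod (z + w))\<^sup>2 \<le> 2 * (cmod z)\<^sup>2 + 2 * (cmod w)\<^sup>2" by (rule square_cmod_add_le)
  also have "\<dots> \<le> 2 * (cmod z)\<^sup>2 + 2 * (cmod w)\<^sup>2 + 2 * ((cmod z)\<^sup>2 * (cmod w)\<^sup>2)" by simp
  finally have "1 + (cmod (z + w))\<^sup>2 \<le> 2 * (1 + (cmod w)\<^sup>2) * (1 + (cmod z)\<^sup>2)"
    by (simp add: algebra_simps)
  then have "(1 + (cmod (z + w))\<^sup>2)\<^sup>2 \<le> (2 * (1 + (cmod w)\<^sup>2) * (1 + (cmod z)\<^sup>2))\<^sup>2"
    by (intro power_mono) auto
  also have "\<dots> = 4 * (1 + (cmod w)\<^sup>2)\<^sup>2 * (1 + (cmod z)\<^sup>2)\<^sup>2"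
    by (simp only: power_mult_distrib) simp
  finally have *: "(1 + (cmod (z + w))\<^sup>2)\<^sup>2 \<le> 4 * (1 + (cmod w)\<^sup>2)\<^sup>2 * (1 + (cmod z)\<^sup>2)\<^sup>2" .
  have "0 < 1 + (cmod (z + w))\<^sup>2" "0 < 1 + (cmod z)\<^sup>2" by (simp_all add: add_pos_nonneg)
  with * show ?thesis by (simp add: invquart_def field_simps)
qed

text \<open>The condition says that the generators are independent over the reals and positively
  oriented. Orientation puts \<open>w2 / w1\<close> in the upper half plane and makes the boundary
  of the cell run counterclockwise.\<close>

locale complex_lattice =
  fixes w1 w2 :: complex
  assumes area_pos: "Im (cnj w1 * w2) > 0"
begin

definition area :: real where "area = Im (cnj w1 * w2)"
definition lp :: "int \<times> int \<Rightarrow> complex" where "lp m = of_int (fst m) * w1 + of_int (snd m) * w2"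
text \<open>\<open>xc\<close> and \<open>yc\<close> are the coordinates in the basis
  \<open>w1\<close>, \<open>w2\<close> by Cramer's rule, see \<open>coords\<close>. The cell is
  centred at 0 and half open, so that it contains exactly one point of every lattice coset.\<close>

definition xc :: "complex \<Rightarrow> real" where "xc z = Im (cnj z * w2) / area"
definition yc :: "complex \<Rightarrow> real" where "yc z = Im (cnj w1 * z) / area"
definition cell :: "complex set" where
  "cell = {z. - 1/2 \<le> xc z \<and> xc z < 1/2 \<and> - 1/2 \<le> yc z \<and> yc z < 1/2}"

lemma area_gt_0: "area > 0" using area_pos by (simp add: area_def)
lemma w1_nz: "w1 \<noteq> 0" and w2_nz: "w2 \<noteq> 0" using area_pos by auto

lemma coords: "of_real (xc z) * w1 + of_real (yc z) * w2 = z"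
proof -
  have "of_real area * (of_real (xc z) * w1 + of_real (yc z) * w2) =
        of_real (Im (cnj z * w2)) * w1 + of_real (Im (cnj w1 * z)) * w2"
    using area_gt_0 by (simp add: xc_def yc_def field_simps)
  also have "\<dots> = of_real area * z"
    by (simp add: area_def complex_eq_iff algebra_simps)
  finally show ?thesis using area_gt_0 by (metis mult_left_cancel of_real_eq_0_iff less_irrefl)
qed

lemma xc_add [simp]: "xc (z + w) = xc z + xc w" and yc_add [simp]: "yc (z + w) = yc z + yc w"
  and xc_diff [simp]: "xc (z - w) = xc z - xc w" and yc_diff [simp]: "yc (z - w) = yc z - yc w"
  and xc_minus [simp]: "xc (- z) = - xc z" and yc_minus [simp]: "yc (- z) = - yc z"
  and xc_0 [simp]: "xc 0 = 0" and yc_0 [simp]: "yc 0 = 0"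
  by (simp_all add: xc_def yc_def add_divide_distrib diff_divide_distrib algebra_simps)

lemma xc_scale [simp]: "xc (of_real r * z) = r * xc z" and yc_scale [simp]: "yc (of_real r * z) = r * yc z"
  by (simp_all add: xc_def yc_def algebra_simps)

lemma xc_w1 [simp]: "xc w1 = 1" and xc_w2 [simp]: "xc w2 = 0"
  and yc_w1 [simp]: "yc w1 = 0" and yc_w2 [simp]: "yc w2 = 1"
  using area_gt_0 by (simp_all add: xc_def yc_def area_def algebra_simps)

lemma xc_lp [simp]: "xc (lp m) = of_int (fst m)" and yc_lp [simp]: "yc (lp m) = of_int (snd m)"
  using xc_scale[of "of_int (fst m)" w1] xc_scale[of "of_int (snd m)" w2]
    yc_scale[of "of_int (fst m)" w1] yc_scale[of "of_int (snd m)" w2]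
  by (simp_all add: lp_def)

lemma xc_yc_eqI: "xc z = xc w \<Longrightarrow> yc z = yc w \<Longrightarrow> z = w"
  using coords[of z] coords[of w] by metis

lemma inj_lp: "inj lp"
  by (rule injI) (metis of_int_eq_iff prod_eq_iff xc_lp yc_lp)

lemma lp_0 [simp]: "lp 0 = 0" by (simp add: lp_def)
lemma lp_add: "lp (m + k) = lp m + lp k" by (simp add: lp_def algebra_simps)
lemma lp_minus: "lp (- m) = - lp m" by (simp add: lp_def algebra_simps)
lemma lp_diff: "lp (m - k) = lp m - lp k" by (simp add: lp_def algebra_simps)

lemma lp_eq_0_iff [simp]: "lp m = 0 \<longleftrightarrow> m = 0"
  using inj_lp lp_0 by (metis injD)

lemma cont_xc [continuous_intros]: "continuous_on S f \<Longrightarrow> continuous_on S (\<lambda>z. xc (f z))"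
  and cont_yc [continuous_intros]: "continuous_on S f \<Longrightarrow> continuous_on S (\<lambda>z. yc (f z))"
  unfolding xc_def yc_def using area_gt_0 by (auto intro!: continuous_intros)

lemma measurable_xc [measurable]: "xc \<in> borel_measurable borel"
  and measurable_yc [measurable]: "yc \<in> borel_measurable borel"
  by (auto intro!: borel_measurable_continuous_onI continuous_intros)

lemma sets_cell [measurable]: "cell \<in> sets borel"
proof -
  have "cell = {z \<in> space borel. - 1/2 \<le> xc z \<and> xc z < 1/2 \<and> - 1/2 \<le> yc z \<and> yc z < 1/2}"
    by (auto simp: cell_def)
  also have "\<dots> \<in> sets borel" by measurable
  finally show ?thesis .
qed

definition ccell :: "complex set" where "ccell = {z. \<bar>xc z\<bar> \<le> 1/2 \<and> \<bar>yc z\<bar> \<le> 1/2}"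
definition diam :: real where "diam = cmod w1 + cmod w2"

lemma cell_subset_ccell: "cell \<subseteq> ccell"
  by (auto simp: cell_def ccell_def)

lemma norm_ccell: "z \<in> ccell \<Longrightarrow> cmod z \<le> diam"
proof -
  assume z: "z \<in> ccell"
  have "cmod z = cmod (of_real (xc z) * w1 + of_real (yc z) * w2)" by (simp add: coords)
  also have "\<dots> \<le> \<bar>xc z\<bar> * cmod w1 + \<bar>yc z\<bar> * cmod w2"
    by (rule norm_triangle_le) (simp add: norm_mult)
  also have "\<dots> \<le> 1 * cmod w1 + 1 * cmod w2"
    using z by (intro add_mono mult_right_mono) (auto simp: ccell_def)
  finally show ?thesis by (simp add: diam_def)
qed

lemma norm_cell: "z \<in> cell \<Longrightarrow> cmod z \<le> diam"
  using norm_ccell cell_subset_ccell by auto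

lemma compact_ccell: "compact ccell"
proof -
  have "ccell = (\<lambda>z. \<bar>xc z\<bar>) -` {..1/2} \<inter> (\<lambda>z. \<bar>yc z\<bar>) -` {..1/2}"
    by (auto simp: ccell_def)
  moreover have "closed ((\<lambda>z. \<bar>xc z\<bar>) -` {..1/2})" "closed ((\<lambda>z. \<bar>yc z\<bar>) -` {..1/2})"
    by (intro closed_vimage continuous_intros closed_atMost)+
  ultimately have "closed ccell" by auto
  moreover have "bounded ccell" by (rule boundedI) (rule norm_ccell)
  ultimately show ?thesis by (simp add: compact_eq_bounded_closed)
qed

lemma abs_xc_le: "\<bar>xc z\<bar> \<le> cmod w2 / area * cmod z" and abs_yc_le: "\<bar>yc z\<bar> \<le> cmod w1 / area * cmod z"
  using area_gt_0 abs_Im_le_cmod[of "cnj z * w2"] abs_Im_le_cmod[of "cnj w1 * z"]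
  by (auto simp: xc_def yc_def abs_divide norm_mult field_simps)

lemma small_ball_subset_cell: obtains r where "r > 0" "ball (0::complex) r \<subseteq> cell"
proof
  \<comment> \<open>Both coordinates are at most \<open>diam / area\<close> times the modulus, so
    within this radius they do not exceed \<open>1/4\<close>.\<close>
  define r where "r = area / (4 * diam)"
  have d: "diam > 0" using w1_nz w2_nz by (simp add: diam_def add_pos_pos)
  show "r > 0" using area_gt_0 d by (simp add: r_def)
  show "ball 0 r \<subseteq> cell"
  proof
    fix z :: complex assume z: "z \<in> ball 0 r"
    have *: "a / area * cmod z < 1/2" if "0 \<le> a" "a \<le> diam" for a
    proof -
      have "a / area * cmod z \<le> diam / area * r"
        using that z area_gt_0 by (intro mult_mono divide_right_mono) auto
      also have "\<dots> < 1/2" using d area_gt_0 by (simp add: r_def)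
      finally show ?thesis .
    qed
    have "\<bar>xc z\<bar> < 1/2" by (rule le_less_trans[OF abs_xc_le *]) (simp_all add: diam_def)
    moreover have "\<bar>yc z\<bar> < 1/2" by (rule le_less_trans[OF abs_yc_le *]) (simp_all add: diam_def)
    ultimately show "z \<in> cell" by (auto simp: cell_def)
  qed
qed

definition vol :: real where "vol = measure lborel cell"

lemma emeasure_cell: "emeasure lborel cell = vol"
  and vol_pos: "vol > 0"
proof -
  have "emeasure lborel cell \<le> emeasure lborel ccell"
    using cell_subset_ccell compact_ccell by (intro emeasure_mono) (auto intro: borel_compact)
  also have "\<dots> < \<infinity>" using compact_ccell by (rule emeasure_compact_finite)
  finally show 1: "emeasure lborel cell = vol"
    by (simp add: vol_def emeasure_eq_ennreal_measure less_top)
  obtain r where r: "r > 0" "ball 0 r \<subseteq> cell" by (rule small_ball_subset_cell)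
  have "0 < emeasure lborel (ball (0::complex) r)"
    using content_ball_pos[OF r(1), of "0::complex"] emeasure_lborel_ball_finite[of "0::complex" r]
    by (simp add: emeasure_eq_ennreal_measure less_top)
  also have "\<dots> \<le> emeasure lborel cell" using r by (intro emeasure_mono) auto
  finally show "vol > 0" using 1 by simp
qed

lemma unique_translate: "\<exists>!m. z + lp m \<in> cell"
proof (rule ex_ex1I)
  have ex: "\<exists>a::int. - 1/2 \<le> x + of_int a \<and> x + of_int a < 1/2" for x :: real
    by (rule exI[of _ "- \<lfloor>x + 1/2\<rfloor>"]) linarith
  obtain a b :: int where "- 1/2 \<le> xc z + of_int a" "xc z + of_int a < 1/2"
    "- 1/2 \<le> yc z + of_int b" "yc z + of_int b < 1/2"
    using ex by meson
  then have "z + lp (a, b) \<in> cell" by (simp add: cell_def)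
  then show "\<exists>m. z + lp m \<in> cell" ..
  have un: "a = b" if "- 1/2 \<le> x + of_int a" "x + of_int a < 1/2" "- 1/2 \<le> x + of_int b" "x + of_int b < 1/2"
    for x :: real and a b :: int
    using that by linarith
  fix m k assume "z + lp m \<in> cell" "z + lp k \<in> cell"
  then show "m = k"
    using un[of "xc z" "fst m" "fst k"] un[of "yc z" "snd m" "snd k"]
    by (auto simp: cell_def prod_eq_iff)
qed

text \<open>Turns unordered sums over the lattice into series over \<open>nat\<close>, the form in
  which sums and Bochner integrals are interchanged.\<close>

definition enum :: "nat \<Rightarrow> int \<times> int" where "enum = from_nat_into UNIV"

lemma bij_enum: "bij enum"
  unfolding enum_def by (rule bij_betw_from_nat_into) (auto simp: finite_prod)

text \<open>The cells tile the plane, so exactly one term is nonzero; multiplying by these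
  indicators decomposes a function into its pieces on translated cells.\<close>

lemma indicator_enum_sums:
  fixes x :: "'b::real_normed_vector"
  shows "(\<lambda>i. indicat_real cell (z + lp (enum i)) *\<^sub>R x) sums x"
    "summable (\<lambda>i. norm (indicat_real cell (z + lp (enum i)) *\<^sub>R x))"
proof -
  obtain m where m: "z + lp m \<in> cell" "\<And>k. z + lp k \<in> cell \<Longrightarrow> k = m"
    using unique_translate[of z] by blast
  obtain j where j: "enum j = m" using bij_enum by (metis bij_pointE)
  have *: "indicat_real cell (z + lp (enum i)) *\<^sub>R x = (if i = j then x else 0)" for i
  proof (cases "i = j")
    case False
    then have "enum i \<noteq> m" using j bij_enum by (metis bij_is_inj injD)
    then have "z + lp (enum i) \<notin> cell" using m(2) by blast
    then show ?thesis using False by simp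
  qed (use m(1) j in simp)
  show "(\<lambda>i. indicat_real cell (z + lp (enum i)) *\<^sub>R x) sums x"
    unfolding * using sums_single[of j "\<lambda>_. x"] by (simp add: eq_commute)
  show "summable (\<lambda>i. norm (indicat_real cell (z + lp (enum i)) *\<^sub>R x))"
    unfolding * by (intro summable_finite[of "{j}"]) auto
qed

section \<open>Integrals over the plane as sums over lattice cells\<close>

lemma
  fixes g :: "complex \<Rightarrow> 'b::{banach, second_countable_topology}"
  assumes [measurable]: "g \<in> borel_measurable borel"
  shows cell_shift_integral:
    "(LINT z|lborel. indicat_real cell (z + lp m) *\<^sub>R g z) = (LINT z:cell|lborel. g (z - lp m))"
    and cell_shift_integrable:
    "integrable lborel (\<lambda>z. indicat_real cell (z + lp m) *\<^sub>R g z) \<longleftrightarrow> set_integrable lborel cell (\<lambda>z. g (z - lp m))"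
proof -
  have [measurable]: "(\<lambda>z. indicat_real cell z *\<^sub>R g (z - lp m)) \<in> borel_measurable borel"
    by measurable
  show "(LINT z|lborel. indicat_real cell (z + lp m) *\<^sub>R g z) = (LINT z:cell|lborel. g (z - lp m))"
    using integral_lborel_shift[of "\<lambda>z. indicat_real cell z *\<^sub>R g (z - lp m)" "lp m"]
    by (simp add: set_lebesgue_integral_def add.commute)
  show "integrable lborel (\<lambda>z. indicat_real cell (z + lp m) *\<^sub>R g z) \<longleftrightarrow> set_integrable lborel cell (\<lambda>z. g (z - lp m))"
    using integrable_lborel_shift[of "\<lambda>z. indicat_real cell z *\<^sub>R g (z - lp m)" "lp m"]
    by (simp add: set_integrable_def add.commute)
qed

lemma integrable_from_cells:
  fixes g :: "complex \<Rightarrow> 'b::{banach, second_countable_topology}"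
  assumes g [measurable]: "g \<in> borel_measurable borel"
    and bound: "\<And>m z. z \<in> cell \<Longrightarrow> norm (g (z + lp m)) \<le> B m" and B: "B summable_on UNIV"
  shows "integrable lborel g"
proof -
  \<comment> \<open>The cell integrals involve \<open>z - lp m\<close> whereas the bound is stated
    for \<open>z + lp m\<close>; reflecting the index set reconciles them.\<close>
  define B' where "B' = (\<lambda>m. B (- m))"
  have B0: "0 \<le> B m" for m
  proof -
    have "0 \<in> cell" by (simp add: cell_def)
    from order_trans[OF norm_ge_zero bound[OF this]] show ?thesis .
  qed
  have "B' summable_on UNIV"
    unfolding B'_def using B by (subst summable_on_reindex_bij_betw[of uminus]) (auto intro: bij_uminus)
  then have "(\<lambda>i. B' (enum i)) summable_on UNIV"
    by (subst summable_on_reindex_bij_betw[OF bij_enum])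
  then have sB: "summable (\<lambda>i. B' (enum i))" by (rule summable_on_imp_summable)
  have vc: "set_integrable lborel cell (\<lambda>z. c :: real)" for c
    by (simp add: set_integrable_def emeasure_cell)
  have bd: "norm (g (z - lp m)) \<le> B' m" if "z \<in> cell" for z m
    using bound[OF that, of "- m"] by (simp add: B'_def lp_minus)
  have si: "set_integrable lborel cell (\<lambda>z. g (z - lp m))" for m
  proof (rule set_integrable_bound[OF vc[of "B' m"]])
    show "set_borel_measurable lborel cell (\<lambda>z. g (z - lp m))"
      unfolding set_borel_measurable_def by measurable
  qed (use bd B0 in \<open>auto simp: B'_def\<close>)
  have "integrable lborel (\<lambda>z. \<Sum>i. indicat_real cell (z + lp (enum i)) *\<^sub>R g z)"
  proof (rule integrable_suminf)
    show "integrable lborel (\<lambda>z. indicat_real cell (z + lp (enum i)) *\<^sub>R g z)" for i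
      using si by (subst cell_shift_integrable) auto
    show "AE z in lborel. summable (\<lambda>i. norm (indicat_real cell (z + lp (enum i)) *\<^sub>R g z))"
      by (intro AE_I2 indicator_enum_sums(2))
    show "summable (\<lambda>i. LINT z|lborel. norm (indicat_real cell (z + lp (enum i)) *\<^sub>R g z))"
    proof (rule summable_comparison_test'[OF summable_mult[OF sB, of vol]])
      fix i
      have "(LINT z|lborel. norm (indicat_real cell (z + lp (enum i)) *\<^sub>R g z)) =
        (LINT z|lborel. indicat_real cell (z + lp (enum i)) *\<^sub>R norm (g z))" by simp
      also have "\<dots> = (LINT z:cell|lborel. norm (g (z - lp (enum i))))"
        by (subst cell_shift_integral) auto
      also have "\<dots> \<le> (LINT z:cell|lborel. B' (enum i))"
        using bd vc by (intro set_integral_mono set_integrable_norm si) auto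
      also have "\<dots> = vol * B' (enum i)"
        using emeasure_cell by (subst set_integral_const) (auto simp: vol_def)
      finally show "norm (LINT z|lborel. norm (indicat_real cell (z + lp (enum i)) *\<^sub>R g z)) \<le> vol * B' (enum i)"
        by simp
    qed
  qed
  also have "(\<lambda>z. \<Sum>i. indicat_real cell (z + lp (enum i)) *\<^sub>R g z) = g"
    by (intro ext sums_unique[symmetric] indicator_enum_sums(1))
  finally show ?thesis .
qed

text \<open>Countable additivity over the tiling. Absolute summability comes from the partial sums,
  which are integrals of functions bounded by \<open>norm (g z)\<close>.\<close>

lemma
  fixes g :: "complex \<Rightarrow> 'b::{banach, second_countable_topology}"
  assumes int: "integrable lborel g"
  shows cell_integrals_summable: "summable (\<lambda>i. LINT z:cell|lborel. norm (g (z - lp (enum i))))"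
    and cell_integrals_sums: "(\<lambda>i. LINT z:cell|lborel. g (z - lp (enum i))) sums (LINT z|lborel. g z)"
    and cell_set_integrable: "set_integrable lborel cell (\<lambda>z. g (z - lp m))"
proof -
  have [measurable]: "g \<in> borel_measurable borel"
    using borel_measurable_integrable[OF int] by simp
  have i1: "integrable lborel (\<lambda>z. indicat_real cell (z + lp m) *\<^sub>R g z)" for m
  proof (rule Bochner_Integration.integrable_bound[OF int])
    show "(\<lambda>z. indicat_real cell (z + lp m) *\<^sub>R g z) \<in> borel_measurable lborel" by measurable
    show "AE z in lborel. norm (indicat_real cell (z + lp m) *\<^sub>R g z) \<le> norm (g z)"
      by (rule AE_I2) (simp add: indicator_def)
  qed
  then show si: "set_integrable lborel cell (\<lambda>z. g (z - lp m))" for m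
    using cell_shift_integrable[of g m] by simp
  have n: "(LINT z|lborel. norm (indicat_real cell (z + lp m) *\<^sub>R g z)) = (LINT z:cell|lborel. norm (g (z - lp m)))" for m
    using cell_shift_integral[of "\<lambda>z. norm (g z)" m] by simp
  show s: "summable (\<lambda>i. LINT z:cell|lborel. norm (g (z - lp (enum i))))"
  proof (rule bounded_imp_summable)
    show "0 \<le> (LINT z:cell|lborel. norm (g (z - lp (enum i))))" for i
      by (auto simp: set_lebesgue_integral_def intro!: integral_nonneg)
    fix k
    have "(LINT z|lborel. (\<Sum>i\<le>k. norm (indicat_real cell (z + lp (enum i)) *\<^sub>R g z))) =
      (\<Sum>i\<le>k. LINT z|lborel. norm (indicat_real cell (z + lp (enum i)) *\<^sub>R g z))"
      by (rule Bochner_Integration.integral_sum) (rule integrable_norm[OF i1])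
    then have "(\<Sum>i\<le>k. LINT z:cell|lborel. norm (g (z - lp (enum i)))) =
      (LINT z|lborel. (\<Sum>i\<le>k. norm (indicat_real cell (z + lp (enum i)) *\<^sub>R g z)))"
      by (simp only: n)
    also have "\<dots> \<le> (LINT z|lborel. norm (g z))"
    proof (rule integral_mono)
      fix z
      have *: "(\<lambda>i. norm (indicat_real cell (z + lp (enum i)) *\<^sub>R g z)) sums norm (g z)"
        using indicator_enum_sums(1)[of z "norm (g z)"] by simp
      have "(\<Sum>i\<le>k. norm (indicat_real cell (z + lp (enum i)) *\<^sub>R g z)) \<le>
          (\<Sum>i. norm (indicat_real cell (z + lp (enum i)) *\<^sub>R g z))"
        by (rule sum_le_suminf[OF sums_summable[OF *] finite_atMost norm_ge_zero])
      also have "\<dots> = norm (g z)" by (rule sums_unique[OF *, symmetric])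
      finally show "(\<Sum>i\<le>k. norm (indicat_real cell (z + lp (enum i)) *\<^sub>R g z)) \<le> norm (g z)" .
    next
      show "integrable lborel (\<lambda>z. \<Sum>i\<le>k. norm (indicat_real cell (z + lp (enum i)) *\<^sub>R g z))"
        by (intro Bochner_Integration.integrable_sum integrable_norm i1)
      show "integrable lborel (\<lambda>z. norm (g z))" by (intro integrable_norm int)
    qed
    finally show "(\<Sum>i\<le>k. LINT z:cell|lborel. norm (g (z - lp (enum i)))) \<le> (LINT z|lborel. norm (g z))" .
  qed
  have su: "summable (\<lambda>i. LINT z|lborel. norm (indicat_real cell (z + lp (enum i)) *\<^sub>R g z))"
    using s by (simp only: n)
  have "(\<lambda>i. LINT z|lborel. indicat_real cell (z + lp (enum i)) *\<^sub>R g z) sums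
    (LINT z|lborel. (\<Sum>i. indicat_real cell (z + lp (enum i)) *\<^sub>R g z))"
    by (rule sums_integral[OF i1 AE_I2[OF indicator_enum_sums(2)] su])
  also have "(\<lambda>z. \<Sum>i. indicat_real cell (z + lp (enum i)) *\<^sub>R g z) = g"
    by (intro ext sums_unique[symmetric] indicator_enum_sums(1))
  finally show "(\<lambda>i. LINT z:cell|lborel. g (z - lp (enum i))) sums (LINT z|lborel. g z)"
    by (simp add: cell_shift_integral)
qed

text \<open>Unfolding: the integral of \<open>g\<close> over the plane is that of its periodisation
  \<open>S\<close> over one cell. The pointwise sum is asked for almost everywhere only, since later
  it is evaluated off the boundary of the cell.\<close>

lemma
  fixes g :: "complex \<Rightarrow> 'b::{banach, second_countable_topology}"
  assumes int: "integrable lborel g"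
    and S: "AE z in lborel. z \<in> cell \<longrightarrow> ((\<lambda>m. g (z + lp m)) has_sum S z) UNIV \<and> (\<lambda>m. norm (g (z + lp m))) summable_on UNIV"
    and [measurable]: "S \<in> borel_measurable borel"
  shows integral_unfold: "(LINT z|lborel. g z) = (LINT z:cell|lborel. S z)"
proof -
  have S': "AE z in lborel. z \<in> cell \<longrightarrow> (\<lambda>i. g (z - lp (enum i))) sums S z \<and> summable (\<lambda>i. norm (g (z - lp (enum i))))"
    using S
  proof eventually_elim
    case (elim z)
    have bij: "bij (\<lambda>i. - enum i)"
      using bij_comp[OF bij_enum bij_uminus] by (simp add: o_def)
    show ?case
    proof
      assume "z \<in> cell"
      then have 1: "((\<lambda>m. g (z + lp m)) has_sum S z) UNIV" "(\<lambda>m. norm (g (z + lp m))) summable_on UNIV"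
        using elim by auto
      have "((\<lambda>i. g (z + lp (- enum i))) has_sum S z) UNIV"
        using 1(1) by (subst has_sum_reindex_bij_betw[OF bij])
      moreover have "(\<lambda>i. norm (g (z + lp (- enum i)))) summable_on UNIV"
        using 1(2) by (subst summable_on_reindex_bij_betw[OF bij])
      ultimately show "(\<lambda>i. g (z - lp (enum i))) sums S z \<and> summable (\<lambda>i. norm (g (z - lp (enum i))))"
        by (auto simp: lp_minus intro: has_sum_imp_sums summable_on_imp_summable)
    qed
  qed
  have [measurable]: "g \<in> borel_measurable borel"
    using borel_measurable_integrable[OF int] by simp
  have "(\<lambda>i. LINT z|lborel. indicat_real cell z *\<^sub>R g (z - lp (enum i))) sums
     (LINT z|lborel. (\<Sum>i. indicat_real cell z *\<^sub>R g (z - lp (enum i))))"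
  proof (rule sums_integral)
    show "integrable lborel (\<lambda>z. indicat_real cell z *\<^sub>R g (z - lp (enum i)))" for i
      using cell_set_integrable[OF int] by (simp add: set_integrable_def)
    show "AE z in lborel. summable (\<lambda>i. norm (indicat_real cell z *\<^sub>R g (z - lp (enum i))))"
      using S' by eventually_elim (auto simp: indicator_def)
    show "summable (\<lambda>i. LINT z|lborel. norm (indicat_real cell z *\<^sub>R g (z - lp (enum i))))"
      using cell_integrals_summable[OF int] by (simp add: set_lebesgue_integral_def)
  qed
  also have "(LINT z|lborel. (\<Sum>i. indicat_real cell z *\<^sub>R g (z - lp (enum i)))) = (LINT z:cell|lborel. S z)"
    unfolding set_lebesgue_integral_def
  proof (intro integral_cong_AE)
    show "AE z in lborel. (\<Sum>i. indicat_real cell z *\<^sub>R g (z - lp (enum i))) = indicat_real cell z *\<^sub>R S z"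
      using S' by eventually_elim (auto simp: indicator_def sums_iff)
  qed measurable
  finally show ?thesis
    using cell_integrals_sums[OF int] by (simp add: sums_iff set_lebesgue_integral_def)
qed

text \<open>The translated cell is another fundamental domain. Unfolding \<open>h\<close> cut off to
  it leaves a single term for each \<open>z\<close>, and the periodisation is \<open>h\<close>
  itself.\<close>

lemma cell_integral_translate:
  fixes h :: "complex \<Rightarrow> complex"
  assumes cont: "continuous_on UNIV h" and per: "\<And>z m. h (z + lp m) = h z"
  shows "(LINT z:cell|lborel. h (z + t)) = (LINT z:cell|lborel. h z)"
proof -
  have [measurable]: "h \<in> borel_measurable borel" using cont by (rule borel_measurable_continuous_onI)
  have ic: "set_integrable lborel cell (\<lambda>z. h (z + t))"
  proof (rule set_integrable_subset)
    show "set_integrable lborel ccell (\<lambda>z. h (z + t))"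
      unfolding set_integrable_def
      by (intro borel_integrable_compact compact_ccell continuous_on_compose2[OF cont] continuous_intros) auto
  qed (use cell_subset_ccell in auto)
  have meas: "(\<lambda>z. indicat_real cell z *\<^sub>R h (z + t)) \<in> borel_measurable borel" by measurable
  have meas': "(\<lambda>z. indicat_real cell (z - t) *\<^sub>R h z) \<in> borel_measurable borel" by measurable
  have "(LINT z|lborel. indicat_real cell (z - t) *\<^sub>R h z) = (LINT z:cell|lborel. h z)"
  proof (rule integral_unfold)
    show "integrable lborel (\<lambda>z. indicat_real cell (z - t) *\<^sub>R h z)"
      using ic integrable_lborel_shift[OF meas', of t] by (simp add: set_integrable_def add.commute)
    show "AE z in lborel. z \<in> cell \<longrightarrow> ((\<lambda>m. indicat_real cell (z + lp m - t) *\<^sub>R h (z + lp m)) has_sum h z) UNIV \<and>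
       (\<lambda>m. norm (indicat_real cell (z + lp m - t) *\<^sub>R h (z + lp m))) summable_on UNIV"
    proof (intro AE_I2 impI)
      fix z
      obtain m where m: "(z - t) + lp m \<in> cell" "\<And>k. (z - t) + lp k \<in> cell \<Longrightarrow> k = m"
        using unique_translate[of "z - t"] by blast
      have *: "indicat_real cell (z + lp k - t) *\<^sub>R h (z + lp k) = (if k = m then h z else 0)" for k
      proof -
        have eq: "z + lp k - t = z - t + lp k" by simp
        have e: "z + lp k - t \<in> cell \<longleftrightarrow> k = m" unfolding eq using m by blast
        show ?thesis by (simp add: indicator_def e per)
      qed
      show "((\<lambda>m. indicat_real cell (z + lp m - t) *\<^sub>R h (z + lp m)) has_sum h z) UNIV \<and>
       (\<lambda>m. norm (indicat_real cell (z + lp m - t) *\<^sub>R h (z + lp m))) summable_on UNIV"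
        unfolding * 
        using has_sum_finite_neutralI[of "{m}" UNIV "\<lambda>k. if k = m then h z else 0" "h z"]
          has_sum_finite_neutralI[of "{m}" UNIV "\<lambda>k. norm (if k = m then h z else 0)" "norm (h z)"]
        by (auto simp: summable_on_def)
    qed
  qed measurable
  then show ?thesis
    using integral_lborel_shift[OF meas', of t] by (simp add: set_lebesgue_integral_def add.commute)
qed

text \<open>Both \<open>1 + a^2\<close> and \<open>1 + b^2\<close> are bounded by a multiple of
  \<open>1 + (cmod (lp (a, b)))\<^sup>2\<close>; multiplying the two bounds reduces the planar sum
  to a product of one-dimensional sums.\<close>

lemma invquart_summable: "(\<lambda>m. invquart (lp m)) summable_on UNIV"
proof -
  define c where "c = (cmod w1 + cmod w2) / area"
  have c: "c > 0" using area_gt_0 w1_nz by (simp add: c_def add_pos_nonneg)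
  define K where "K = 1 + c\<^sup>2"
  have K: "K \<ge> 1" by (simp add: K_def)
  have bd: "1 + (real_of_int a)\<^sup>2 \<le> K * (1 + (cmod (lp (a, b)))\<^sup>2)"
    "1 + (real_of_int b)\<^sup>2 \<le> K * (1 + (cmod (lp (a, b)))\<^sup>2)" for a b
  proof -
    have "\<bar>real_of_int a\<bar> \<le> c * cmod (lp (a, b))"
      using abs_xc_le[of "lp (a, b)"] area_gt_0
      by (auto simp: c_def add_divide_distrib distrib_right intro: order_trans)
    then have "\<bar>real_of_int a\<bar>\<^sup>2 \<le> (c * cmod (lp (a, b)))\<^sup>2" by (intro power_mono) auto
    then show "1 + (real_of_int a)\<^sup>2 \<le> K * (1 + (cmod (lp (a, b)))\<^sup>2)"
      by (simp add: K_def power_mult_distrib algebra_simps) (smt (verit) zero_le_power2)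
    have "\<bar>real_of_int b\<bar> \<le> c * cmod (lp (a, b))"
      using abs_yc_le[of "lp (a, b)"] area_gt_0
      by (auto simp: c_def add_divide_distrib distrib_right intro: order_trans)
    then have "\<bar>real_of_int b\<bar>\<^sup>2 \<le> (c * cmod (lp (a, b)))\<^sup>2" by (intro power_mono) auto
    then show "1 + (real_of_int b)\<^sup>2 \<le> K * (1 + (cmod (lp (a, b)))\<^sup>2)"
      by (simp add: K_def power_mult_distrib algebra_simps) (smt (verit) zero_le_power2)
  qed
  define u where "u = (\<lambda>a::int. 1 / (1 + (real_of_int a)\<^sup>2))"
  have u: "u summable_on UNIV" unfolding u_def by (rule summable_on_int_inverse_square)
  have upos: "u a > 0" for a by (simp add: u_def add_pos_nonneg)
  obtain U where U: "(u has_sum U) UNIV" using u by (auto simp: summable_on_def)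
  have "(\<lambda>(a, b). u a * u b) summable_on (UNIV \<times> UNIV)"
  proof (rule summable_on_SigmaI[where g = "\<lambda>a. u a * U"])
    show "((\<lambda>y. case (a, y) of (a, b) \<Rightarrow> u a * u b) has_sum u a * U) UNIV" for a
      using has_sum_cmult_right[OF U] by simp
    show "(\<lambda>a. u a * U) summable_on UNIV" using u by (rule summable_on_cmult_left)
  qed (use upos in \<open>auto simp: less_imp_le\<close>)
  then have "(\<lambda>m. K\<^sup>2 * (u (fst m) * u (snd m))) summable_on UNIV"
    by (intro summable_on_cmult_right) (simp only: case_prod_unfold UNIV_Times_UNIV)
  then show ?thesis
  proof (rule summable_on_comparison_test)
    fix m :: "int \<times> int"
    obtain a b where m: "m = (a, b)" by (cases m)
    have p: "1 + (real_of_int a)\<^sup>2 > 0" "1 + (real_of_int b)\<^sup>2 > 0" "1 + (cmod (lp m))\<^sup>2 > 0"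
      by (simp_all add: add_pos_nonneg)
    have "(1 + (real_of_int a)\<^sup>2) * (1 + (real_of_int b)\<^sup>2) \<le> (K * (1 + (cmod (lp m))\<^sup>2)) * (K * (1 + (cmod (lp m))\<^sup>2))"
      using bd(1)[of a b] bd(2)[of b a] p K by (intro mult_mono) (auto simp: m)
    also have "\<dots> = K\<^sup>2 * (1 + (cmod (lp m))\<^sup>2)\<^sup>2" by (simp add: power2_eq_square)
    finally have *: "(1 + (real_of_int a)\<^sup>2) * (1 + (real_of_int b)\<^sup>2) \<le> K\<^sup>2 * (1 + (cmod (lp m))\<^sup>2)\<^sup>2" .
    have aux: "1 / Y \<le> k * (1 / A * (1 / B))" if "0 < A" "0 < B" "0 < Y" "A * B \<le> k * Y" for A B Y k :: real
      using that by (simp add: field_simps)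
    from aux[OF p(1,2) zero_less_power[OF p(3)] *]
    show "invquart (lp m) \<le> K\<^sup>2 * (u (fst m) * u (snd m))"
      by (simp only: invquart_def u_def m fst_conv snd_conv)
    show "0 \<le> invquart (lp m)" using invquart_pos[of "lp m"] by simp
  qed
qed

text \<open>The sum is invariant under lattice shifts of \<open>z\<close>, so \<open>z\<close> may
  be moved into the cell, where the Peetre bound compares it with the sum at 0; hence one constant
  for all \<open>z\<close>.\<close>

lemma invquart_translates:
  obtains C where "C \<ge> 0" "\<And>z. (\<lambda>m. invquart (z + lp m)) summable_on UNIV"
    "\<And>z. (\<Sum>\<^sub>\<infinity>m. invquart (z + lp m)) \<le> C"
proof -
  define K where "K = 4 * (1 + diam\<^sup>2)\<^sup>2"
  define C where "C = K * (\<Sum>\<^sub>\<infinity>m. invquart (lp m))"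
  have K: "K \<ge> 0" by (simp add: K_def)
  have le: "invquart (z + lp m) \<le> K * invquart (lp m)" if "z \<in> cell" for z m
  proof -
    have "invquart (z + lp m) \<le> 4 * (1 + (cmod (- z))\<^sup>2)\<^sup>2 * invquart (z + lp m + (- z))"
      by (rule invquart_shift_le)
    also have "\<dots> \<le> K * invquart (lp m)"
      using norm_cell[OF that] invquart_pos[of "lp m"]
      by (auto simp: K_def intro!: mult_right_mono mult_left_mono power_mono)
    finally show ?thesis .
  qed
  have 1: "(\<lambda>m. invquart (z + lp m)) summable_on UNIV \<and> (\<Sum>\<^sub>\<infinity>m. invquart (z + lp m)) \<le> C" if z: "z \<in> cell" for z
  proof
    have sK: "(\<lambda>m. K * invquart (lp m)) summable_on UNIV" by (intro summable_on_cmult_right invquart_summable)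
    show s: "(\<lambda>m. invquart (z + lp m)) summable_on UNIV"
      by (rule summable_on_comparison_test[OF sK le[OF z] less_imp_le[OF invquart_pos]])
    have "(\<Sum>\<^sub>\<infinity>m. invquart (z + lp m)) \<le> (\<Sum>\<^sub>\<infinity>m. K * invquart (lp m))"
      by (rule infsum_mono[OF s sK le[OF z]])
    also have "\<dots> = C" unfolding C_def using invquart_summable by (intro infsum_cmult_right)
    finally show "(\<Sum>\<^sub>\<infinity>m. invquart (z + lp m)) \<le> C" .
  qed
  have 2: "(\<lambda>m. invquart (z + lp m)) summable_on UNIV \<and> (\<Sum>\<^sub>\<infinity>m. invquart (z + lp m)) \<le> C" for z
  proof -
    obtain k where k: "z + lp k \<in> cell" using unique_translate[of z] by blast
    have bij: "bij (\<lambda>m. m - k)" by (rule bij_betwI[where g = "\<lambda>m. m + k"]) auto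
    have "(\<lambda>m. invquart (z + lp m)) summable_on UNIV \<longleftrightarrow> (\<lambda>m. invquart ((z + lp k) + lp (m - k))) summable_on UNIV"
      by (simp add: lp_diff algebra_simps)
    moreover have "(\<Sum>\<^sub>\<infinity>m. invquart (z + lp m)) = (\<Sum>\<^sub>\<infinity>m. invquart ((z + lp k) + lp (m - k)))"
      by (simp add: lp_diff algebra_simps)
    ultimately show ?thesis
      using 1[OF k] summable_on_reindex_bij_betw[OF bij, of "\<lambda>m. invquart (z + lp k + lp m)"]
        infsum_reindex_bij_betw[OF bij, of "\<lambda>m. invquart (z + lp k + lp m)"] by simp
  qed
  have "C \<ge> 0" unfolding C_def
    by (intro mult_nonneg_nonneg infsum_nonneg K less_imp_le[OF invquart_pos])
  then show thesis using that 2 by blast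
qed

lemma integrable_invquart: "integrable lborel invquart"
proof (rule integrable_from_cells)
  define K where "K = 4 * (1 + diam\<^sup>2)\<^sup>2"
  show "invquart \<in> borel_measurable borel"
    by (intro borel_measurable_continuous_onI continuous_intros)
  show "(\<lambda>m. K * invquart (lp m)) summable_on UNIV"
    by (intro summable_on_cmult_right invquart_summable)
  fix m z assume z: "z \<in> cell"
  have "invquart (z + lp m) \<le> 4 * (1 + (cmod (- z))\<^sup>2)\<^sup>2 * invquart (z + lp m + (- z))"
    by (rule invquart_shift_le)
  also have "\<dots> \<le> K * invquart (lp m)"
    using norm_cell[OF z] invquart_pos[of "lp m"]
    by (auto simp: K_def intro!: mult_right_mono mult_left_mono power_mono)
  finally show "norm (invquart (z + lp m)) \<le> K * invquart (lp m)"
    using invquart_pos[of "z + lp m"] by simp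
qed

end

section \<open>Characters and Fourier uniqueness on a cell\<close>

text \<open>The symplectic character: with the pairing \<open>Im (cnj z * \<nu>)\<close> the dual of
  a lattice is the lattice itself divided by its area, with no rotation. The exponent is kept in
  this form so that it can be merged with Gaussian exponents.\<close>

definition chi :: "complex \<Rightarrow> complex \<Rightarrow> complex" where
  "chi \<nu> z = exp (of_real pi * (cnj z * \<nu> - z * cnj \<nu>))"

lemma chi_eq_cis: "chi \<nu> z = cis (2 * pi * Im (cnj z * \<nu>))"
proof -
  have "of_real pi * (cnj z * \<nu> - z * cnj \<nu>) = \<i> * of_real (2 * pi * Im (cnj z * \<nu>))"
    by (simp add: complex_eq_iff algebra_simps)
  then show ?thesis by (simp only: chi_def cis_conv_exp)
qed

lemma norm_chi [simp]: "cmod (chi \<nu> z) = 1"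
  by (simp add: chi_eq_cis)

lemma chi_add: "chi \<nu> (z + w) = chi \<nu> z * chi \<nu> w"
  and chi_add_left: "chi (\<nu> + \<mu>) z = chi \<nu> z * chi \<mu> z"
  by (simp_all add: chi_eq_cis cis_mult algebra_simps)

lemma chi_0 [simp]: "chi 0 z = 1" "chi \<nu> 0 = 1"
  by (simp_all add: chi_eq_cis)

lemma continuous_on_chi [continuous_intros]:
  "continuous_on S f \<Longrightarrow> continuous_on S (\<lambda>z. chi \<nu> (f z))"
  unfolding chi_def by (intro continuous_intros)

section \<open>Orthogonality of characters and uniqueness of Fourier coefficients\<close>

context complex_lattice
begin

lemma chi_dual: "chi (lp m / of_real area) z = cis (2 * pi * (of_int (snd m) * xc z - of_int (fst m) * yc z))"
proof -
  have "Im (cnj z * (lp m / of_real area)) = of_int (snd m) * xc z - of_int (fst m) * yc z"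
  proof -
    have "cnj z * (lp m / of_real area) = (cnj z * lp m) / of_real area" by simp
    then have "Im (cnj z * (lp m / of_real area)) = Im (cnj z * lp m) / area"
      by (simp only: Im_divide_of_real)
    also have "Im (cnj z * lp m) = of_int (snd m) * Im (cnj z * w2) - of_int (fst m) * Im (cnj w1 * z)"
      by (simp add: lp_def algebra_simps)
    finally show ?thesis by (simp only: xc_def yc_def times_divide_eq_right diff_divide_distrib)
  qed
  then show ?thesis by (simp add: chi_eq_cis)
qed

lemma chi_dual_lp [simp]: "chi (lp m / of_real area) (lp k) = 1"
proof -
  have "2 * pi * (of_int (snd m) * xc (lp k) - of_int (fst m) * yc (lp k)) =
     2 * pi * of_int (snd m * fst k - fst m * snd k)"
    by simp
  then show ?thesis unfolding chi_dual by (simp only: cis_multiple_2pi Ints_of_int)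
qed

lemma set_integrable_cell:
  fixes f :: "complex \<Rightarrow> 'b::{banach, second_countable_topology}"
  assumes "continuous_on UNIV f"
  shows "set_integrable lborel cell f"
proof (rule set_integrable_subset)
  show "set_integrable lborel ccell f"
    unfolding set_integrable_def
    by (intro borel_integrable_compact compact_ccell continuous_on_subset[OF assms]) auto
qed (use cell_subset_ccell in auto)

text \<open>Translating by \<open>t\<close> leaves the integral unchanged but multiplies it by
  \<open>chi \<nu> t\<close>; it suffices that this factor differs from 1 for some
  \<open>t\<close>.\<close>

lemma integral_chi_cell:
  assumes per: "\<And>m. chi \<nu> (lp m) = 1" and ne: "\<nu> \<noteq> 0"
  shows "(LINT z:cell|lborel. chi \<nu> z) = 0"
proof -
  obtain t where t: "chi \<nu> t \<noteq> 1"
  proof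
    \<comment> \<open>Chosen to make \<open>Im (cnj t * \<nu>)\<close> equal to \<open>1/4\<close>,
      hence \<open>chi \<nu> t\<close> equal to the imaginary unit.\<close>
    define t where "t = - (\<i> * \<nu>) * of_real (1 / (4 * (cmod \<nu>)\<^sup>2))"
    have "cnj t * \<nu> = \<i> * (of_real ((cmod \<nu>)\<^sup>2) * of_real (1 / (4 * (cmod \<nu>)\<^sup>2)))"
      by (simp only: t_def complex_norm_square) simp
    also have "\<dots> = \<i> / 4"
    proof -
      have "(cmod \<nu>)\<^sup>2 * (1 / (4 * (cmod \<nu>)\<^sup>2)) = 1 / 4" using ne by simp
      then show ?thesis by (simp only: of_real_mult[symmetric]) simp
    qed
    finally have "Im (cnj t * \<nu>) = 1 / 4" by (simp only:) simp
    then have "chi \<nu> t = cis (pi / 2)" by (simp only: chi_eq_cis) simp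
    then show "chi \<nu> t \<noteq> 1" by (simp add: complex_eq_iff)
  qed
  have "(LINT z:cell|lborel. chi \<nu> (z + t)) = (LINT z:cell|lborel. chi \<nu> z)"
    by (rule cell_integral_translate) (auto intro!: continuous_intros simp: chi_add per)
  then have "(LINT z:cell|lborel. chi \<nu> z) * chi \<nu> t = (LINT z:cell|lborel. chi \<nu> z)"
    by (simp add: chi_add)
  then show ?thesis using t by simp
qed

text \<open>A trigonometric polynomial with values in the unit interval that reaches 1 on the closed
  cell only at 0; its powers concentrate at 0.\<close>

definition peak :: "complex \<Rightarrow> real" where
  "peak z = ((cos (pi * xc z))\<^sup>2 + (cos (pi * yc z))\<^sup>2) / 2"

lemma cont_peak [continuous_intros]:
  fixes f :: "complex \<Rightarrow> complex"
  shows "continuous_on S f \<Longrightarrow> continuous_on S (\<lambda>z. peak (f z))"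
  unfolding peak_def by (intro continuous_on_divide continuous_on_add continuous_on_power continuous_on_cos continuous_on_mult continuous_on_const cont_xc cont_yc) auto

lemma peak_chi: "of_real (peak z) = (4 + chi (lp (0, 1) / of_real area) z + chi (lp (0, -1) / of_real area) z
   + chi (lp (1, 0) / of_real area) z + chi (lp (-1, 0) / of_real area) z) / 8"
proof -
  have c: "of_real ((cos (pi * x))\<^sup>2) = (2 + cis (2 * pi * x) + cis (- (2 * pi * x))) / (4::complex)" for x
  proof -
    have "2 * (cos (pi * x))\<^sup>2 = 1 + cos (2 * pi * x)"
      using cos_double_cos[of "pi * x"] by (simp add: mult.assoc)
    then show ?thesis by (simp add: complex_eq_iff)
  qed
  have "of_real (peak z) = (complex_of_real ((cos (pi * xc z))\<^sup>2) + of_real ((cos (pi * yc z))\<^sup>2)) / 2"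
    by (simp add: peak_def)
  also have "\<dots> = (4 + cis (2 * pi * xc z) + cis (- (2 * pi * xc z)) + cis (- (2 * pi * yc z)) + cis (2 * pi * yc z)) / 8"
    unfolding c by (simp add: add_divide_distrib algebra_simps)
  finally show ?thesis by (simp add: chi_dual)
qed

lemma peak_nonneg: "peak z \<ge> 0" by (simp add: peak_def)

lemma peak_less_1: "z \<in> ccell \<Longrightarrow> z \<noteq> 0 \<Longrightarrow> peak z < 1"
proof -
  assume z: "z \<in> ccell" "z \<noteq> 0"
  have c: "(cos (pi * x))\<^sup>2 \<le> 1" for x
    using sin_cos_squared_add2[of "pi * x"] zero_le_power2[of "sin (pi * x)"] by linarith
  have s: "(cos (pi * x))\<^sup>2 < 1" if "\<bar>x\<bar> \<le> 1/2" "x \<noteq> 0" for x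
  proof -
    have "sin (pi * x) \<noteq> 0"
    proof
      assume "sin (pi * x) = 0"
      then obtain i :: int where "pi * x = of_int i * pi" by (auto simp: sin_zero_iff_int2)
      then have "x = of_int i" by simp
      with that show False by (cases "i = 0") (auto simp: abs_le_iff; linarith)+
    qed
    then have "0 < (sin (pi * x))\<^sup>2" by simp
    then show ?thesis using sin_cos_squared_add2[of "pi * x"] by linarith
  qed
  have "xc z \<noteq> 0 \<or> yc z \<noteq> 0" using z(2) xc_yc_eqI[of z 0] by auto
  then show ?thesis
    using s[of "xc z"] s[of "yc z"] c[of "xc z"] c[of "yc z"] z(1) by (auto simp: peak_def ccell_def)
qed

text \<open>If every coefficient vanishes, \<open>p\<close> is orthogonal to all powers of the
  trigonometric polynomial \<open>peak\<close>. These concentrate at 0, which is impossible when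
  \<open>p 0\<close> is nonzero.\<close>

lemma fourier_unique_at_0:
  assumes cont: "continuous_on UNIV p"
    and coeff: "\<And>m. (LINT z:cell|lborel. p z * chi (lp m / of_real area) z) = 0"
  shows "p 0 = 0"
proof (rule ccontr)
  assume p0: "p 0 \<noteq> 0"
  \<comment> \<open>Proved for all characters at once: by \<open>peak_chi\<close> one more factor
    \<open>peak\<close> is a combination of the trivial character and its four neighbours.\<close>
  have ker: "(LINT z:cell|lborel. p z * chi (lp m / of_real area) z * of_real (peak z ^ N)) = 0" for N m
  proof (induction N arbitrary: m)
    case 0
    then show ?case by (simp add: coeff)
  next
    case (Suc N)
    define J where "J = (\<lambda>k z. p z * chi (lp (m + k) / of_real area) z * of_real (peak z ^ N))"
    have intJ: "set_integrable lborel cell (J k)" for k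
      unfolding J_def by (intro set_integrable_cell continuous_intros cont)
    have J0: "(LINT z:cell|lborel. J k z) = 0" for k
      unfolding J_def by (rule Suc.IH)
    have "p z * chi (lp m / of_real area) z * of_real (peak z ^ Suc N) =
       (4 * J 0 z + J (0, 1) z + J (0, -1) z + J (1, 0) z + J (-1, 0) z) / 8" for z
    proof -
      have J: "J k z = p z * chi (lp m / of_real area) z * chi (lp k / of_real area) z * of_real (peak z ^ N)" for k
        by (simp add: J_def lp_add add_divide_distrib chi_add_left mult_ac)
      have "p z * chi (lp m / of_real area) z * of_real (peak z ^ Suc N) =
        of_real (peak z) * (p z * chi (lp m / of_real area) z * of_real (peak z ^ N))" by simp
      also have "\<dots> = (4 * J 0 z + J (0, 1) z + J (0, -1) z + J (1, 0) z + J (-1, 0) z) / 8"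
        unfolding peak_chi J by (simp add: algebra_simps add_divide_distrib)
      finally show ?thesis .
    qed
    then have "(LINT z:cell|lborel. p z * chi (lp m / of_real area) z * of_real (peak z ^ Suc N)) =
      (LINT z:cell|lborel. (4 * J 0 z + J (0, 1) z + J (0, -1) z + J (1, 0) z + J (-1, 0) z) / 8)"
      by (simp only:)
    also have "\<dots> = 0"
      using intJ by (simp add: set_integral_add J0)
    finally show ?case .
  qed
  \<comment> \<open>Division by \<open>p 0\<close> and passage to real parts normalise the value at
    0 to 1, so that \<open>P\<close> is positive near 0.\<close>
  define P where "P = (\<lambda>z. Re (p z / p 0))"
  have contP: "continuous_on UNIV P" unfolding P_def using p0 by (intro continuous_intros cont) auto
  have PN: "(LINT z:cell|lborel. P z * peak z ^ N) = 0" for N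
  proof -
    have i: "set_integrable lborel cell (\<lambda>z. (p z / p 0) * of_real (peak z ^ N))"
      using p0 by (intro set_integrable_cell continuous_intros cont) auto
    have "(LINT z:cell|lborel. (p z / p 0) * of_real (peak z ^ N)) = (LINT z:cell|lborel. p z * of_real (peak z ^ N)) / p 0"
      by simp
    also have "\<dots> = 0" using ker[of 0 N] by simp
    finally have "Re (LINT z:cell|lborel. (p z / p 0) * of_real (peak z ^ N)) = 0" by (simp only: zero_complex.simps)
    moreover have "Re (LINT z:cell|lborel. (p z / p 0) * of_real (peak z ^ N)) = (LINT z:cell|lborel. P z * peak z ^ N)"
    proof -
      have "(LINT z|lborel. Re (indicat_real cell z *\<^sub>R ((p z / p 0) * of_real (peak z ^ N)))) =
         Re (LINT z|lborel. indicat_real cell z *\<^sub>R ((p z / p 0) * of_real (peak z ^ N)))"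
        using i unfolding set_integrable_def by (rule integral_Re)
      moreover have "Re (indicat_real cell z *\<^sub>R ((p z / p 0) * of_real (peak z ^ N))) =
          indicat_real cell z *\<^sub>R (P z * peak z ^ N)" for z
      proof -
        have Rr: "Re (a * of_real r) = Re a * r" for a r by simp
        show ?thesis by (simp only: scaleR_complex.simps(1) P_def Rr real_scaleR_def)
      qed
      ultimately show ?thesis by (simp only: set_lebesgue_integral_def)
    qed
    ultimately show ?thesis by simp
  qed
  have P0: "P 0 = 1" using p0 by (simp add: P_def)
  obtain \<delta> where \<delta>: "\<delta> > 0" "\<And>z. cmod z < \<delta> \<Longrightarrow> P z > 1/2"
  proof -
    have "isCont P 0" using contP by (simp add: continuous_on_eq_continuous_at)
    then have "\<exists>d>0. \<forall>z. dist z 0 < d \<longrightarrow> dist (P z) (P 0) < 1/2"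
      unfolding continuous_at_eps_delta by (rule allE[of _ "1/2"]) simp
    then obtain d where "d > 0" "\<And>z. dist z 0 < d \<Longrightarrow> dist (P z) (P 0) < 1/2" by blast
    moreover have "P z > 1/2" if "dist (P z) (P 0) < 1/2" for z
      using that unfolding dist_real_def P0 by linarith
    ultimately show thesis by (intro that[of d]) (auto simp: dist_norm)
  qed
  obtain m where m: "0 \<le> m" "m < 1" "\<And>z. z \<in> ccell \<Longrightarrow> cmod z \<ge> \<delta> \<Longrightarrow> peak z \<le> m"
  proof (cases "ccell - ball 0 \<delta> = {}")
    case True
    then show thesis by (intro that[of 0]) auto
  next
    case False
    have "compact (ccell - ball 0 \<delta>)" using compact_ccell by (intro compact_diff) auto
    moreover have "continuous_on (ccell - ball 0 \<delta>) peak"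
      using cont_peak[OF continuous_on_id] by simp
    ultimately obtain z0 where z0: "z0 \<in> ccell - ball 0 \<delta>" "\<And>z. z \<in> ccell - ball 0 \<delta> \<Longrightarrow> peak z \<le> peak z0"
      using continuous_attains_sup[OF _ False, of peak] by blast
    have "z0 \<noteq> 0" using z0(1) \<delta>(1) by auto
    then show thesis
      using z0 \<delta>(1) peak_less_1[of z0] peak_nonneg[of z0] by (intro that[of "peak z0"]) auto
  qed
  \<comment> \<open>A level strictly between the bound \<open>m\<close> for \<open>peak\<close> away
    from 0 and its value 1 at 0; this gap makes the mass near 0 win exponentially.\<close>
  define m' where "m' = (1 + m) / 2"
  have m': "m < m'" "m' < 1" "0 < m'" using m by (auto simp: m'_def)
  obtain r0 where r0: "r0 > 0" "ball (0::complex) r0 \<subseteq> cell" by (rule small_ball_subset_cell)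
  have pk0: "peak 0 = 1" by (simp add: peak_def)
  obtain d where d: "d > 0" "\<And>z. cmod z < d \<Longrightarrow> peak z > m'"
  proof -
    have "continuous_on UNIV peak" using cont_peak[OF continuous_on_id] by simp
    then have "isCont peak 0" by (simp add: continuous_on_eq_continuous_at)
    then have "\<exists>d>0. \<forall>z. dist z 0 < d \<longrightarrow> dist (peak z) (peak 0) < 1 - m'"
      unfolding continuous_at_eps_delta by (rule allE[of _ "1 - m'"]) (use m' in simp)
    then obtain d where "d > 0" "\<And>z. dist z 0 < d \<Longrightarrow> dist (peak z) (peak 0) < 1 - m'" by blast
    moreover have "peak z > m'" if "dist (peak z) (peak 0) < 1 - m'" for z
      using that unfolding dist_real_def pk0 by linarith
    ultimately show thesis by (intro that[of d]) (auto simp: dist_norm)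
  qed
  define r where "r = min r0 (min d \<delta>)"
  define V where "V = ball (0::complex) r"
  have r: "r > 0" using r0 d \<delta> by (simp add: r_def)
  have V: "V \<subseteq> cell" using r0 by (auto simp: V_def r_def)
  have vV: "measure lborel V > 0" using content_ball_pos[OF r] by (simp add: V_def)
  have "bounded (P ` ccell)"
    by (intro compact_imp_bounded compact_continuous_image compact_ccell continuous_on_subset[OF contP]) auto
  then obtain B where B: "B > 0" "\<And>z. z \<in> ccell \<Longrightarrow> \<bar>P z\<bar> \<le> B"
    unfolding bounded_pos by auto
  \<comment> \<open>The small disc \<open>V\<close> contributes at least the left side, the region
    away from 0 at most the right side in absolute value, and what remains is nonnegative; the total
    is zero.\<close>
  have ineq: "measure lborel V / 2 * m' ^ N \<le> B * vol * m ^ N" for N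
  proof -
    have iV: "set_integrable lborel V (\<lambda>z. m' ^ N / 2)"
      unfolding V_def by (intro set_integrable_ball_continuous continuous_intros)
    have iC: "set_integrable lborel cell (\<lambda>z. B * m ^ N)"
      by (intro set_integrable_cell continuous_intros)
    have "(LINT z|lborel. indicat_real V z *\<^sub>R (m' ^ N / 2) - indicat_real cell z *\<^sub>R (B * m ^ N)) \<le>
      (LINT z|lborel. indicat_real cell z *\<^sub>R (P z * peak z ^ N))"
    proof (rule integral_mono)
      show "integrable lborel (\<lambda>z. indicat_real V z *\<^sub>R (m' ^ N / 2) - indicat_real cell z *\<^sub>R (B * m ^ N))"
        using iV iC unfolding set_integrable_def by (rule Bochner_Integration.integrable_diff)
      show "integrable lborel (\<lambda>z. indicat_real cell z *\<^sub>R (P z * peak z ^ N))"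
        unfolding set_integrable_def[symmetric] by (intro set_integrable_cell continuous_intros contP)
      fix z :: complex
      have mN: "0 \<le> B * m ^ N" using B m by simp
      have pN: "0 \<le> peak z ^ N" using peak_nonneg by simp
      show "indicat_real V z *\<^sub>R (m' ^ N / 2) - indicat_real cell z *\<^sub>R (B * m ^ N) \<le>
         indicat_real cell z *\<^sub>R (P z * peak z ^ N)"
      proof (cases "z \<in> cell")
        case False
        then show ?thesis using V by (auto simp: indicator_def)
      next
        case True
        then have zc: "z \<in> ccell" using cell_subset_ccell by auto
        show ?thesis
        proof (cases "cmod z < \<delta>")
          case d1: True
          show ?thesis
          proof (cases "z \<in> V")
            case zV: True
            have "m' ^ N \<le> peak z ^ N"
              using zV d(2)[of z] m' by (intro power_mono) (auto simp: V_def r_def)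
            moreover have "1/2 * peak z ^ N \<le> P z * peak z ^ N"
              using \<delta>(2)[OF d1] pN by (intro mult_right_mono) auto
            ultimately show ?thesis using True zV mN by simp
          next
            case False
            have "0 \<le> P z * peak z ^ N" using \<delta>(2)[OF d1] pN by (intro mult_nonneg_nonneg) auto
            then show ?thesis using True False mN by simp
          qed
        next
          case False
          then have zV: "z \<notin> V" by (simp add: V_def r_def)
          have "\<bar>P z * peak z ^ N\<bar> \<le> B * m ^ N"
            using B(2)[OF zc] m(3)[OF zc] False peak_nonneg[of z] m(1) B(1)
            unfolding abs_mult power_abs by (intro mult_mono power_mono) auto
          then show ?thesis using True zV by simp
        qed
      qed
    qed
    also have "\<dots> = 0" using PN by (simp add: set_lebesgue_integral_def)
    also have "(LINT z|lborel. indicat_real V z *\<^sub>R (m' ^ N / 2) - indicat_real cell z *\<^sub>R (B * m ^ N)) =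
       (LINT z:V|lborel. m' ^ N / 2) - (LINT z:cell|lborel. B * m ^ N)"
      using iV iC unfolding set_integrable_def set_lebesgue_integral_def by (rule Bochner_Integration.integral_diff)
    also have "\<dots> = measure lborel V * (m' ^ N / 2) - vol * (B * m ^ N)"
      using emeasure_cell emeasure_lborel_ball_finite[of "0::complex" r]
      by (subst (1 2) set_integral_const) (auto simp: vol_def V_def)
    finally show ?thesis by (simp add: algebra_simps)
  qed
  have "(\<lambda>N. (m / m') ^ N) \<longlonglongrightarrow> 0"
    using m m' by (intro LIMSEQ_power_zero) (auto simp: abs_of_nonneg)
  then have lim: "(\<lambda>N. B * vol * (m / m') ^ N) \<longlonglongrightarrow> B * vol * 0" by (intro tendsto_mult_left)
  have "measure lborel V / 2 \<le> B * vol * (m / m') ^ N" for N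
    using ineq[of N] m' by (simp add: power_divide field_simps)
  then have "measure lborel V / 2 \<le> B * vol * 0"
    using lim by (intro tendsto_lowerbound[OF lim]) auto
  then show False using vV by simp
qed

end

section \<open>The sigma function\<close>

text \<open>\<open>A\<close> is the product $\prod_{n\ge 0}(1 - zq^n)$.\<close>

lemma q_product_exists:
  fixes q :: complex
  assumes q: "q \<noteq> 0" "cmod q < 1"
  obtains A where "A holomorphic_on UNIV" "\<And>z. A z = (1 - z) * A (q * z)"
    "\<And>z. A z = 0 \<Longrightarrow> \<exists>n. z * q ^ n = 1"
proof -
  \<comment> \<open>The prescribed zeros \<open>inverse (q ^ n)\<close> grow geometrically, so
    factors of rank 0, that is plain linear factors, already converge.\<close>
  interpret W: weierstrass_product "\<lambda>n. inverse (q ^ n)" "\<lambda>_. 0"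
  proof
    show "inverse (q ^ n) \<noteq> 0" for n using q by simp
    have "filterlim (\<lambda>n. q ^ n) (at 0) sequentially"
      unfolding filterlim_at using LIMSEQ_power_zero[OF q(2)] q(1) by auto
    then show "filterlim (\<lambda>n. inverse (q ^ n)) at_infinity sequentially"
      by (rule filterlim_compose[OF filterlim_inverse_at_infinity])
    show "summable (\<lambda>n. (r / cmod (inverse (q ^ n))) ^ Suc 0)" for r
      using q(2) by (simp add: norm_inverse norm_power summable_mult summable_geometric divide_inverse)
  qed
  have hp: "(\<lambda>n. 1 - z * q ^ n) has_prod W.f z" for z
    using W.has_prod[of z] by (simp add: weierstrass_factor_def divide_inverse)
  show thesis
  proof
    show "W.f holomorphic_on UNIV" by (rule W.holomorphic)
    show "W.f z = (1 - z) * W.f (q * z)" for z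
    proof -
      have "(\<lambda>n. 1 - z * q ^ Suc n) has_prod W.f (q * z)"
        using hp[of "q * z"] by (simp add: mult_ac)
      from has_prod_Suc_imp[OF this] have "(\<lambda>n. 1 - z * q ^ n) has_prod (W.f (q * z) * (1 - z))" by simp
      then show ?thesis using hp[of z] has_prod_unique2 by (metis mult.commute)
    qed
    show "\<exists>n. z * q ^ n = 1" if "W.f z = 0" for z
    proof -
      from that obtain n where "z = inverse (q ^ n)" unfolding W.zero by auto
      then have "z * q ^ n = 1" using q by simp
      then show ?thesis ..
    qed
  qed
qed

section \<open>A sigma function from the theta product\<close>

context complex_lattice
begin

text \<open>In the variable \<open>e w\<close> the product \<open>\<theta>\<close> is Jacobi's theta
  function up to a constant factor: invariant under \<open>w1\<close> and multiplied by
  \<open>- 1 / e w\<close> under \<open>w2\<close>. A quadratic exponential distributes this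
  asymmetric behaviour evenly over both generators, which is the normalisation that makes the
  modulus times a Gaussian periodic.\<close>

lemma sigma_exists:
  obtains \<sigma> where "\<sigma> holomorphic_on UNIV"
    "\<And>w. \<sigma> (w + w1) = - exp (of_real (pi / area) * (cnj w1 * w + (cmod w1)\<^sup>2 / 2)) * \<sigma> w"
    "\<And>w. \<sigma> (w + w2) = - exp (of_real (pi / area) * (cnj w2 * w + (cmod w2)\<^sup>2 / 2)) * \<sigma> w"
    "\<And>w. w \<notin> range lp \<Longrightarrow> \<sigma> w \<noteq> 0" "\<sigma> 0 = 0" "deriv \<sigma> 0 \<noteq> 0"
proof -
  define \<tau> where "\<tau> = w2 / w1"
  define q where "q = exp (2 * of_real pi * \<i> * \<tau>)"
  have "\<tau> = cnj w1 * w2 / of_real ((cmod w1)\<^sup>2)"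
    unfolding complex_norm_square using w1_nz by (simp add: \<tau>_def field_simps)
  then have "Im \<tau> = area / (cmod w1)\<^sup>2"
    by (simp only: Im_divide_of_real area_def)
  then have Im\<tau>: "Im \<tau> > 0" using area_gt_0 w1_nz by simp
  have q: "q \<noteq> 0" "cmod q < 1" using Im\<tau> by (simp_all add: q_def)
  obtain A where A: "A holomorphic_on UNIV" "\<And>z. A z = (1 - z) * A (q * z)"
    "\<And>z. A z = 0 \<Longrightarrow> \<exists>n. z * q ^ n = 1"
    using q_product_exists[OF q] by blast
  have A1: "A 1 = 0" using A(2)[of 1] by simp
  have Aq: "A q \<noteq> 0"
  proof
    assume "A q = 0"
    then obtain n where "q * q ^ n = 1" using A(3) by blast
    then have "cmod q ^ Suc n = 1" by (metis norm_one norm_power power_Suc)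
    moreover have "cmod q ^ Suc n < 1" using q by (intro power_Suc_less_one) auto
    ultimately show False by simp
  qed
  define \<theta> where "\<theta> = (\<lambda>\<zeta>. A \<zeta> * A (q / \<zeta>))"
  have \<theta>q: "\<theta> (q * \<zeta>) = - (1 / \<zeta>) * \<theta> \<zeta>" if \<zeta>: "\<zeta> \<noteq> 0" for \<zeta>
  \<comment> \<open>At 1 the factor \<open>1 - \<zeta>\<close> cannot be cancelled; there both sides
    vanish because \<open>A 1 = 0\<close>.\<close>
  proof (cases "\<zeta> = 1")
    case True
    then show ?thesis using q A1 by (simp add: \<theta>_def)
  next
    case False
    have "(1 - \<zeta>) * \<theta> (q * \<zeta>) = ((1 - \<zeta>) * A (q * \<zeta>)) * A (1 / \<zeta>)"
      using q by (simp add: \<theta>_def)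
    also have "\<dots> = A \<zeta> * ((1 - 1 / \<zeta>) * A (q / \<zeta>))"
      using A(2)[of \<zeta>] A(2)[of "1 / \<zeta>"] by simp
    also have "\<dots> = (1 - \<zeta>) * (- (1 / \<zeta>) * \<theta> \<zeta>)"
      using \<zeta> by (simp add: \<theta>_def field_simps)
    finally show ?thesis
      by (rule mult_left_cancel[THEN iffD1, rotated]) (use False in simp)
  qed
  define e where "e = (\<lambda>w. exp (2 * of_real pi * \<i> * (w / w1)))"
  have e1: "e (w + w1) = e w" for w
    using w1_nz by (simp add: e_def add_divide_distrib distrib_left exp_add)
  have e2: "e (w + w2) = q * e w" for w
    unfolding e_def q_def \<tau>_def exp_add[symmetric]
    by (rule arg_cong[where f = exp]) (simp add: add_divide_distrib algebra_simps)
  have e0: "e w \<noteq> 0" for w by (simp add: e_def)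
  \<comment> \<open>\<open>\<alpha>\<close> produces the exponent \<open>cnj w1 * w\<close> demanded
    under \<open>w1\<close>, and \<open>\<beta>\<close> the sign, as \<open>\<beta> * w1\<close> is
    minus i pi. This leaves no freedom for \<open>w2\<close>.\<close>
  define \<alpha> where "\<alpha> = of_real pi * cnj w1 / (2 * of_real area * w1)"
  define \<beta> where "\<beta> = - (\<i> * of_real pi / w1)"
  define \<sigma> where "\<sigma> = (\<lambda>w. exp (\<alpha> * w\<^sup>2 + \<beta> * w) * \<theta> (e w))"
  have ea: "complex_of_real area \<noteq> 0" using area_gt_0 by simp
  \<comment> \<open>This identity plays the part of Legendre's relation: it brings the factor picked
    up under \<open>w2\<close> into the same shape as the one under \<open>w1\<close>.\<close>
  have ar: "cnj w1 * w2 - w1 * cnj w2 = 2 * \<i> * of_real area"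
    by (simp add: area_def complex_eq_iff)
  have n1: "complex_of_real ((cmod w1)\<^sup>2) = w1 * cnj w1" and n2: "complex_of_real ((cmod w2)\<^sup>2) = w2 * cnj w2"
    by (simp_all only: complex_norm_square)
  have n1h: "complex_of_real ((cmod w1)\<^sup>2 / 2) = w1 * cnj w1 / 2" and n2h: "complex_of_real ((cmod w2)\<^sup>2 / 2) = w2 * cnj w2 / 2"
    by (simp_all only: of_real_divide n1 n2) simp_all
  have s1: "\<sigma> (w + w1) = - exp (of_real (pi / area) * (cnj w1 * w + (cmod w1)\<^sup>2 / 2)) * \<sigma> w" for w
  proof -
    have "\<alpha> * (w + w1)\<^sup>2 + \<beta> * (w + w1) =
       (\<alpha> * w\<^sup>2 + \<beta> * w) + (\<alpha> * (2 * w * w1 + w1\<^sup>2) + \<beta> * w1)"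
      by (simp add: power2_eq_square algebra_simps)
    also have "\<alpha> * (2 * w * w1 + w1\<^sup>2) + \<beta> * w1 =
        of_real (pi / area) * (cnj w1 * w + (cmod w1)\<^sup>2 / 2) + - (\<i> * of_real pi)"
      unfolding n1h using w1_nz ea by (simp add: \<alpha>_def \<beta>_def power2_eq_square field_simps)
    finally have "exp (\<alpha> * (w + w1)\<^sup>2 + \<beta> * (w + w1)) =
      exp (\<alpha> * w\<^sup>2 + \<beta> * w) * (exp (of_real (pi / area) * (cnj w1 * w + (cmod w1)\<^sup>2 / 2)) * exp (- (\<i> * of_real pi)))"
      by (simp only: exp_add)
    then show ?thesis by (simp add: \<sigma>_def e1 exp_minus)
  qed
  have s2: "\<sigma> (w + w2) = - exp (of_real (pi / area) * (cnj w2 * w + (cmod w2)\<^sup>2 / 2)) * \<sigma> w" for w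
  proof -
    have "\<alpha> * (w + w2)\<^sup>2 + \<beta> * (w + w2) =
       (\<alpha> * w\<^sup>2 + \<beta> * w) + ((\<alpha> * (2 * w * w2 + w2\<^sup>2) + \<beta> * w2 - 2 * of_real pi * \<i> * (w / w1)) + 2 * of_real pi * \<i> * (w / w1))"
      by (simp add: power2_eq_square algebra_simps)
    also have "\<alpha> * (2 * w * w2 + w2\<^sup>2) + \<beta> * w2 - 2 * of_real pi * \<i> * (w / w1) =
        (of_real pi / (2 * of_real area * w1)) * ((cnj w1 * w2 - 2 * \<i> * of_real area) * (2 * w + w2))"
      using w1_nz ea by (simp add: \<alpha>_def \<beta>_def power2_eq_square field_simps)
    also have "cnj w1 * w2 - 2 * \<i> * of_real area = w1 * cnj w2"
      unfolding ar[symmetric] by simp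
    also have "(of_real pi / (2 * of_real area * w1)) * ((w1 * cnj w2) * (2 * w + w2)) =
        of_real (pi / area) * (cnj w2 * w + (cmod w2)\<^sup>2 / 2)"
      unfolding n2h using w1_nz ea by (simp add: field_simps)
    finally have "exp (\<alpha> * (w + w2)\<^sup>2 + \<beta> * (w + w2)) =
      exp (\<alpha> * w\<^sup>2 + \<beta> * w) * (exp (of_real (pi / area) * (cnj w2 * w + (cmod w2)\<^sup>2 / 2)) * e w)"
      by (simp only: exp_add e_def)
    then show ?thesis using e0[of w] by (simp add: \<sigma>_def e2 \<theta>q)
  qed
  have holA: "(\<lambda>w. A (f w)) holomorphic_on S" if "f holomorphic_on S" for f S
    using holomorphic_on_compose_gen[OF that A(1)] by (simp add: o_def)
  have hole: "e holomorphic_on UNIV" unfolding e_def using w1_nz by (intro holomorphic_intros) auto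
  have hol: "\<sigma> holomorphic_on UNIV"
    unfolding \<sigma>_def \<theta>_def using e0 by (intro holomorphic_intros holA hole) auto
  have zeros: "w \<in> range lp" if "\<sigma> w = 0" for w
  proof -
    \<comment> \<open>A zero of either factor of \<open>\<theta>\<close> means that
      \<open>e w\<close> is an integer power of \<open>q\<close>, which places \<open>w\<close> in
      the lattice.\<close>
    have per: "w \<in> range lp" if "e w = exp (2 * of_real pi * \<i> * (of_int j * \<tau>))" for j :: int
    proof -
      from that obtain n :: int where "2 * of_real pi * \<i> * (w / w1) = 2 * of_real pi * \<i> * (of_int j * \<tau>) + of_real (real_of_int (2 * n) * pi) * \<i>"
        unfolding e_def exp_eq by blast
      then have "(2 * of_real pi * \<i>) * (w / w1) = (2 * of_real pi * \<i>) * (of_int j * \<tau> + of_int n)"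
        by (simp add: algebra_simps)
      then have "w / w1 = of_int j * \<tau> + of_int n"
        by (rule mult_left_cancel[THEN iffD1, rotated]) simp
      then have "w = lp (n, j)" using w1_nz by (simp add: \<tau>_def lp_def field_simps)
      then show ?thesis by simp
    qed
    from that consider "A (e w) = 0" | "A (q / e w) = 0" by (auto simp: \<sigma>_def \<theta>_def)
    then show ?thesis
    proof cases
      case 1
      then obtain n where n: "e w * q ^ n = 1" using A(3) by blast
      have "exp (2 * of_real pi * \<i> * (of_int (- int n) * \<tau>)) * q ^ n = 1"
        by (simp add: q_def exp_minus flip: exp_of_nat_mult exp_add) (simp add: mult_ac flip: exp_add)
      then have "e w = exp (2 * of_real pi * \<i> * (of_int (- int n) * \<tau>))"
        using n q(1) by (metis mult_right_cancel power_not_zero)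
      then show ?thesis by (rule per)
    next
      case 2
      then obtain n where n: "q / e w * q ^ n = 1" using A(3) by blast
      then have "e w = q ^ Suc n" using e0[of w] by (simp add: field_simps)
      also have "\<dots> = exp (2 * of_real pi * \<i> * (of_int (int (Suc n)) * \<tau>))"
        by (simp only: q_def exp_of_nat_mult[symmetric]) (simp add: mult_ac)
      finally show ?thesis by (rule per)
    qed
  qed
  have d0: "deriv \<sigma> 0 \<noteq> 0"
  proof -
    \<comment> \<open>Splitting off \<open>1 - e w\<close> shows that the zero at 0 is simple: the
      cofactor there is \<open>A q * A q\<close>, and \<open>A q\<close> is nonzero since no power
      \<open>q ^ Suc n\<close> is 1.\<close>
    define g where "g = (\<lambda>w. exp (\<alpha> * w\<^sup>2 + \<beta> * w) * (A (q * e w) * A (q / e w)))"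
    have holg: "g holomorphic_on UNIV" unfolding g_def using e0 by (intro holomorphic_intros holA hole) auto
    have "\<sigma> w = (1 - e w) * g w" for w
      using A(2)[of "e w"] by (simp add: \<sigma>_def g_def \<theta>_def)
    then have sg: "\<sigma> = (\<lambda>w. (1 - e w) * g w)" by auto
    have e00: "e 0 = 1" by (simp add: e_def)
    have de: "(e has_field_derivative (2 * of_real pi * \<i> / w1)) (at 0)"
      unfolding e_def using w1_nz by (auto intro!: derivative_eq_intros)
    have dg: "(g has_field_derivative deriv g 0) (at 0)"
      using holg by (intro holomorphic_derivI[of g UNIV]) auto
    have "(\<sigma> has_field_derivative (- (2 * of_real pi * \<i> / w1) * g 0)) (at 0)"
      unfolding sg by (rule derivative_eq_intros de dg refl | simp add: e00)+
    then have "deriv \<sigma> 0 = - (2 * of_real pi * \<i> / w1) * g 0" by (rule DERIV_imp_deriv)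
    moreover have "g 0 \<noteq> 0" using Aq by (simp add: g_def e00)
    ultimately show ?thesis using w1_nz by simp
  qed
  have "\<sigma> 0 = 0" by (simp add: \<sigma>_def \<theta>_def e_def A1)
  with hol s1 s2 zeros d0 show thesis by (intro that[of \<sigma>]) auto
qed

text \<open>The exponents add up to the one for the sum of the periods, apart from $i$ times an imaginary part.\<close>

lemma sigma_power_exists:
  obtains s k where "k holomorphic_on UNIV" "\<And>w. s w = w ^ n * k w" "k 0 \<noteq> 0"
    "\<And>w. w \<notin> range lp \<Longrightarrow> k w \<noteq> 0"
    "\<And>m. \<exists>\<epsilon>. cmod \<epsilon> = 1 \<and> (\<forall>w. s (w + lp m) =
       \<epsilon> * exp (of_real (pi * (real n / area)) * (cnj (lp m) * w + (cmod (lp m))\<^sup>2 / 2)) * s w)"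
proof -
  obtain \<sigma> where \<sigma>: "\<sigma> holomorphic_on UNIV"
    "\<And>w. \<sigma> (w + w1) = - exp (of_real (pi / area) * (cnj w1 * w + (cmod w1)\<^sup>2 / 2)) * \<sigma> w"
    "\<And>w. \<sigma> (w + w2) = - exp (of_real (pi / area) * (cnj w2 * w + (cmod w2)\<^sup>2 / 2)) * \<sigma> w"
    "\<And>w. w \<notin> range lp \<Longrightarrow> \<sigma> w \<noteq> 0" "\<sigma> 0 = 0" "deriv \<sigma> 0 \<noteq> 0"
    using sigma_exists by blast
  define E where "E = (\<lambda>l w. exp (of_real (pi / area) * (cnj l * w + of_real ((cmod l)\<^sup>2) / 2)))"
  \<comment> \<open>The vectors with \<open>Q\<close> form a group, by \<open>Qadd\<close> and
    \<open>Qneg\<close>; it contains both generators and hence the lattice.\<close>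
  define Q where "Q = (\<lambda>l. \<exists>\<epsilon>. cmod \<epsilon> = 1 \<and> (\<forall>w. \<sigma> (w + l) = \<epsilon> * E l w * \<sigma> w))"
  have Eadd: "\<exists>\<epsilon>. cmod \<epsilon> = 1 \<and> (\<forall>w. E l (w + l') * E l' w = \<epsilon> * E (l + l') w)" for l l'
  proof (intro exI conjI allI)
    define x where "x = pi / area * Im (cnj l * l')"
    show "cmod (cis x) = 1" by simp
    fix w
    have n: "complex_of_real ((cmod a)\<^sup>2) = a * cnj a" for a by (simp only: complex_norm_square)
    have i: "\<i> * of_real (Im (cnj l * l')) = (cnj l * l' - l * cnj l') / 2"
      by (simp add: complex_eq_iff)
    have "of_real (pi / area) * (cnj l * (w + l') + of_real ((cmod l)\<^sup>2) / 2) + of_real (pi / area) * (cnj l' * w + of_real ((cmod l')\<^sup>2) / 2) =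
      of_real (pi / area) * (\<i> * of_real (Im (cnj l * l'))) + of_real (pi / area) * (cnj (l + l') * w + of_real ((cmod (l + l'))\<^sup>2) / 2)"
      unfolding n i distrib_left[symmetric] by (rule arg_cong[where f = "\<lambda>x. _ * x"]) (simp add: field_simps)
    also have "of_real (pi / area) * (\<i> * of_real (Im (cnj l * l'))) = \<i> * of_real x" by (simp add: x_def)
    finally show "E l (w + l') * E l' w = cis x * E (l + l') w"
      by (simp only: E_def exp_add[symmetric] cis_conv_exp)
  qed
  have Qadd: "Q (l + l')" if "Q l" "Q l'" for l l'
  proof -
    from that obtain a b where a: "cmod a = 1" "\<And>w. \<sigma> (w + l) = a * E l w * \<sigma> w"
      and b: "cmod b = 1" "\<And>w. \<sigma> (w + l') = b * E l' w * \<sigma> w" unfolding Q_def by blast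
    obtain c where c: "cmod c = 1" "\<And>w. E l (w + l') * E l' w = c * E (l + l') w" using Eadd by blast
    have "\<sigma> (w + (l + l')) = (a * b * c) * E (l + l') w * \<sigma> w" for w
    proof -
      have "\<sigma> (w + (l + l')) = \<sigma> ((w + l') + l)" by (simp add: ac_simps)
      also have "\<dots> = a * b * (E l (w + l') * E l' w) * \<sigma> w" by (simp only: a(2) b(2)) (simp only: mult_ac)
      finally show ?thesis by (simp only: c(2)) (simp only: mult_ac)
    qed
    moreover have "cmod (a * b * c) = 1" by (simp add: norm_mult a b c)
    ultimately show ?thesis unfolding Q_def by blast
  qed
  have Q0: "Q 0" unfolding Q_def by (rule exI[of _ 1]) (simp add: E_def)
  have Qneg: "Q (- l)" if "Q l" for l
  proof -
    from that obtain a where a: "cmod a = 1" "\<And>w. \<sigma> (w + l) = a * E l w * \<sigma> w" unfolding Q_def by blast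
    obtain c where c: "cmod c = 1" "\<And>w. E l (w + - l) * E (- l) w = c * E (l + - l) w" using Eadd by blast
    have c': "E l (w - l) * E (- l) w = c" for w using c(2)[of w] by (simp add: E_def)
    have a0: "a \<noteq> 0" "c \<noteq> 0" using a c by auto
    have "\<sigma> (w + - l) = (1 / (a * c)) * E (- l) w * \<sigma> w" for w
    proof -
      have "E (- l) w * \<sigma> w = a * (E l (w - l) * E (- l) w) * \<sigma> (w - l)"
        using a(2)[of "w - l"] by simp
      then have "E (- l) w * \<sigma> w = a * c * \<sigma> (w - l)" by (simp only: c')
      then show ?thesis using a0 by (simp add: field_simps)
    qed
    moreover have "cmod (1 / (a * c)) = 1" by (simp add: norm_mult norm_divide a c)
    ultimately show ?thesis unfolding Q_def by blast
  qed
  have Qnat: "Q (of_nat j * l)" if "Q l" for l j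
  proof (induction j)
    case (Suc j)
    then show ?case using Qadd[OF that Suc] by (simp add: algebra_simps)
  qed (simp add: Q0)
  have Qint: "Q (of_int j * l)" if "Q l" for l j
  proof (cases j)
    case (nonneg n)
    then show ?thesis using Qnat[OF that, of n] by simp
  next
    case (neg n)
    have "of_int j * l = - (of_nat (Suc n) * l)" unfolding neg by (simp add: algebra_simps)
    then show ?thesis using Qneg[OF Qnat[OF that, of "Suc n"]] by (simp only:)
  qed
  have "Q w1" "Q w2" unfolding Q_def E_def using \<sigma>(2,3) by (auto intro!: exI[of _ "-1"])
  then have Q: "Q (lp m)" for m unfolding lp_def by (intro Qadd Qint)
  \<comment> \<open>\<open>\<sigma>\<close> with its simple zero at 0 divided out; the
    \<open>n\<close>-th power is the factor \<open>k\<close>, which stays nonzero at 0.\<close>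
  define \<kappa> where "\<kappa> = (\<lambda>w. if w = 0 then deriv \<sigma> 0 else (\<sigma> w - \<sigma> 0) / (w - 0))"
  have hol\<kappa>: "\<kappa> holomorphic_on UNIV" unfolding \<kappa>_def by (rule pole_lemma[OF \<sigma>(1)]) simp
  have \<sigma>\<kappa>: "\<sigma> w = w * \<kappa> w" for w by (simp add: \<kappa>_def \<sigma>(5))
  show thesis
  proof (rule that[of "\<lambda>w. \<kappa> w ^ n" "\<lambda>w. \<sigma> w ^ n"])
    show "(\<lambda>w. \<kappa> w ^ n) holomorphic_on UNIV" by (intro holomorphic_intros hol\<kappa>)
    show "\<sigma> w ^ n = w ^ n * \<kappa> w ^ n" for w by (simp add: \<sigma>\<kappa> power_mult_distrib)
    show "\<kappa> 0 ^ n \<noteq> 0" using \<sigma>(6) by (simp add: \<kappa>_def)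
    show "\<kappa> w ^ n \<noteq> 0" if "w \<notin> range lp" for w using \<sigma>(4)[OF that] by (simp add: \<sigma>\<kappa>)
    fix m
    from Q[of m] obtain \<epsilon> where \<epsilon>: "cmod \<epsilon> = 1" "\<And>w. \<sigma> (w + lp m) = \<epsilon> * E (lp m) w * \<sigma> w"
      unfolding Q_def by blast
    have "E (lp m) w ^ n = exp (of_real (pi * (real n / area)) * (cnj (lp m) * w + (cmod (lp m))\<^sup>2 / 2))" for w
      unfolding E_def exp_of_nat_mult[symmetric] by (rule arg_cong[where f = exp]) simp
    then have "\<forall>w. \<sigma> (w + lp m) ^ n =
       \<epsilon> ^ n * exp (of_real (pi * (real n / area)) * (cnj (lp m) * w + (cmod (lp m))\<^sup>2 / 2)) * \<sigma> w ^ n"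
      by (simp only: \<epsilon>(2) power_mult_distrib) simp
    moreover have "cmod (\<epsilon> ^ n) = 1" by (simp add: norm_power \<epsilon>)
    ultimately show "\<exists>\<epsilon>. cmod \<epsilon> = 1 \<and> (\<forall>w. \<sigma> (w + lp m) ^ n =
       \<epsilon> * exp (of_real (pi * (real n / area)) * (cnj (lp m) * w + (cmod (lp m))\<^sup>2 / 2)) * \<sigma> w ^ n)" by blast
  qed
qed

end

section \<open>Necessity\<close>

lemma cmod_add_square: "(cmod (z + w))\<^sup>2 = (cmod z)\<^sup>2 + (cmod w)\<^sup>2 + 2 * Re (cnj w * z)"
  unfolding cmod_power2 by (simp add: power2_eq_square algebra_simps)

lemma cmod_diff_square: "(cmod (z - w))\<^sup>2 = (cmod z)\<^sup>2 + (cmod w)\<^sup>2 - 2 * Re (cnj w * z)"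
  unfolding cmod_power2 by (simp add: power2_eq_square algebra_simps)

lemma (in complex_lattice) dual_lattice: "complex_lattice (w1 / of_real area) (w2 / of_real area)"
proof
  have "Im (cnj (w1 / of_real area) * (w2 / of_real area)) = Im (cnj w1 * w2) / area / area"
    by (simp add: Im_divide_of_real diff_divide_distrib)
  then show "0 < Im (cnj (w1 / of_real area) * (w2 / of_real area))"
    using area_gt_0 area_pos by simp
qed

text \<open>Since the disc of radius \<open>r\<close> about 0 lies in the cell, its lattice
  translates are disjoint: every point has only one translate in the cell.\<close>

lemma (in complex_lattice) sum_ball_integrals_le:
  fixes g :: "complex \<Rightarrow> real"
  assumes int: "integrable lborel g" and nn: "\<And>z. g z \<ge> 0" and r: "ball 0 r \<subseteq> cell" and J: "finite J"
  shows "(\<Sum>m\<in>J. LINT \<zeta>:ball (z + lp m) r|lborel. g \<zeta>) \<le> (LINT \<zeta>|lborel. g \<zeta>)"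
proof -
  have i: "integrable lborel (\<lambda>\<zeta>. indicat_real (ball (z + lp m) r) \<zeta> *\<^sub>R g \<zeta>)" for m
    by (rule integrable_mult_indicator) (auto simp: int)
  have "(\<Sum>m\<in>J. LINT \<zeta>:ball (z + lp m) r|lborel. g \<zeta>) =
    (LINT \<zeta>|lborel. (\<Sum>m\<in>J. indicat_real (ball (z + lp m) r) \<zeta> *\<^sub>R g \<zeta>))"
    unfolding set_lebesgue_integral_def by (rule Bochner_Integration.integral_sum[symmetric]) (rule i)
  also have "\<dots> \<le> (LINT \<zeta>|lborel. g \<zeta>)"
  proof (rule integral_mono)
    show "integrable lborel (\<lambda>\<zeta>. \<Sum>m\<in>J. indicat_real (ball (z + lp m) r) \<zeta> *\<^sub>R g \<zeta>)"
      by (intro Bochner_Integration.integrable_sum i)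
    fix \<zeta>
    obtain k where k: "\<And>m. (\<zeta> - z) + lp m \<in> cell \<Longrightarrow> m = k"
      using unique_translate[of "\<zeta> - z"] by blast
    have ind: "indicat_real (ball (z + lp m) r) \<zeta> \<le> (if m = - k then 1 else 0)" for m
    proof (cases "\<zeta> \<in> ball (z + lp m) r")
      case True
      then have "(\<zeta> - z) + lp (- m) \<in> ball 0 r"
        by (simp add: lp_minus dist_norm norm_minus_commute algebra_simps)
      then have "- m = k" using k r by blast
      then have "m = - k" by auto
      then show ?thesis by simp
    qed auto
    have "(\<Sum>m\<in>J. indicat_real (ball (z + lp m) r) \<zeta> *\<^sub>R g \<zeta>) = (\<Sum>m\<in>J. indicat_real (ball (z + lp m) r) \<zeta>) * g \<zeta>"
      by (simp add: sum_distrib_right)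
    also have "\<dots> \<le> (\<Sum>m\<in>J. if m = - k then 1 else 0) * g \<zeta>"
      by (intro mult_right_mono sum_mono ind nn)
    also have "\<dots> \<le> 1 * g \<zeta>"
      using J nn by (intro mult_right_mono) auto
    finally show "(\<Sum>m\<in>J. indicat_real (ball (z + lp m) r) \<zeta> *\<^sub>R g \<zeta>) \<le> g \<zeta>" by simp
  qed (rule int)
  finally show ?thesis .
qed

text \<open>Records the properties of the \<open>n\<close>-th power of the sigma function;
  \<open>k\<close> is \<open>s\<close> with its zero at the origin divided out. In the theorem the
  locale is instantiated on the dual lattice \<open>M\<close>, so that \<open>real n / area\<close>
  is the quotient of \<open>n\<close> by the density.\<close>

locale quasi_periodic = complex_lattice +
  fixes s k :: "complex \<Rightarrow> complex" and n :: nat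
  assumes n1: "n \<ge> 1" and hol_k: "k holomorphic_on UNIV" and s_eq: "\<And>w. s w = w ^ n * k w"
    and k0: "k 0 \<noteq> 0" and k_nz: "\<And>w. w \<notin> range lp \<Longrightarrow> k w \<noteq> 0"
    and quasi: "\<And>m. \<exists>\<epsilon>. cmod \<epsilon> = 1 \<and> (\<forall>w. s (w + lp m) =
       \<epsilon> * exp (of_real (pi * (real n / area)) * (cnj (lp m) * w + (cmod (lp m))\<^sup>2 / 2)) * s w)"
begin

definition \<beta> :: real where "\<beta> = real n / area"

lemma \<beta>_pos: "\<beta> > 0" using n1 area_gt_0 by (simp add: \<beta>_def)

lemma hol_s: "s holomorphic_on UNIV"
  unfolding s_eq[abs_def] by (intro holomorphic_intros hol_k)

lemma s_nz: "w \<notin> range lp \<Longrightarrow> s w \<noteq> 0"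
  using k_nz[of w] lp_0 by (metis mult_eq_0_iff power_not_zero rangeI s_eq)

lemma cont_k: "continuous_on UNIV k" by (rule holomorphic_on_imp_continuous_on[OF hol_k])
lemma cont_s: "continuous_on UNIV s" by (rule holomorphic_on_imp_continuous_on[OF hol_s])

definition gauss :: "complex \<Rightarrow> real" where "gauss z = exp (pi * \<beta> / 2 * (cmod z)\<^sup>2)"

lemma gauss_ge_1: "gauss z \<ge> 1"
  using \<beta>_pos by (simp add: gauss_def)

text \<open>In modulus the phase disappears, and the remaining exponential is exactly the change of
  \<open>gauss\<close> under the shift.\<close>

lemma norm_s_period: "cmod (s (w + lp m)) / gauss (w + lp m) = cmod (s w) / gauss w"
proof -
  from quasi[of m] obtain \<epsilon> where \<epsilon>: "cmod \<epsilon> = 1" "\<And>w. s (w + lp m) =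
       \<epsilon> * exp (of_real (pi * \<beta>) * (cnj (lp m) * w + (cmod (lp m))\<^sup>2 / 2)) * s w"
    unfolding \<beta>_def by blast
  have "Re (of_real (pi * \<beta>) * (cnj (lp m) * w + (cmod (lp m))\<^sup>2 / 2)) = pi * \<beta> * (Re (cnj (lp m) * w) + (cmod (lp m))\<^sup>2 / 2)"
    by (simp add: algebra_simps)
  then have "cmod (s (w + lp m)) = exp (pi * \<beta> * (Re (cnj (lp m) * w) + (cmod (lp m))\<^sup>2 / 2)) * cmod (s w)"
    by (simp only: \<epsilon> norm_mult norm_exp_eq_Re mult_1)
  moreover have "gauss (w + lp m) = gauss w * exp (pi * \<beta> * (Re (cnj (lp m) * w) + (cmod (lp m))\<^sup>2 / 2))"
    unfolding gauss_def cmod_add_square exp_add[symmetric] by (simp add: algebra_simps add_divide_distrib)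
  ultimately show ?thesis by (simp add: gauss_def)
qed

lemma s_bound: obtains C where "C > 0" "\<And>w. cmod (s w) \<le> C * gauss w"
proof -
  have "bounded (s ` ccell)"
    by (intro compact_imp_bounded compact_continuous_image compact_ccell continuous_on_subset[OF cont_s]) auto
  then obtain C where C: "C > 0" "\<And>z. z \<in> ccell \<Longrightarrow> cmod (s z) \<le> C"
    unfolding bounded_pos by auto
  have "cmod (s w) \<le> C * gauss w" for w
  proof -
    obtain m where "w + lp m \<in> cell" using unique_translate by blast
    then have "cmod (s (w + lp m)) \<le> C" using C cell_subset_ccell by blast
    then have "cmod (s (w + lp m)) / gauss (w + lp m) \<le> C"
      using gauss_ge_1[of "w + lp m"] C(1) by (simp add: divide_le_eq) (smt (verit) mult_le_cancel_left1)
    then show ?thesis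
      unfolding norm_s_period using gauss_ge_1[of w] by (simp add: divide_le_eq)
  qed
  then show thesis using that C(1) by blast
qed

text \<open>The Weyl translate of \<open>s\<close> by \<open>\<nu>\<close> for the Gaussian weight
  with parameter \<open>\<beta>\<close>; it satisfies the same bound as \<open>s\<close>, uniformly
  in \<open>\<nu>\<close>.\<close>

definition sh :: "complex \<Rightarrow> complex \<Rightarrow> complex" where
  "sh \<nu> z = s (z - \<nu>) * exp (of_real (pi * \<beta>) * (cnj \<nu> * z - (cmod \<nu>)\<^sup>2 / 2))"

text \<open>The quotient of \<open>sh \<nu> z\<close> by \<open>z - \<nu>\<close>, written through
  \<open>k\<close> so that it is visibly entire.\<close>

definition ek :: "complex \<Rightarrow> complex \<Rightarrow> complex" where
  "ek \<nu> z = (z - \<nu>) ^ (n - 1) * k (z - \<nu>) * exp (of_real (pi * \<beta>) * (cnj \<nu> * z - (cmod \<nu>)\<^sup>2 / 2))"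

lemma sh_ek: "sh \<nu> z = (z - \<nu>) * ek \<nu> z"
proof -
  have "(z - \<nu>) ^ n = (z - \<nu>) * (z - \<nu>) ^ (n - 1)" using n1 by (simp add: power_eq_if)
  then show ?thesis by (simp add: sh_def ek_def s_eq)
qed

lemma hol_ek: "ek \<nu> holomorphic_on UNIV"
proof -
  have "(\<lambda>z. k (z + - \<nu>)) holomorphic_on UNIV" by (rule holomorphic_on_shift[OF hol_k])
  then show ?thesis unfolding ek_def by (intro holomorphic_intros) simp_all
qed

lemma sh_bound: obtains C where "C > 0" "\<And>\<nu> z. cmod (sh \<nu> z) \<le> C * gauss z"
proof -
  obtain C where C: "C > 0" "\<And>w. cmod (s w) \<le> C * gauss w" using s_bound by blast
  have "cmod (sh \<nu> z) \<le> C * gauss z" for \<nu> z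
  proof -
    have "Re (of_real (pi * \<beta>) * (cnj \<nu> * z - (cmod \<nu>)\<^sup>2 / 2)) = pi * \<beta> * (Re (cnj \<nu> * z) - (cmod \<nu>)\<^sup>2 / 2)"
      by (simp add: algebra_simps)
    then have "cmod (sh \<nu> z) = cmod (s (z - \<nu>)) * exp (pi * \<beta> * (Re (cnj \<nu> * z) - (cmod \<nu>)\<^sup>2 / 2))"
      by (simp only: sh_def norm_mult norm_exp_eq_Re)
    also have "\<dots> \<le> (C * gauss (z - \<nu>)) * exp (pi * \<beta> * (Re (cnj \<nu> * z) - (cmod \<nu>)\<^sup>2 / 2))"
      by (intro mult_right_mono C(2)) auto
    also have "gauss (z - \<nu>) * exp (pi * \<beta> * (Re (cnj \<nu> * z) - (cmod \<nu>)\<^sup>2 / 2)) = gauss z"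
      unfolding gauss_def cmod_diff_square exp_add[symmetric] by (rule arg_cong[where f = exp]) (simp add: field_simps)
    then have "(C * gauss (z - \<nu>)) * exp (pi * \<beta> * (Re (cnj \<nu> * z) - (cmod \<nu>)\<^sup>2 / 2)) = C * gauss z"
      by (simp only: mult.assoc)
    finally show ?thesis .
  qed
  then show thesis using that C(1) by blast
qed

text \<open>Shifting the zero set of \<open>sh\<close> by a lattice vector returns the same zero
  set, and the weights agree, so only a phase can change. This puts poles at \<open>u\<close> and at
  \<open>u + lp m0\<close> over the same numerator.\<close>

lemma sh_change: obtains c where "cmod c = 1" "\<And>z. sh \<nu> z = c * sh (\<nu> + lp m) z"
proof -
  from quasi[of m] obtain \<epsilon> where \<epsilon>: "cmod \<epsilon> = 1" "\<And>w. s (w + lp m) =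
       \<epsilon> * exp (of_real (pi * \<beta>) * (cnj (lp m) * w + (cmod (lp m))\<^sup>2 / 2)) * s w"
    unfolding \<beta>_def by blast
  define l where "l = lp m"
  define \<nu>' where "\<nu>' = \<nu> + l"
  define c where "c = \<epsilon> * cis (- (pi * \<beta> * Im (cnj l * \<nu>')))"
  have n: "complex_of_real ((cmod a)\<^sup>2 / 2) = a * cnj a / 2" for a
    by (simp only: of_real_divide complex_norm_square) simp
  have i: "\<i> * of_real (Im (cnj l * \<nu>')) = (cnj l * \<nu>' - l * cnj \<nu>') / 2"
    by (simp add: complex_eq_iff)
  have "sh \<nu> z = c * sh \<nu>' z" for z
  proof -
    have "sh \<nu> z = s ((z - \<nu>') + l) * exp (of_real (pi * \<beta>) * (cnj \<nu> * z - (cmod \<nu>)\<^sup>2 / 2))"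
      by (simp add: sh_def \<nu>'_def)
    also have "\<dots> = \<epsilon> * s (z - \<nu>') * exp (of_real (pi * \<beta>) * (cnj l * (z - \<nu>') + (cmod l)\<^sup>2 / 2) +
        of_real (pi * \<beta>) * (cnj \<nu> * z - (cmod \<nu>)\<^sup>2 / 2))"
      unfolding l_def \<epsilon>(2) exp_add by (simp only: mult_ac)
    also have "of_real (pi * \<beta>) * (cnj l * (z - \<nu>') + (cmod l)\<^sup>2 / 2) +
        of_real (pi * \<beta>) * (cnj \<nu> * z - (cmod \<nu>)\<^sup>2 / 2) =
      of_real (pi * \<beta>) * (- (\<i> * of_real (Im (cnj l * \<nu>')))) + of_real (pi * \<beta>) * (cnj \<nu>' * z - (cmod \<nu>')\<^sup>2 / 2)"
      unfolding n i distrib_left[symmetric]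
      by (rule arg_cong[where f = "\<lambda>x. _ * x"]) (simp add: \<nu>'_def field_simps)
    also have "of_real (pi * \<beta>) * (- (\<i> * of_real (Im (cnj l * \<nu>')))) = \<i> * of_real (- (pi * \<beta> * Im (cnj l * \<nu>')))"
      by simp
    finally show ?thesis
      by (simp only: exp_add c_def sh_def cis_conv_exp mult_ac)
  qed
  moreover have "cmod c = 1" by (simp add: c_def norm_mult \<epsilon>)
  ultimately show thesis using that by (simp add: \<nu>'_def l_def)
qed

text \<open>\<open>sh\<close> vanishes to order \<open>n\<close> at all points
  \<open>u + lp b\<close>. Dividing by one linear factor lowers the order to \<open>n - 1\<close> at
  its own zero only, so the reduced quotient \<open>e1\<close> is nonzero at 0 just for
  \<open>a = b\<close>.\<close>

lemma ek_at_lattice: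
  obtains e1 where "e1 holomorphic_on UNIV" "\<And>z. ek (u + lp a) (z + (u + lp b)) = z ^ (n - 1) * e1 z"
    "e1 0 = (if a = b then k 0 * of_real (gauss (u + lp b)) else 0)"
proof (cases "a = b")
  case True
  define \<nu> where "\<nu> = u + lp b"
  show thesis
  proof (rule that[of "\<lambda>z. k z * exp (of_real (pi * \<beta>) * (cnj \<nu> * (z + \<nu>) - (cmod \<nu>)\<^sup>2 / 2))"])
    show "(\<lambda>z. k z * exp (of_real (pi * \<beta>) * (cnj \<nu> * (z + \<nu>) - (cmod \<nu>)\<^sup>2 / 2))) holomorphic_on UNIV"
      by (intro holomorphic_intros hol_k)
    show "ek (u + lp a) (z + (u + lp b)) = z ^ (n - 1) * (k z * exp (of_real (pi * \<beta>) * (cnj \<nu> * (z + \<nu>) - (cmod \<nu>)\<^sup>2 / 2)))" for z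
      using True by (simp add: ek_def \<nu>_def[symmetric])
    have "cnj \<nu> * \<nu> - (cmod \<nu>)\<^sup>2 / 2 = of_real ((cmod \<nu>)\<^sup>2 / 2)"
      by (simp only: of_real_divide complex_norm_square) simp
    then have "of_real (pi * \<beta>) * (cnj \<nu> * \<nu> - (cmod \<nu>)\<^sup>2 / 2) = complex_of_real (pi * \<beta> / 2 * (cmod \<nu>)\<^sup>2)"
      by (simp only: of_real_mult[symmetric]) simp
    then have "exp (of_real (pi * \<beta>) * (cnj \<nu> * (0 + \<nu>) - (cmod \<nu>)\<^sup>2 / 2)) = complex_of_real (gauss \<nu>)"
      by (simp only: add_0 gauss_def exp_of_real)
    then show "k 0 * exp (of_real (pi * \<beta>) * (cnj \<nu> * (0 + \<nu>) - (cmod \<nu>)\<^sup>2 / 2)) = (if a = b then k 0 * of_real (gauss (u + lp b)) else 0)"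
      using True by (simp add: \<nu>_def[symmetric])
  qed
next
  case False
  define \<nu> \<mu> d where "\<nu> = u + lp a" and "\<mu> = u + lp b" and "d = lp b - lp a"
  have d: "d \<noteq> 0" using False inj_lp by (auto simp: d_def inj_eq)
  have d': "\<mu> - \<nu> = d" by (simp add: d_def \<mu>_def \<nu>_def)
  obtain c where c: "cmod c = 1" "\<And>z. sh \<nu> z = c * sh (\<nu> + lp (b - a)) z" using sh_change by blast
  have "\<nu> + lp (b - a) = \<mu>" by (simp add: \<nu>_def \<mu>_def lp_diff)
  then have c': "sh \<nu> z = c * sh \<mu> z" for z using c(2) by simp
  have *: "(z + d) * ek \<nu> (z + \<mu>) = c * (z * ek \<mu> (z + \<mu>))" for z
    using c'[of "z + \<mu>"] d' by (simp add: sh_ek algebra_simps)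
  define E where "E = (\<lambda>z. k z * exp (of_real (pi * \<beta>) * (cnj \<mu> * (z + \<mu>) - (cmod \<mu>)\<^sup>2 / 2)))"
  have holE: "E holomorphic_on UNIV" unfolding E_def by (intro holomorphic_intros hol_k)
  have ekE: "ek \<mu> (z + \<mu>) = z ^ (n - 1) * E z" for z by (simp add: ek_def E_def)
  \<comment> \<open>The value 0 at 0 is the correct one: the preceding relation writes the quotient
    near 0 as a holomorphic function with a factor \<open>z\<close>. Holomorphy is glued from the
    punctured plane and a disc that avoids \<open>- d\<close>.\<close>
  define e1 where "e1 = (\<lambda>z. if z = 0 then 0 else ek \<nu> (z + \<mu>) / z ^ (n - 1))"
  have hol1: "e1 holomorphic_on (- {0})"
  proof (rule holomorphic_transform)
    show "(\<lambda>z. ek \<nu> (z + \<mu>) / z ^ (n - 1)) holomorphic_on (- {0})"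
      by (intro holomorphic_intros holomorphic_on_subset[OF holomorphic_on_shift[OF hol_ek]]) auto
  qed (auto simp: e1_def)
  have hol2: "e1 holomorphic_on ball 0 (cmod d)"
  proof (rule holomorphic_transform)
    have nz: "z + d \<noteq> 0" if "z \<in> ball 0 (cmod d)" for z :: complex
    proof
      assume "z + d = 0"
      then have "z = - d" by (simp add: add_eq_0_iff)
      then show False using that by simp
    qed
    show "(\<lambda>z. c * (z * E z) / (z + d)) holomorphic_on ball 0 (cmod d)"
      using nz by (intro holomorphic_intros holomorphic_on_subset[OF holE]) auto
    fix z :: complex assume z: "z \<in> ball 0 (cmod d)"
    show "c * (z * E z) / (z + d) = e1 z"
    proof -
      have "(z + d) * ek \<nu> (z + \<mu>) = c * (z * E z) * z ^ (n - 1)" by (simp only: * ekE mult_ac)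
      then have "ek \<nu> (z + \<mu>) = c * (z * E z) * z ^ (n - 1) / (z + d)"
        by (intro iffD2[OF nonzero_eq_divide_eq[OF nz[OF z]]]) (simp only: mult.commute[of _ "z + d"])
      then show ?thesis by (simp add: e1_def)
    qed
  qed
  have "- {0} \<union> ball 0 (cmod d) = UNIV" using d by auto
  then have hol: "e1 holomorphic_on UNIV"
    using holomorphic_on_Un[OF hol1 hol2] open_Compl[OF closed_singleton] by (metis open_ball)
  have "ek \<nu> \<mu> = 0" using *[of 0] d by simp
  then have "ek \<nu> (z + \<mu>) = z ^ (n - 1) * e1 z" for z by (simp add: e1_def)
  with hol show thesis using False by (intro that[of e1]) (auto simp: \<nu>_def \<mu>_def e1_def)
qed

text \<open>After the phase \<open>c\<close> both terms of \<open>h\<close> have numerator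
  \<open>sh u\<close>, so the two poles combine to
  \<open>(\<nu> - u) / ((z - \<nu>) * (z - u))\<close> and the quadratic decay appears. The last
  property lists the leading coefficients of order \<open>n - 1\<close> on \<open>u + M\<close>;
  they are nonzero at the two poles only.\<close>

lemma test_function_exists:
  assumes u: "u \<notin> range lp" and m0: "m0 \<noteq> 0"
  obtains h c C where "cmod c = 1" "h holomorphic_on UNIV" "C > 0"
    "\<And>z. cmod (h z) \<le> C * gauss z / (1 + (cmod z)\<^sup>2)"
    "h 0 = sh u 0 * (1 / u - 1 / (u + lp m0))"
    "\<And>b. \<exists>h1. h1 holomorphic_on UNIV \<and> (\<forall>z. h (z + (u + lp b)) = z ^ (n - 1) * h1 z) \<and>
       h1 0 = (if b = m0 then c * k 0 * of_real (gauss (u + lp m0)) else if b = 0 then - (k 0 * of_real (gauss u)) else 0)"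
proof -
  define \<nu> where "\<nu> = u + lp m0"
  have "\<nu> \<notin> range lp"
  proof
    assume "\<nu> \<in> range lp"
    then obtain b where "\<nu> = lp b" by auto
    then have "u = lp (b - m0)" by (simp add: \<nu>_def lp_diff algebra_simps)
    then show False using u by blast
  qed
  then have nz: "\<nu> \<noteq> 0" "u \<noteq> 0" using u lp_0 by (metis rangeI)+
  obtain c where c: "cmod c = 1" "\<And>z. sh u z = c * sh (u + lp m0) z" using sh_change by blast
  define h where "h = (\<lambda>z. c * ek \<nu> z - ek u z)"
  have hol: "h holomorphic_on UNIV" unfolding h_def by (intro holomorphic_intros hol_ek)
  have h_eq: "h z = sh u z * (1 / (z - \<nu>) - 1 / (z - u))" if "z \<noteq> \<nu>" "z \<noteq> u" for z
  proof -
    have "c * ek \<nu> z = sh u z / (z - \<nu>)" using c(2)[of z] that by (simp add: sh_ek \<nu>_def[symmetric])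
    moreover have "ek u z = sh u z / (z - u)" using that by (simp add: sh_ek)
    ultimately show ?thesis by (simp add: h_def algebra_simps)
  qed
  obtain C1 where C1: "C1 > 0" "\<And>\<nu> z. cmod (sh \<nu> z) \<le> C1 * gauss z" using sh_bound by blast
  \<comment> \<open>Beyond this radius the modulus of \<open>z\<close> is at least 1, and the
    distance to either pole is at least half of it.\<close>
  define R where "R = 2 * (cmod u + cmod \<nu>) + 1"
  have "bounded (h ` cball 0 R)"
    by (intro compact_imp_bounded compact_continuous_image holomorphic_on_imp_continuous_on holomorphic_on_subset[OF hol]) auto
  then obtain B where B: "B > 0" "\<And>z. cmod z \<le> R \<Longrightarrow> cmod (h z) \<le> B"
    unfolding bounded_pos by auto
  \<comment> \<open>The 8 is 4 from halving both distances times 2 from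
    \<open>1 + (cmod z)\<^sup>2 \<le> 2 * (cmod z)\<^sup>2\<close>; the second summand covers the
    disc of radius \<open>R\<close>.\<close>
  define C where "C = C1 * (8 * cmod (\<nu> - u)) + B * (1 + R\<^sup>2)"
  have C: "C > 0" unfolding C_def using C1 B by (intro add_nonneg_pos mult_nonneg_nonneg mult_pos_pos add_pos_nonneg) auto
  have bound: "cmod (h z) \<le> C * gauss z / (1 + (cmod z)\<^sup>2)" for z
  proof -
    have p: "1 + (cmod z)\<^sup>2 > 0" by (simp add: add_pos_nonneg)
    have g: "gauss z \<ge> 1" by (rule gauss_ge_1)
    have "cmod (h z) * (1 + (cmod z)\<^sup>2) \<le> C * gauss z"
    proof (cases "cmod z \<le> R")
      case True
      have "cmod (h z) * (1 + (cmod z)\<^sup>2) \<le> B * (1 + R\<^sup>2)"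
        using True B by (intro mult_mono add_mono power_mono) auto
      also have "\<dots> \<le> C" using C1 by (simp add: C_def)
      also have "\<dots> \<le> C * gauss z" using C g by simp
      finally show ?thesis .
    next
      case False
      have z1: "cmod z \<ge> 1" using False by (simp add: R_def add_nonneg_nonneg) (smt (verit) norm_ge_zero)
      have half: "cmod z / 2 \<le> cmod (z - x)" if "x = u \<or> x = \<nu>" for x
      proof -
        have "2 * cmod x \<le> cmod z" using False that unfolding R_def by (smt (verit) norm_ge_zero)
        then show ?thesis using norm_triangle_ineq2[of z x] by linarith
      qed
      have ne: "z \<noteq> \<nu>" "z \<noteq> u" using half[of \<nu>] half[of u] z1 by auto
      have "1 / (z - \<nu>) - 1 / (z - u) = (\<nu> - u) / ((z - \<nu>) * (z - u))"
        using ne by (simp add: field_simps)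
      then have "cmod (h z) = cmod (sh u z) * (cmod (\<nu> - u) / (cmod (z - \<nu>) * cmod (z - u)))"
        unfolding h_eq[OF ne] by (simp only: norm_mult norm_divide)
      also have "\<dots> \<le> (C1 * gauss z) * (cmod (\<nu> - u) / ((cmod z / 2) * (cmod z / 2)))"
        using half[of \<nu>] half[of u] z1 C1 g
        by (intro mult_mono divide_left_mono mult_pos_pos) auto
      also have "\<dots> = (C1 * gauss z) * (4 * cmod (\<nu> - u)) / (cmod z)\<^sup>2"
        by (simp add: power2_eq_square)
      finally have "cmod (h z) * (cmod z)\<^sup>2 \<le> (C1 * gauss z) * (4 * cmod (\<nu> - u))"
        using z1 by (simp only: pos_le_divide_eq zero_less_power)
      moreover have "1 + (cmod z)\<^sup>2 \<le> 2 * (cmod z)\<^sup>2" using z1 by (simp add: one_le_power)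
      ultimately have "cmod (h z) * (1 + (cmod z)\<^sup>2) \<le> 2 * ((C1 * gauss z) * (4 * cmod (\<nu> - u)))"
        using mult_left_mono[of "1 + (cmod z)\<^sup>2" "2 * (cmod z)\<^sup>2" "cmod (h z)"] by simp
      also have "\<dots> = C1 * (8 * cmod (\<nu> - u)) * gauss z" by simp
      also have "\<dots> \<le> C * gauss z" using B g by (intro mult_right_mono) (auto simp: C_def)
      finally show ?thesis .
    qed
    then show ?thesis using p by (simp add: field_simps)
  qed
  have loc: "\<exists>h1. h1 holomorphic_on UNIV \<and> (\<forall>z. h (z + (u + lp b)) = z ^ (n - 1) * h1 z) \<and>
       h1 0 = (if b = m0 then c * k 0 * of_real (gauss (u + lp m0)) else if b = 0 then - (k 0 * of_real (gauss u)) else 0)" for b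
  proof -
    obtain e1 where e1: "e1 holomorphic_on UNIV" "\<And>z. ek (u + lp m0) (z + (u + lp b)) = z ^ (n - 1) * e1 z"
      "e1 0 = (if m0 = b then k 0 * of_real (gauss (u + lp b)) else 0)" using ek_at_lattice[of u m0 b] by blast
    obtain e2 where e2: "e2 holomorphic_on UNIV" "\<And>z. ek (u + lp 0) (z + (u + lp b)) = z ^ (n - 1) * e2 z"
      "e2 0 = (if 0 = b then k 0 * of_real (gauss (u + lp b)) else 0)" using ek_at_lattice[of u 0 b] by blast
    show ?thesis
    proof (intro exI[of _ "\<lambda>z. c * e1 z - e2 z"] conjI allI)
      show "(\<lambda>z. c * e1 z - e2 z) holomorphic_on UNIV" by (intro holomorphic_intros e1(1) e2(1))
      show "h (z + (u + lp b)) = z ^ (n - 1) * (c * e1 z - e2 z)" for z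
        using e1(2)[of z] e2(2)[of z] by (simp add: h_def \<nu>_def algebra_simps)
      show "c * e1 0 - e2 0 = (if b = m0 then c * k 0 * of_real (gauss (u + lp m0)) else if b = 0 then - (k 0 * of_real (gauss u)) else 0)"
        using m0 by (auto simp: e1(3) e2(3))
    qed
  qed
  have "h 0 = sh u 0 * (1 / u - 1 / \<nu>)" using h_eq[of 0] nz by (simp add: algebra_simps)
  with c(1) hol C bound loc show thesis by (intro that[of c h C]) (auto simp: \<nu>_def)
qed

end

text \<open>The shifted Gaussian has a cross term in \<open>cnj z * \<nu>\<close>, which the
  character cancels; the other cross term doubles and is holomorphic in \<open>z\<close>. Thus the
  Fourier coefficient at \<open>\<nu>\<close> sees the functions around the point
  \<open>\<nu>\<close>.\<close>

lemma exp_gauss_chi_shift: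
  "of_real (exp (- pi * (cmod (z + \<nu>))\<^sup>2)) * chi \<nu> (z + \<nu>) =
   of_real (exp (- pi * (cmod \<nu>)\<^sup>2)) * exp (- 2 * of_real pi * cnj \<nu> * z) * of_real (exp (- pi * (cmod z)\<^sup>2))"
proof -
  have n: "complex_of_real (exp (- pi * (cmod a)\<^sup>2)) = exp (of_real pi * (- (a * cnj a)))" for a
  proof -
    have "complex_of_real (exp (- pi * (cmod a)\<^sup>2)) = exp (of_real pi * (- of_real ((cmod a)\<^sup>2)))"
      by (simp flip: exp_of_real)
    then show ?thesis by (simp only: complex_norm_square)
  qed
  show ?thesis
    unfolding n chi_def exp_add[symmetric] by (rule arg_cong[where f = exp]) (simp add: algebra_simps)
qed

text \<open>Recentred at \<open>\<nu>\<close> the integrand is \<open>z ^ (n - 1)\<close> times a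
  polyanalytic function of order \<open>n\<close> times a radial Gaussian, so
  \<open>integral_radial_polyanalytic\<close> isolates the top coefficient at
  \<open>\<nu>\<close>.\<close>

lemma gauss_pairing_at_zero:
  assumes n1: "n \<ge> 1" and h: "h1 holomorphic_on UNIV" "\<And>z. h (z + \<nu>) = z ^ (n - 1) * h1 z"
    and \<phi>: "\<And>k. k < n \<Longrightarrow> \<phi> k holomorphic_on UNIV"
    and int: "integrable lborel (\<lambda>z. h z * (\<Sum>k<n. cnj z ^ k * \<phi> k z) * of_real (exp (- pi * (cmod z)\<^sup>2)) * chi \<nu> z)"
  shows "(LINT z|lborel. h z * (\<Sum>k<n. cnj z ^ k * \<phi> k z) * of_real (exp (- pi * (cmod z)\<^sup>2)) * chi \<nu> z) =
     of_real (exp (- pi * (cmod \<nu>)\<^sup>2)) * h1 0 * \<phi> (n - 1) \<nu> *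
     (LINT z|lborel. of_real (cmod z ^ (2 * (n - 1))) * of_real (exp (- pi * (cmod z)\<^sup>2)))"
proof -
  define m where "m = n - 1"
  have m: "n = Suc m" using n1 by (simp add: m_def)
  define G where "G = (\<lambda>z. h z * (\<Sum>k<n. cnj z ^ k * \<phi> k z) * of_real (exp (- pi * (cmod z)\<^sup>2)) * chi \<nu> z)"
  define q where "q = (\<lambda>p z. (\<Sum>k<n. of_nat (k choose p) * cnj \<nu> ^ (k - p) * \<phi> k (z + \<nu>)) *
     (of_real (exp (- pi * (cmod \<nu>)\<^sup>2)) * h1 z * exp (- 2 * of_real pi * cnj \<nu> * z)))"
  have G_shift: "G (\<nu> + z) = z ^ m * (\<Sum>p\<le>m. cnj z ^ p * q p z) * of_real (exp (- pi * (cmod z)\<^sup>2))" for z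
  proof -
    have "G (\<nu> + z) = h (z + \<nu>) * (\<Sum>k<n. cnj (z + \<nu>) ^ k * \<phi> k (z + \<nu>)) *
       (of_real (exp (- pi * (cmod (z + \<nu>))\<^sup>2)) * chi \<nu> (z + \<nu>))"
      by (simp only: G_def add.commute mult.assoc)
    also have "\<dots> = z ^ m * (\<Sum>p<n. cnj z ^ p * q p z) * of_real (exp (- pi * (cmod z)\<^sup>2))"
      unfolding exp_gauss_chi_shift polyanalytic_shift h(2) q_def m_def mult.assoc[symmetric] sum_distrib_right[symmetric]
      by (simp only: mult_ac)
    finally show ?thesis by (simp only: m lessThan_Suc_atMost)
  qed
  have [measurable]: "G \<in> borel_measurable borel"
    using borel_measurable_integrable[OF int] by (simp add: G_def)
  have intG: "integrable lborel (\<lambda>z. G (\<nu> + z))"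
    using int integrable_lborel_shift[of G \<nu>] by (simp add: G_def)
  have "(LINT z|lborel. G z) = (LINT z|lborel. G (\<nu> + z))"
    using integral_lborel_shift[of G \<nu>] by simp
  also have "\<dots> = q m 0 * (LINT z|lborel. of_real (cmod z ^ (2 * m)) * of_real (exp (- pi * (cmod z)\<^sup>2)))"
    unfolding G_shift
  proof (rule integral_radial_polyanalytic)
    show "q p holomorphic_on UNIV" if "p \<le> m" for p
      unfolding q_def by (intro holomorphic_intros holomorphic_on_shift \<phi> h(1)) auto
    show "complex_of_real (exp (- pi * (cmod (c * z))\<^sup>2)) = of_real (exp (- pi * (cmod z)\<^sup>2))" if "cmod c = 1" for c z
      by (simp only: norm_mult that mult_1)
    show "complex_integrable lborel (\<lambda>z. z ^ m * (\<Sum>k\<le>m. cnj z ^ k * q k z) * of_real (exp (- pi * (cmod z)\<^sup>2)))"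
      using intG unfolding G_shift .
  qed
  also have "q m 0 = of_real (exp (- pi * (cmod \<nu>)\<^sup>2)) * h1 0 * \<phi> m \<nu>"
  proof -
    have "(\<Sum>k<n. of_nat (k choose m) * cnj \<nu> ^ (k - m) * \<phi> k \<nu>) = (\<Sum>k<n. if k = m then \<phi> m \<nu> else 0)"
      unfolding m by (intro sum.cong refl) (auto simp: binomial_eq_0)
    then show ?thesis by (simp add: q_def m)
  qed
  finally show ?thesis by (simp only: G_def m_def)
qed

text \<open>Along a line of lattice points the quotient tends to 0, which forces
  \<open>a = 0\<close>; what remains is the inverse square sum over a planar lattice, and this
  diverges like the harmonic series.\<close>

lemma (in complex_lattice) inverse_not_square_summable:
  assumes \<kappa>: "\<kappa> \<noteq> 0" and un: "\<And>m. u + lp m \<noteq> 0"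
    and bd: "\<And>J. finite J \<Longrightarrow> 0 \<notin> J \<Longrightarrow> (\<Sum>m\<in>J. (cmod (a - \<kappa> / (u + lp m)))\<^sup>2) \<le> K"
  shows False
proof -
  have a: "a = 0"
  proof -
    define x where "x = (\<lambda>i::nat. a - \<kappa> / (u + lp (int (Suc i), 0)))"
    have "summable (\<lambda>i. (cmod (x i))\<^sup>2)"
    proof (rule bounded_imp_summable)
      fix N :: nat
      have "(\<Sum>i\<le>N. (cmod (x i))\<^sup>2) = (\<Sum>m\<in>(\<lambda>i. (int (Suc i), 0)) ` {..N}. (cmod (a - \<kappa> / (u + lp m)))\<^sup>2)"
        unfolding x_def by (subst sum.reindex) (auto simp: inj_on_def)
      also have "\<dots> \<le> K" by (rule bd) (auto simp: zero_prod_def)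
      finally show "(\<Sum>i\<le>N. (cmod (x i))\<^sup>2) \<le> K" .
    qed simp
    then have "(\<lambda>i. (cmod (x i))\<^sup>2) \<longlonglongrightarrow> 0" by (rule summable_LIMSEQ_zero)
    then have "(\<lambda>i. sqrt ((cmod (x i))\<^sup>2)) \<longlonglongrightarrow> sqrt 0" by (rule tendsto_real_sqrt)
    then have x0: "x \<longlonglongrightarrow> 0" by (simp add: tendsto_norm_zero_iff)
    have "filterlim (\<lambda>i::nat. w1 * of_nat i) at_infinity sequentially"
      by (rule tendsto_mult_filterlim_at_infinity[OF tendsto_const w1_nz tendsto_of_nat])
    then have "filterlim (\<lambda>i::nat. (u + w1) + w1 * of_nat i) at_infinity sequentially"
      by (rule tendsto_add_filterlim_at_infinity[OF tendsto_const])
    then have "filterlim (\<lambda>i::nat. u + lp (int (Suc i), 0)) at_infinity sequentially"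
      by (simp add: lp_def algebra_simps)
    then have "(\<lambda>i. \<kappa> / (u + lp (int (Suc i), 0))) \<longlonglongrightarrow> 0"
      by (rule tendsto_divide_0[OF tendsto_const])
    then have "x \<longlonglongrightarrow> a - 0" unfolding x_def by (intro tendsto_diff tendsto_const)
    then show ?thesis using x0 LIMSEQ_unique by fastforce
  qed
  define C where "C = cmod u + diam + 1"
  have C: "C > 0" unfolding C_def diam_def by (simp add: add_nonneg_pos)
  define e where "e = (\<lambda>(i::nat, j::nat). (int i, int j))"
  have le: "(cmod \<kappa>)\<^sup>2 / C\<^sup>2 * (1 / (real i)\<^sup>2) \<le> (cmod (a - \<kappa> / (u + lp (e (i, j)))))\<^sup>2" if "1 \<le> j" "j \<le> i" for i j
  proof -
    have i: "real i \<ge> 1" "real j \<le> real i" using that by simp_all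
    have "cmod (u + lp (e (i, j))) \<le> cmod u + (real i * cmod w1 + real j * cmod w2)"
      unfolding lp_def e_def by (intro norm_triangle_mono) (simp_all add: norm_mult)
    also have "\<dots> \<le> real i * cmod u + (real i * cmod w1 + real i * cmod w2)"
      using i by (intro add_mono mult_right_mono) (auto simp: mult_le_cancel_right1)
    also have "\<dots> \<le> C * real i" using i by (simp add: C_def diam_def algebra_simps)
    finally have "cmod (u + lp (e (i, j))) \<le> C * real i" .
    then have "(cmod \<kappa> / (C * real i))\<^sup>2 \<le> (cmod \<kappa> / cmod (u + lp (e (i, j))))\<^sup>2"
      using un C i by (intro power_mono divide_left_mono mult_pos_pos) auto
    then show ?thesis by (simp add: a norm_divide power_divide power_mult_distrib)
  qed
  have "summable (\<lambda>i. inverse (real (Suc i)))"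
  proof (rule bounded_imp_summable)
    fix N :: nat
    \<comment> \<open>Row \<open>i\<close> of this triangle holds \<open>i\<close> indices, and at
      each of them the summand is at least a constant times the inverse square of \<open>i\<close>;
      so row \<open>i\<close> contributes at least a multiple of \<open>1 / i\<close>.\<close>
    define J where "J = (SIGMA i:{1..Suc N}. {1..i})"
    have inj: "inj_on e J" by (auto simp: inj_on_def e_def)
    have "(\<Sum>i\<le>N. inverse (real (Suc i))) = (\<Sum>i\<in>{1..Suc N}. inverse (real i))"
      by (rule sum.reindex_bij_witness[of _ "\<lambda>i. i - 1" Suc]) auto
    also have "\<dots> = (\<Sum>i\<in>{1..Suc N}. \<Sum>j\<in>{1..i}. 1 / (real i)\<^sup>2)"
      by (intro sum.cong refl) (simp add: power2_eq_square field_simps)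
    also have "\<dots> = (\<Sum>(i, j)\<in>J. 1 / (real i)\<^sup>2)"
      unfolding J_def by (rule sum.Sigma) auto
    also have "\<dots> \<le> (\<Sum>p\<in>J. C\<^sup>2 / (cmod \<kappa>)\<^sup>2 * (cmod (a - \<kappa> / (u + lp (e p))))\<^sup>2)"
    proof (intro sum_mono)
      fix p assume p: "p \<in> J"
      obtain i j where ij: "p = (i, j)" by (cases p)
      have "(cmod \<kappa>)\<^sup>2 / C\<^sup>2 * (1 / (real i)\<^sup>2) \<le> (cmod (a - \<kappa> / (u + lp (e (i, j)))))\<^sup>2"
        using p by (intro le) (auto simp: J_def ij)
      then have "1 / (real i)\<^sup>2 \<le> (cmod (a - \<kappa> / (u + lp (e (i, j)))))\<^sup>2 / ((cmod \<kappa>)\<^sup>2 / C\<^sup>2)"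
        using C \<kappa> by (subst pos_le_divide_eq) (auto simp: mult.commute)
      then show "(case p of (i, j) \<Rightarrow> 1 / (real i)\<^sup>2) \<le> C\<^sup>2 / (cmod \<kappa>)\<^sup>2 * (cmod (a - \<kappa> / (u + lp (e p))))\<^sup>2"
        by (simp add: ij mult.commute)
    qed
    also have "\<dots> = C\<^sup>2 / (cmod \<kappa>)\<^sup>2 * (\<Sum>m\<in>e ` J. (cmod (a - \<kappa> / (u + lp m)))\<^sup>2)"
      by (simp add: sum.reindex[OF inj] sum_distrib_left)
    also have "\<dots> \<le> C\<^sup>2 / (cmod \<kappa>)\<^sup>2 * K"
      by (intro mult_left_mono bd) (auto simp: J_def e_def zero_prod_def)
    finally show "(\<Sum>i\<le>N. inverse (real (Suc i))) \<le> C\<^sup>2 / (cmod \<kappa>)\<^sup>2 * K" .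
  qed simp
  then have "summable (\<lambda>i. inverse (real i))" by (subst (asm) summable_Suc_iff)
  then show False using not_summable_harmonic[where 'a = real] by simp
qed

section \<open>Nonexistence of a delta function when \<open>n\<close> is at most the density\<close>

context quasi_periodic
begin

text \<open>The locale lattice is \<open>M\<close> here; the interpolation nodes are the points
  \<open>lp m / of_real area\<close>, that is its dual.\<close>

lemma no_delta_function:
  fixes \<phi> :: "nat \<Rightarrow> complex \<Rightarrow> complex"
  defines "F \<equiv> \<lambda>z. \<Sum>k<n. cnj z ^ k * \<phi> k z"
  assumes dens: "real n \<le> area" and \<phi>: "\<And>k. k < n \<Longrightarrow> \<phi> k holomorphic_on UNIV"
    and int: "integrable lborel (\<lambda>z. (cmod (F z))\<^sup>2 * exp (- pi * (cmod z)\<^sup>2))"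
    and zero: "\<And>m. m \<noteq> 0 \<Longrightarrow> F (lp m / of_real area) = 0" and F0: "F 0 \<noteq> 0"
  shows False
proof -
  interpret D: complex_lattice "w1 / of_real area" "w2 / of_real area" by (rule dual_lattice)
  have D_lp: "D.lp m = lp m / of_real area" for m
    by (simp add: D.lp_def lp_def add_divide_distrib)
  have D_area: "D.area = 1 / area"
  proof -
    have "D.area = Im (cnj w1 * w2) / area / area"
      by (simp add: D.area_def Im_divide_of_real diff_divide_distrib)
    also have "Im (cnj w1 * w2) = area" by (simp only: area_def)
    finally show ?thesis using area_gt_0 by simp
  qed
  have dual_dual: "D.lp m / of_real D.area = lp m" for m
    using area_gt_0 by (simp add: D_lp D_area)
  have chi1: "chi (lp m) (D.lp j) = 1" for m j
    using D.chi_dual_lp[of m j] by (simp only: dual_dual)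
  have \<beta>1: "\<beta> \<le> 1" using dens area_gt_0 by (simp add: \<beta>_def)
  \<comment> \<open>A half period, hence off the lattice: \<open>s (- u)\<close> is nonzero, and no
    pole of a test function sits at 0.\<close>
  define u where "u = w1 / 2"
  have u: "u \<notin> range lp"
  proof
    assume "u \<in> range lp"
    then obtain m where "u = lp m" by auto
    then have "xc u = of_int (fst m)" by simp
    moreover have "xc u = 1 / 2" using xc_scale[of "1/2" w1] by (simp add: u_def)
    ultimately have "2 * fst m = (1::int)" by linarith
    then show False by presburger
  qed
  have un: "u + lp m \<noteq> 0" for m
  proof
    assume "u + lp m = 0"
    then have "u = lp (- m)" by (simp add: lp_minus add_eq_0_iff2)
    then show False using u by blast
  qed
  define Fg where "Fg = (\<lambda>z. (cmod (F z))\<^sup>2 * exp (- pi * (cmod z)\<^sup>2))"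
  have contF: "continuous_on UNIV F" unfolding F_def using \<phi> by (intro continuous_on_polyanalytic) auto
  have Fg0: "Fg z \<ge> 0" for z by (simp add: Fg_def)
  have intFg: "integrable lborel Fg" using int by (simp add: Fg_def)
  define K0 where "K0 = (LINT z|lborel. Fg z)"
  obtain rD where rD: "rD > 0" "ball 0 rD \<subseteq> D.cell" by (rule D.small_ball_subset_cell)
  obtain rM where rM: "rM > 0" "ball 0 rM \<subseteq> cell" by (rule small_ball_subset_cell)
  have rD2: "rD / 2 > 0" using rD by simp
  have local_bound: "\<exists>C\<ge>0. \<forall>a. Fg a \<le> C * (LINT z:ball a r|lborel. Fg z) \<and>
      (cmod (\<phi> (n - 1) a))\<^sup>2 * exp (- pi * (cmod a)\<^sup>2) \<le> C * (LINT z:ball a r|lborel. Fg z)" if r: "r > 0" for r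
  proof (rule polyanalytic_fock_bound[OF r, where n = n])
    fix C :: real
    assume C: "C \<ge> 0"
      and 1: "\<And>q a. (\<forall>k<n. q k holomorphic_on UNIV) \<Longrightarrow> (cmod (\<Sum>k<n. cnj a ^ k * q k a))\<^sup>2 * exp (- pi * (cmod a)\<^sup>2) \<le>
         C * (LINT z:ball a r|lborel. (cmod (\<Sum>k<n. cnj z ^ k * q k z))\<^sup>2 * exp (- pi * (cmod z)\<^sup>2))"
      and 2: "\<And>q a m. n = Suc m \<Longrightarrow> (\<forall>k<n. q k holomorphic_on UNIV) \<Longrightarrow> (cmod (q m a))\<^sup>2 * exp (- pi * (cmod a)\<^sup>2) \<le>
         C * (LINT z:ball a r|lborel. (cmod (\<Sum>k<n. cnj z ^ k * q k z))\<^sup>2 * exp (- pi * (cmod z)\<^sup>2))"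
    have \<phi>': "\<forall>k<n. \<phi> k holomorphic_on UNIV" using \<phi> by blast
    have nS: "n = Suc (n - 1)" using n1 by simp
    show ?thesis
      unfolding Fg_def F_def using C 1[OF \<phi>'] 2[OF nS \<phi>'] by blast
  qed
  obtain CD where CD: "CD \<ge> 0" "\<And>a. Fg a \<le> CD * (LINT z:ball a (rD/2)|lborel. Fg z)"
    using local_bound[OF rD2] by blast
  obtain CM where CM: "CM \<ge> 0" "\<And>a. (cmod (\<phi> (n - 1) a))\<^sup>2 * exp (- pi * (cmod a)\<^sup>2) \<le> CM * (LINT z:ball a rM|lborel. Fg z)"
    using local_bound[OF rM(1)] by blast
  define cn where "cn = (LINT z|lborel. complex_of_real (cmod z ^ (2 * (n - 1))) * of_real (exp (- pi * (cmod z)\<^sup>2)))"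
  \<comment> \<open>The weighted top coefficient that appears in the Fourier coefficients;
    \<open>\<beta> \<le> 1\<close> makes it square summable over the lattice, see
    \<open>Tb\<close>.\<close>
  define T where "T = (\<lambda>m. of_real (exp (- pi * (cmod (u + lp m))\<^sup>2)) * of_real (gauss (u + lp m)) * \<phi> (n - 1) (u + lp m))"
  \<comment> \<open>Each \<open>m0\<close> has its own test function and gives one relation between
    \<open>T m0\<close> and \<open>T 0\<close>, whose left side contains
    \<open>1 / (u + lp m0)\<close>.\<close>
  have rel: "\<exists>c. cmod c = 1 \<and> of_real D.vol * (sh u 0 * (1 / u - 1 / (u + lp m0)) * F 0) = cn * k 0 * (c * T m0 - T 0)"
    if m0: "m0 \<noteq> 0" for m0
  proof -
    obtain h c C where c: "cmod c = 1" and hol: "h holomorphic_on UNIV" and C: "C > 0"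
      and hb: "\<And>z. cmod (h z) \<le> C * gauss z / (1 + (cmod z)\<^sup>2)"
      and h0: "h 0 = sh u 0 * (1 / u - 1 / (u + lp m0))"
      and hloc: "\<And>b. \<exists>h1. h1 holomorphic_on UNIV \<and> (\<forall>z. h (z + (u + lp b)) = z ^ (n - 1) * h1 z) \<and>
       h1 0 = (if b = m0 then c * k 0 * of_real (gauss (u + lp m0)) else if b = 0 then - (k 0 * of_real (gauss u)) else 0)"
      by (rule test_function_exists[OF u m0]) (rule that)
    define G where "G = (\<lambda>z. h z * F z * of_real (exp (- pi * (cmod z)\<^sup>2)))"
    define g where "g = (\<lambda>z. G z * chi u z)"
    have contG: "continuous_on UNIV G" unfolding G_def
      by (intro continuous_intros contF holomorphic_on_imp_continuous_on[OF hol])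
    have contg: "continuous_on UNIV g" unfolding g_def by (intro continuous_intros contG)
    \<comment> \<open>Here \<open>\<beta> \<le> 1\<close> enters:
      \<open>gauss z * exp (- pi * (cmod z)\<^sup>2)\<close> is at most the square root of the Fock
      weight. The product of the two square integrable factors is then split into their
      squares.\<close>
    have gb: "cmod (g z) \<le> C * (invquart z + Fg z)" for z
    proof -
      define x where "x = 1 / (1 + (cmod z)\<^sup>2)"
      define y where "y = cmod (F z) * exp (- pi / 2 * (cmod z)\<^sup>2)"
      have p: "1 + (cmod z)\<^sup>2 > 0" by (simp add: add_pos_nonneg)
      have x0: "x \<ge> 0" using p by (simp add: x_def)
      have y0: "y \<ge> 0" by (simp add: y_def)
      have "gauss z * exp (- pi * (cmod z)\<^sup>2) \<le> exp (- pi / 2 * (cmod z)\<^sup>2)"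
      proof -
        have "\<beta> * (pi / 2 * (cmod z)\<^sup>2) \<le> 1 * (pi / 2 * (cmod z)\<^sup>2)" by (rule mult_right_mono[OF \<beta>1]) simp
        then show ?thesis unfolding gauss_def exp_add[symmetric] by (simp add: algebra_simps)
      qed
      then have ge: "cmod (F z) * (gauss z * exp (- pi * (cmod z)\<^sup>2)) \<le> y"
        unfolding y_def by (intro mult_left_mono) auto
      have "cmod (g z) = cmod (h z) * (cmod (F z) * exp (- pi * (cmod z)\<^sup>2))"
        by (simp add: g_def G_def norm_mult)
      also have "\<dots> \<le> (C * gauss z * x) * (cmod (F z) * exp (- pi * (cmod z)\<^sup>2))"
        using hb[of z] by (intro mult_right_mono) (auto simp: x_def)
      also have "\<dots> = C * x * (cmod (F z) * (gauss z * exp (- pi * (cmod z)\<^sup>2)))" by (simp only: mult_ac)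
      also have "\<dots> \<le> C * x * y" using C x0 by (intro mult_left_mono ge) auto
      also have "\<dots> \<le> C * (x\<^sup>2 + y\<^sup>2)"
      proof -
        have "2 * (x * y) \<le> x\<^sup>2 + y\<^sup>2" using sum_squares_bound[of x y] by (simp add: mult.assoc)
        moreover have "0 \<le> x * y" using x0 y0 by simp
        ultimately have "x * y \<le> x\<^sup>2 + y\<^sup>2" by linarith
        then show ?thesis using C by simp
      qed
      also have "x\<^sup>2 = invquart z" by (simp add: x_def invquart_def power_divide)
      also have "y\<^sup>2 = Fg z"
        by (simp add: y_def Fg_def power_mult_distrib exp_double[symmetric])
      finally show ?thesis .
    qed
    have intg: "integrable lborel g"
    proof (rule Bochner_Integration.integrable_bound)
      show "integrable lborel (\<lambda>z. C * (invquart z + Fg z))"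
        by (intro Bochner_Integration.integrable_mult_right Bochner_Integration.integrable_add integrable_invquart intFg)
      show "g \<in> borel_measurable lborel" using contg by (simp add: borel_measurable_continuous_onI)
      show "AE z in lborel. norm (g z) \<le> norm (C * (invquart z + Fg z))"
        using gb by (intro AE_I2) (smt (verit) real_norm_def)
    qed
    define P where "P = (\<lambda>z. \<Sum>\<^sub>\<infinity>m. g (z + D.lp m))"
    \<comment> \<open>For the Fock part of \<open>g\<close> no pointwise rate of decay is at hand;
      its translates are dominated by integrals over disjoint discs, whose sum is at most
      \<open>K0\<close>. Passing from radius \<open>rD/2\<close> to \<open>rD\<close> makes the
      bound uniform near \<open>z0\<close>.\<close>
    have major: "\<exists>M. M summable_on UNIV \<and> (\<forall>m. \<forall>z\<in>cball z0 (rD/2). cmod (g (z + D.lp m)) \<le> M m)" for z0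
    proof (intro exI conjI allI ballI)
      define I where "I = (\<lambda>m. LINT \<zeta>:ball (z0 + D.lp m) rD|lborel. Fg \<zeta>)"
      define Kz where "Kz = 4 * (1 + (cmod z0 + rD/2)\<^sup>2)\<^sup>2"
      have I0: "I m \<ge> 0" for m unfolding I_def set_lebesgue_integral_def
        by (rule Bochner_Integration.integral_nonneg) (auto simp: Fg0)
      have "I summable_on UNIV"
      proof (rule nonneg_bdd_above_summable_on)
        show "bdd_above (sum I ` {F. F \<subseteq> UNIV \<and> finite F})"
          by (rule bdd_aboveI[of _ K0]) (auto simp: I_def K0_def intro!: D.sum_ball_integrals_le intFg Fg0 rD)
      qed (use I0 in auto)
      then show "(\<lambda>m. C * (Kz * invquart (D.lp m) + CD * I m)) summable_on UNIV"
        by (intro summable_on_cmult_right summable_on_add D.invquart_summable)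
      fix m z assume z: "z \<in> cball z0 (rD/2)"
      have zn: "cmod z \<le> cmod z0 + rD/2"
        using z norm_triangle_ineq2[of z z0] by (simp add: dist_norm norm_minus_commute)
      have "invquart (z + D.lp m) \<le> 4 * (1 + (cmod (- z))\<^sup>2)\<^sup>2 * invquart (z + D.lp m + (- z))"
        by (rule invquart_shift_le)
      also have "\<dots> \<le> Kz * invquart (D.lp m)"
        using zn invquart_pos[of "D.lp m"]
        by (auto simp: Kz_def intro!: mult_right_mono mult_left_mono power_mono)
      finally have 1: "invquart (z + D.lp m) \<le> Kz * invquart (D.lp m)" .
      have "Fg (z + D.lp m) \<le> CD * (LINT \<zeta>:ball (z + D.lp m) (rD/2)|lborel. Fg \<zeta>)" by (rule CD(2))
      also have "\<dots> \<le> CD * I m"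
        unfolding I_def
      proof (intro mult_left_mono CD(1) set_integral_ball_mono Fg0)
        show "continuous_on UNIV Fg" unfolding Fg_def by (intro continuous_intros contF)
        show "ball (z + D.lp m) (rD/2) \<subseteq> ball (z0 + D.lp m) rD"
          using z by (auto simp: ball_subset_ball_iff dist_commute)
      qed
      finally have 2: "Fg (z + D.lp m) \<le> CD * I m" .
      have "cmod (g (z + D.lp m)) \<le> C * (invquart (z + D.lp m) + Fg (z + D.lp m))" by (rule gb)
      also have "\<dots> \<le> C * (Kz * invquart (D.lp m) + CD * I m)"
        using C by (intro mult_left_mono add_mono 1 2) auto
      finally show "cmod (g (z + D.lp m)) \<le> C * (Kz * invquart (D.lp m) + CD * I m)" .
    qed
    have summ: "(\<lambda>m. norm (g (z + D.lp m))) summable_on UNIV" for z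
    proof -
      obtain M where M: "M summable_on UNIV" "\<And>m x. x \<in> cball z (rD/2) \<Longrightarrow> cmod (g (x + D.lp m)) \<le> M m"
        using major[of z] by blast
      show ?thesis
        by (rule summable_on_comparison_test[OF M(1)]) (use M(2)[of z] rD in auto)
    qed
    have Psum: "((\<lambda>m. g (z + D.lp m)) has_sum P z) UNIV" for z
      unfolding P_def using abs_summable_summable[OF summ] by (rule has_sum_infsum)
    have contP: "continuous_on UNIV P"
    proof (rule continuous_at_imp_continuous_on, rule ballI)
      fix z0
      obtain M where M: "M summable_on UNIV" "\<And>m x. x \<in> cball z0 (rD/2) \<Longrightarrow> cmod (g (x + D.lp m)) \<le> M m"
        using major[of z0] by blast
      have "uniform_limit (cball z0 (rD/2)) (\<lambda>X z. \<Sum>m\<in>X. g (z + D.lp m)) (\<lambda>z. \<Sum>\<^sub>\<infinity>m. g (z + D.lp m)) (finite_subsets_at_top UNIV)"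
        using M by (intro Weierstrass_m_test_general) auto
      then have "continuous_on (cball z0 (rD/2)) (\<lambda>z. \<Sum>\<^sub>\<infinity>m. g (z + D.lp m))"
        by (rule uniform_limit_theorem[rotated])
           (auto intro!: always_eventually continuous_on_sum continuous_on_compose2[OF contg] continuous_intros)
      then have "continuous_on (ball z0 (rD/2)) P"
        unfolding P_def by (rule continuous_on_subset) auto
      then show "isCont P z0" using rD by (simp add: continuous_on_eq_continuous_at)
    qed
    define co where "co = (\<lambda>m. LINT z|lborel. g z * chi (lp m) z)"
    \<comment> \<open>Unfolding over a cell of the dual lattice, on which the characters
      \<open>chi (lp m)\<close> are periodic, turns a coefficient of \<open>P\<close> into an
      integral over the plane.\<close>
    have coeff: "(LINT z:D.cell|lborel. P z * chi (lp m) z) = co m" for m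
    proof -
      have "co m = (LINT z:D.cell|lborel. P z * chi (lp m) z)"
        unfolding co_def
      proof (rule D.integral_unfold)
        show "integrable lborel (\<lambda>z. g z * chi (lp m) z)"
          by (rule Bochner_Integration.integrable_bound[OF intg])
             (auto simp: norm_mult intro!: borel_measurable_continuous_onI continuous_intros contg)
        have "((\<lambda>j. g (z + D.lp j) * chi (lp m) z) has_sum P z * chi (lp m) z) UNIV" for z
          by (intro has_sum_cmult_left Psum)
        moreover have "(\<lambda>j. norm (g (z + D.lp j) * chi (lp m) z)) summable_on UNIV" for z
          using summ[of z] by (simp add: norm_mult)
        ultimately show "AE z in lborel. z \<in> D.cell \<longrightarrow>
          ((\<lambda>j. g (z + D.lp j) * chi (lp m) (z + D.lp j)) has_sum P z * chi (lp m) z) UNIV \<and>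
          (\<lambda>j. norm (g (z + D.lp j) * chi (lp m) (z + D.lp j))) summable_on UNIV"
          by (simp add: chi_add chi1)
        show "(\<lambda>z. P z * chi (lp m) z) \<in> borel_measurable borel"
          by (intro borel_measurable_continuous_onI continuous_intros contP)
      qed
      then show ?thesis by simp
    qed
    have co_val: "co m = (if m = m0 then cn * k 0 * (c * T m0) else if m = 0 then - (cn * k 0 * T 0) else 0)" for m
    proof -
      obtain h1 where h1: "h1 holomorphic_on UNIV" "\<And>z. h (z + (u + lp m)) = z ^ (n - 1) * h1 z"
        "h1 0 = (if m = m0 then c * k 0 * of_real (gauss (u + lp m0)) else if m = 0 then - (k 0 * of_real (gauss u)) else 0)"
        using hloc[of m] by blast
      have eq: "g z * chi (lp m) z = h z * (\<Sum>k<n. cnj z ^ k * \<phi> k z) * of_real (exp (- pi * (cmod z)\<^sup>2)) * chi (u + lp m) z" for z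
        by (simp add: g_def G_def F_def chi_add_left mult.assoc)
      have i: "integrable lborel (\<lambda>z. g z * chi (lp m) z)"
        by (rule Bochner_Integration.integrable_bound[OF intg])
           (auto simp: norm_mult intro!: borel_measurable_continuous_onI continuous_intros contg)
      have "co m = of_real (exp (- pi * (cmod (u + lp m))\<^sup>2)) * h1 0 * \<phi> (n - 1) (u + lp m) * cn"
        unfolding co_def eq cn_def using i unfolding eq by (intro gauss_pairing_at_zero n1 h1(1,2) \<phi>)
      then show ?thesis unfolding h1(3) T_def by auto
    qed
    have chint: "(LINT z:D.cell|lborel. chi (lp j) z) = (if j = 0 then of_real D.vol else 0)" for j
    proof (cases "j = 0")
      case True
      then show ?thesis using D.emeasure_cell
        by (simp add: set_integral_const D.vol_def set_lebesgue_integral_def scaleR_conv_of_real)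
    next
      case False
      then show ?thesis using D.integral_chi_cell[of "lp j"] by (simp add: chi1)
    qed
    \<comment> \<open>\<open>P\<close> minus its expected two-term Fourier series, cleared of the
      denominator \<open>D.vol\<close>. The minus sign at \<open>lp m0\<close> appears because
      coefficients are taken against \<open>chi (lp m)\<close> without conjugation.\<close>
    define p where "p = (\<lambda>z. of_real D.vol * P z - (co m0 * chi (- lp m0) z + co 0))"
    have "p 0 = 0"
    proof (rule D.fourier_unique_at_0)
      show "continuous_on UNIV p" unfolding p_def by (intro continuous_intros contP)
      fix m
      have i1: "set_integrable lborel D.cell (\<lambda>z. P z * chi (lp m) z)"
        by (intro D.set_integrable_cell continuous_intros contP)
      have i2: "set_integrable lborel D.cell (chi (lp j))" for j
        using D.set_integrable_cell[OF continuous_on_chi[OF continuous_on_id]] by simp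
      have "p z * chi (lp m) z = of_real D.vol * (P z * chi (lp m) z) - (co m0 * chi (lp (m - m0)) z + co 0 * chi (lp m) z)" for z
      proof -
        have "chi (- lp m0) z * chi (lp m) z = chi (lp (m - m0)) z"
          by (simp add: chi_add_left[symmetric] lp_diff)
        then show ?thesis by (simp add: p_def algebra_simps)
      qed
      then have "(LINT z:D.cell|lborel. p z * chi (lp m) z) =
         of_real D.vol * co m - (co m0 * (LINT z:D.cell|lborel. chi (lp (m - m0)) z) + co 0 * (LINT z:D.cell|lborel. chi (lp m) z))"
        using i1 i2 by (simp add: set_integral_diff set_integral_add coeff)
      also have "\<dots> = 0" using m0 by (auto simp: chint co_val)
      finally show "(LINT z:D.cell|lborel. p z * chi (D.lp m / of_real D.area) z) = 0" by (simp only: dual_dual)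
    qed
    then have "of_real D.vol * P 0 = co m0 + co 0" by (simp add: p_def)
    \<comment> \<open>At 0 the periodisation runs over the nodes, where \<open>F\<close> vanishes
      except at 0.\<close>
    moreover have "P 0 = h 0 * F 0"
    proof -
      have "g (D.lp m) = 0" if "m \<noteq> 0" for m using zero[OF that] by (simp add: g_def G_def D_lp)
      then have "P 0 = (\<Sum>\<^sub>\<infinity>m\<in>{0}. g (0 + D.lp m))"
        unfolding P_def by (intro infsum_cong_neutral) auto
      then show ?thesis by (simp add: g_def G_def)
    qed
    ultimately have "of_real D.vol * (sh u 0 * (1 / u - 1 / (u + lp m0)) * F 0) = cn * k 0 * (c * T m0 - T 0)"
      using m0 by (simp add: h0 co_val algebra_simps)
    with c show ?thesis by blast
  qed
  define \<kappa> where "\<kappa> = of_real D.vol * sh u 0 * F 0"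
  \<comment> \<open>Collects the part of \<open>rel\<close> that does not depend on
    \<open>m0\<close>, so that \<open>a - \<kappa> / (u + lp m)\<close> is a unimodular multiple of
    \<open>cn * k 0 * T m\<close>.\<close>
  define a where "a = \<kappa> / u + cn * k 0 * T 0"
  have "- u \<notin> range lp"
  proof
    assume "- u \<in> range lp"
    then obtain m where "- u = lp m" by auto
    then have "u = lp (- m)" by (metis lp_minus minus_minus)
    then show False using u by blast
  qed
  then have "s (- u) \<noteq> 0" by (rule s_nz)
  then have \<kappa>0: "\<kappa> \<noteq> 0" using F0 D.vol_pos by (simp add: \<kappa>_def sh_def)
  have Tb: "(cmod (T m))\<^sup>2 \<le> CM * (LINT z:ball (u + lp m) rM|lborel. Fg z)" for m
  proof -
    define y where "y = (cmod (u + lp m))\<^sup>2"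
    have y: "y \<ge> 0" by (simp add: y_def)
    have "(cmod (T m))\<^sup>2 = (exp (- pi * y) * gauss (u + lp m))\<^sup>2 * (cmod (\<phi> (n - 1) (u + lp m)))\<^sup>2"
      using gauss_ge_1[of "u + lp m"] by (simp add: T_def norm_mult power_mult_distrib y_def)
    also have "(exp (- pi * y) * gauss (u + lp m))\<^sup>2 \<le> exp (- pi * y)"
    proof -
      have "\<beta> * (pi * y) \<le> 1 * (pi * y)" using y by (intro mult_right_mono \<beta>1) auto
      then show ?thesis
        unfolding gauss_def exp_add[symmetric] exp_double[symmetric] y_def[symmetric] by (simp add: algebra_simps)
    qed
    then have "(exp (- pi * y) * gauss (u + lp m))\<^sup>2 * (cmod (\<phi> (n - 1) (u + lp m)))\<^sup>2 \<le>
        exp (- pi * y) * (cmod (\<phi> (n - 1) (u + lp m)))\<^sup>2" by (intro mult_right_mono) auto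
    also have "\<dots> \<le> CM * (LINT z:ball (u + lp m) rM|lborel. Fg z)"
      using CM(2)[of "u + lp m"] by (simp add: y_def mult.commute)
    finally show ?thesis .
  qed
  show False
  proof (rule inverse_not_square_summable[OF \<kappa>0 un])
    fix J :: "(int \<times> int) set" assume J: "finite J" "0 \<notin> J"
    have "(\<Sum>m\<in>J. (cmod (a - \<kappa> / (u + lp m)))\<^sup>2) \<le>
      (\<Sum>m\<in>J. (cmod (cn * k 0))\<^sup>2 * (CM * (LINT z:ball (u + lp m) rM|lborel. Fg z)))"
    proof (intro sum_mono)
      fix m assume "m \<in> J"
      then have "m \<noteq> 0" using J by auto
      then obtain c where c: "cmod c = 1" "of_real D.vol * (sh u 0 * (1 / u - 1 / (u + lp m)) * F 0) = cn * k 0 * (c * T m - T 0)"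
        using rel by blast
      have "a - \<kappa> / (u + lp m) = of_real D.vol * (sh u 0 * (1 / u - 1 / (u + lp m)) * F 0) + cn * k 0 * T 0"
        by (simp add: a_def \<kappa>_def algebra_simps)
      also have "\<dots> = cn * k 0 * (c * T m)" unfolding c(2) by (simp add: algebra_simps)
      finally have "(cmod (a - \<kappa> / (u + lp m)))\<^sup>2 = (cmod (cn * k 0))\<^sup>2 * (cmod (T m))\<^sup>2"
        by (simp add: norm_mult c(1) power_mult_distrib)
      also have "\<dots> \<le> (cmod (cn * k 0))\<^sup>2 * (CM * (LINT z:ball (u + lp m) rM|lborel. Fg z))"
        by (intro mult_left_mono Tb) auto
      finally show "(cmod (a - \<kappa> / (u + lp m)))\<^sup>2 \<le> (cmod (cn * k 0))\<^sup>2 * (CM * (LINT z:ball (u + lp m) rM|lborel. Fg z))" .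
    qed
    also have "\<dots> = (cmod (cn * k 0))\<^sup>2 * CM * (\<Sum>m\<in>J. LINT z:ball (u + lp m) rM|lborel. Fg z)"
      by (simp add: sum_distrib_left mult.assoc)
    also have "\<dots> \<le> (cmod (cn * k 0))\<^sup>2 * CM * K0"
      unfolding K0_def using CM(1) J(1) by (intro mult_left_mono sum_ball_integrals_le intFg Fg0 rM) auto
    finally show "(\<Sum>m\<in>J. (cmod (a - \<kappa> / (u + lp m)))\<^sup>2) \<le> (cmod (cn * k 0))\<^sup>2 * CM * K0" .
  qed
qed

end

section \<open>Contour integrals around the period parallelogram\<close>

text \<open>The remainder quotient \<open>r\<close> is entire because each step divides out a zero
  at 0; it separates off the finitely many terms that a pole of order \<open>m\<close> can
  see.\<close>

lemma exp_taylor_remainder: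
  obtains d :: "nat \<Rightarrow> complex" and r where "r holomorphic_on UNIV" "\<And>x. exp x = (\<Sum>j<m. d j * x ^ j) + x ^ m * r x"
proof -
  have "\<exists>d r. r holomorphic_on UNIV \<and> (\<forall>x::complex. exp x = (\<Sum>j<m. d j * x ^ j) + x ^ m * r x)"
  proof (induction m)
    case 0
    show ?case by (rule exI, rule exI[of _ exp]) (auto intro: holomorphic_intros)
  next
    case (Suc m)
    then obtain d r where r: "r holomorphic_on UNIV" "\<And>x::complex. exp x = (\<Sum>j<m. d j * x ^ j) + x ^ m * r x" by blast
    define r' where "r' = (\<lambda>x. if x = 0 then deriv r 0 else (r x - r 0) / (x - 0))"
    have 1: "r' holomorphic_on UNIV" unfolding r'_def by (rule pole_lemma[OF r(1)]) simp
    have 2: "r x = r 0 + x * r' x" for x by (simp add: r'_def)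
    show ?case
    proof (intro exI conjI allI)
      show "r' holomorphic_on UNIV" by (rule 1)
      fix x :: complex
      have "(\<Sum>j<Suc m. (if j = m then r 0 else d j) * x ^ j) = (\<Sum>j<m. d j * x ^ j) + r 0 * x ^ m" by simp
      then show "exp x = (\<Sum>j<Suc m. (if j = m then r 0 else d j) * x ^ j) + x ^ Suc m * r' x"
        using r(2)[of x] 2[of x] by (simp add: algebra_simps)
    qed
  qed
  then show thesis using that by blast
qed

lemma contour_integral_linepath_shift:
  "contour_integral (linepath (p + d) (q + d)) f = contour_integral (linepath p q) (\<lambda>t. f (t + d))"
proof -
  have "linepath (p + d) (q + d) x = linepath p q x + d" for x
    by (simp add: linepath_def algebra_simps)
  then show ?thesis by (simp add: contour_integral_integral)
qed

section \<open>Exponential estimates\<close>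

lemma exp_linear_le_exp_quadratic:
  fixes A B :: real
  assumes "B > 0"
  obtains K where "K > 0" "\<And>x. exp (A * x) \<le> K * exp (B * x\<^sup>2)"
proof
  show "exp (A\<^sup>2 / (4 * B)) > 0" by simp
  fix x
  have "0 \<le> (2 * B * x - A)\<^sup>2 / (4 * B)" using assms by simp
  also have "\<dots> = A\<^sup>2 / (4 * B) + B * x\<^sup>2 - A * x" using assms by (simp add: power2_eq_square field_simps)
  finally show "exp (A * x) \<le> exp (A\<^sup>2 / (4 * B)) * exp (B * x\<^sup>2)" by (simp flip: exp_add)
qed

lemma power_le_exp:
  assumes "x \<ge> (0::real)"
  shows "(1 + x) ^ N \<le> exp (real N * x)"
proof -
  have "(1 + x) ^ N \<le> exp x ^ N" using assms by (intro power_mono) auto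
  then show ?thesis by (simp add: exp_of_nat_mult)
qed

lemma exp_linear_gauss_le_invquart:
  fixes A B :: real
  assumes B: "B > 0"
  obtains K where "K > 0" "\<And>z. exp (A * cmod z - B * (cmod z)\<^sup>2) \<le> K * invquart z"
proof -
  \<comment> \<open>\<open>(1 + x\<^sup>2)\<^sup>2\<close> is at most \<open>exp (4 * x)\<close> for
    nonnegative \<open>x\<close>, so 4 is added to the linear coefficient in advance.\<close>
  obtain K where K: "K > 0" "\<And>x. exp ((A + 4) * x) \<le> K * exp (B * x\<^sup>2)"
    using exp_linear_le_exp_quadratic[OF B, where A = "A + 4"] by blast
  have "exp (A * cmod z - B * (cmod z)\<^sup>2) \<le> K * invquart z" for z
  proof -
    define x where "x = cmod z"
    have x: "x \<ge> 0" by (simp add: x_def)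
    have "(1 + x\<^sup>2)\<^sup>2 \<le> ((1 + x)\<^sup>2)\<^sup>2"
      using x by (intro power_mono) (auto simp: power2_eq_square algebra_simps)
    also have "\<dots> = (1 + x) ^ 4" by (simp flip: power_mult)
    also have "\<dots> \<le> exp (real 4 * x)" by (rule power_le_exp[OF x])
    finally have "exp (A * x) * (1 + x\<^sup>2)\<^sup>2 \<le> exp (A * x) * exp (4 * x)" by (intro mult_left_mono) auto
    also have "\<dots> = exp ((A + 4) * x)" by (simp add: exp_add[symmetric] algebra_simps)
    also have "\<dots> \<le> K * exp (B * x\<^sup>2)" by (rule K(2))
    finally have "exp (A * x) * (1 + x\<^sup>2)\<^sup>2 \<le> K * exp (B * x\<^sup>2)" .
    moreover have "(1 + x\<^sup>2)\<^sup>2 > 0" by (intro zero_less_power add_pos_nonneg) auto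
    ultimately show ?thesis by (simp add: invquart_def exp_diff x_def[symmetric] field_simps)
  qed
  then show thesis using that K(1) by blast
qed

section \<open>The boundary of the cell and its winding number\<close>

context complex_lattice
begin

definition icell :: "complex set" where "icell = {z. \<bar>xc z\<bar> < 1/2 \<and> \<bar>yc z\<bar> < 1/2}"

text \<open>Runs counterclockwise. The third and fourth sides are the reversed translates of the
  first two by \<open>w2\<close> and by \<open>- w1\<close>, which
  \<open>contour_integral_bp\<close> exploits.\<close>

definition bp :: "real \<Rightarrow> complex" where
  "bp = linepath (- (w1/2) - w2/2) (w1/2 - w2/2) +++ linepath (w1/2 - w2/2) (w1/2 + w2/2) +++
        linepath (w1/2 + w2/2) (- (w1/2) + w2/2) +++ linepath (- (w1/2) + w2/2) (- (w1/2) - w2/2)"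

lemma xc_half [simp]: "xc (w1/2) = 1/2" "xc (w2/2) = 0" and yc_half [simp]: "yc (w1/2) = 0" "yc (w2/2) = 1/2"
  using xc_scale[of "1/2" w1] xc_scale[of "1/2" w2] yc_scale[of "1/2" w1] yc_scale[of "1/2" w2] by simp_all

lemma xc_scaleR [simp]: "xc (r *\<^sub>R z) = r * xc z" and yc_scaleR [simp]: "yc (r *\<^sub>R z) = r * yc z"
  by (simp_all add: scaleR_conv_of_real)

lemma convex_ccell: "convex ccell" and convex_icell: "convex icell"
proof -
  have tri: "\<bar>u * a + v * b\<bar> \<le> M" if "0 \<le> u" "0 \<le> v" "u + v = 1" "\<bar>a\<bar> \<le> M" "\<bar>b\<bar> \<le> M" for u v a b M :: real
  proof -
    have "\<bar>u * a + v * b\<bar> \<le> u * \<bar>a\<bar> + v * \<bar>b\<bar>"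
      using that by (intro order_trans[OF abs_triangle_ineq]) (simp add: abs_mult)
    also have "\<dots> \<le> u * M + v * M" using that by (intro add_mono mult_left_mono) auto
    also have "\<dots> = M" using that by (simp flip: distrib_right)
    finally show ?thesis .
  qed
  have tri': "\<bar>u * a + v * b\<bar> < M" if "0 \<le> u" "0 \<le> v" "u + v = 1" "\<bar>a\<bar> < M" "\<bar>b\<bar> < M" for u v a b M :: real
    using tri[OF that(1-3), of a "max \<bar>a\<bar> \<bar>b\<bar>" b] that(4,5) by linarith
  show "convex ccell"
  proof (rule convexI)
    fix x y and u v :: real
    assume "x \<in> ccell" "y \<in> ccell" "0 \<le> u" "0 \<le> v" "u + v = 1"
    then show "u *\<^sub>R x + v *\<^sub>R y \<in> ccell"
      unfolding ccell_def mem_Collect_eq xc_add yc_add xc_scaleR yc_scaleR by (intro conjI tri) blast+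
  qed
  show "convex icell"
  proof (rule convexI)
    fix x y and u v :: real
    assume "x \<in> icell" "y \<in> icell" "0 \<le> u" "0 \<le> v" "u + v = 1"
    then show "u *\<^sub>R x + v *\<^sub>R y \<in> icell"
      unfolding icell_def mem_Collect_eq xc_add yc_add xc_scaleR yc_scaleR by (intro conjI tri') blast+
  qed
qed

lemma open_icell: "open icell"
proof -
  have "icell = (\<lambda>z. \<bar>xc z\<bar>) -` {..<1/2} \<inter> (\<lambda>z. \<bar>yc z\<bar>) -` {..<1/2}" by (auto simp: icell_def)
  moreover have "open ((\<lambda>z. \<bar>xc z\<bar>) -` {..<1/2})" "open ((\<lambda>z. \<bar>yc z\<bar>) -` {..<1/2})"
    by (intro open_vimage continuous_intros open_lessThan)+
  ultimately show ?thesis by auto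
qed

lemma icell_interior: "z \<in> icell \<Longrightarrow> z \<in> interior ccell"
  using open_icell by (rule interiorI) (auto simp: icell_def ccell_def)

lemma valid_bp: "valid_path bp" "pathfinish bp = pathstart bp"
  by (auto simp: bp_def intro!: valid_path_join)

lemma segment_xc: "z \<in> closed_segment p q \<Longrightarrow> xc p = x \<Longrightarrow> xc q = x \<Longrightarrow> xc z = x"
  and segment_yc: "z \<in> closed_segment p q \<Longrightarrow> yc p = y \<Longrightarrow> yc q = y \<Longrightarrow> yc z = y"
  by (auto simp: in_segment left_diff_distrib)

definition side1 where "side1 = closed_segment (- (w1/2) - w2/2) (w1/2 - w2/2)"
definition side2 where "side2 = closed_segment (w1/2 - w2/2) (w1/2 + w2/2)"
definition side3 where "side3 = closed_segment (w1/2 + w2/2) (- (w1/2) + w2/2)"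
definition side4 where "side4 = closed_segment (- (w1/2) + w2/2) (- (w1/2) - w2/2)"

lemma side_coords:
  "z \<in> side1 \<Longrightarrow> yc z = - 1/2" "z \<in> side2 \<Longrightarrow> xc z = 1/2"
  "z \<in> side3 \<Longrightarrow> yc z = 1/2" "z \<in> side4 \<Longrightarrow> xc z = - 1/2"
proof -
  show "z \<in> side1 \<Longrightarrow> yc z = - 1/2" unfolding side1_def by (erule segment_yc) simp_all
  show "z \<in> side2 \<Longrightarrow> xc z = 1/2" unfolding side2_def by (erule segment_xc) simp_all
  show "z \<in> side3 \<Longrightarrow> yc z = 1/2" unfolding side3_def by (erule segment_yc) simp_all
  show "z \<in> side4 \<Longrightarrow> xc z = - 1/2" unfolding side4_def by (erule segment_xc) simp_all
qed

lemma path_image_bp: "path_image bp = side1 \<union> side2 \<union> side3 \<union> side4"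
  by (simp add: bp_def path_image_join side1_def side2_def side3_def side4_def Un_assoc)

lemma sides_ccell: "side1 \<union> side2 \<union> side3 \<union> side4 \<subseteq> ccell"
proof -
  have "closed_segment p q \<subseteq> ccell" if "p \<in> ccell" "q \<in> ccell" for p q
    using that convex_ccell by (simp add: closed_segment_subset)
  then show ?thesis unfolding side1_def side2_def side3_def side4_def
    by (intro Un_least) (auto simp: ccell_def)
qed

lemma bp_disjoint_icell: "icell \<inter> path_image bp = {}"
  using side_coords unfolding path_image_bp icell_def by fastforce

lemma bp_ccell: "path_image bp \<subseteq> ccell"
  using sides_ccell path_image_bp by simp

text \<open>The winding number is carried along as a symbol: it is constant on the open cell and
  nonzero, and ends up as a factor of the value of the delta function at 0.\<close>

definition W :: complex where "W = winding_number bp 0"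

lemma winding_bp: "z \<in> icell \<Longrightarrow> winding_number bp z = W"
  unfolding W_def
  by (rule winding_number_eq[OF valid_path_imp_path[OF valid_bp(1)] valid_bp(2) _ _ convex_connected[OF convex_icell] bp_disjoint_icell])
     (auto simp: icell_def)

text \<open>By positive orientation the origin lies to the left of every side, so each side
  contributes a winding number with positive real part.\<close>

lemma W_nz: "W \<noteq> 0"
proof -
  have z: "0 \<notin> side1" "0 \<notin> side2" "0 \<notin> side3" "0 \<notin> side4"
    using side_coords[of 0] by auto
  note z' = z[unfolded side1_def side2_def side3_def side4_def]
  have "W = winding_number (linepath (- (w1/2) - w2/2) (w1/2 - w2/2)) 0 + (winding_number (linepath (w1/2 - w2/2) (w1/2 + w2/2)) 0 +
        (winding_number (linepath (w1/2 + w2/2) (- (w1/2) + w2/2)) 0 + winding_number (linepath (- (w1/2) + w2/2) (- (w1/2) - w2/2)) 0))"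
    unfolding W_def bp_def using z'
    by (subst winding_number_join | simp add: path_image_join)+
  moreover have "Re (winding_number (linepath (- (w1/2) - w2/2) (w1/2 - w2/2)) 0) > 0"
    "Re (winding_number (linepath (w1/2 - w2/2) (w1/2 + w2/2)) 0) > 0"
    "Re (winding_number (linepath (w1/2 + w2/2) (- (w1/2) + w2/2)) 0) > 0"
    "Re (winding_number (linepath (- (w1/2) + w2/2) (- (w1/2) - w2/2)) 0) > 0"
    using area_pos by (intro winding_number_linepath_pos_lt; simp add: algebra_simps)+
  ultimately have "Re W > 0" by simp
  then show ?thesis by auto
qed

text \<open>Opposite sides are expressed over the same segment, so that each difference telescopes
  once the integrand is translated through the lattice.\<close>

lemma contour_integral_bp:
  assumes "continuous_on (path_image bp) f"
  shows "contour_integral bp f =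
    contour_integral (linepath (- (w1/2) - w2/2) (w1/2 - w2/2)) f - contour_integral (linepath (- (w1/2) - w2/2) (w1/2 - w2/2)) (\<lambda>t. f (t + w2))
    + (contour_integral (linepath (w1/2 - w2/2) (w1/2 + w2/2)) f - contour_integral (linepath (w1/2 - w2/2) (w1/2 + w2/2)) (\<lambda>t. f (t - w1)))"
    "f contour_integrable_on bp"
proof -
  have c: "continuous_on side1 f" "continuous_on side2 f" "continuous_on side3 f" "continuous_on side4 f"
    using assms by (auto simp: path_image_bp elim: continuous_on_subset)
  note i = c[unfolded side1_def side2_def side3_def side4_def, THEN contour_integrable_continuous_linepath]
  show "f contour_integrable_on bp"
    unfolding bp_def using i by simp
  have "contour_integral bp f = contour_integral (linepath (- (w1/2) - w2/2) (w1/2 - w2/2)) f + (contour_integral (linepath (w1/2 - w2/2) (w1/2 + w2/2)) f +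
        (contour_integral (linepath (w1/2 + w2/2) (- (w1/2) + w2/2)) f + contour_integral (linepath (- (w1/2) + w2/2) (- (w1/2) - w2/2)) f))"
    unfolding bp_def using i by simp
  also have "contour_integral (linepath (w1/2 + w2/2) (- (w1/2) + w2/2)) f =
     - contour_integral (linepath (- (w1/2) - w2/2) (w1/2 - w2/2)) (\<lambda>t. f (t + w2))"
  proof -
    have "contour_integral (linepath (w1/2 + w2/2) (- (w1/2) + w2/2)) f = - contour_integral (linepath (- (w1/2) + w2/2) (w1/2 + w2/2)) f"
      by (rule contour_integral_reverse_linepath) (use c(3) in \<open>simp add: side3_def closed_segment_commute\<close>)
    also have "contour_integral (linepath (- (w1/2) + w2/2) (w1/2 + w2/2)) f =
      contour_integral (linepath ((- (w1/2) - w2/2) + w2) ((w1/2 - w2/2) + w2)) f"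
      by (simp add: field_simps)
    finally show ?thesis by (simp only: contour_integral_linepath_shift)
  qed
  also have "contour_integral (linepath (- (w1/2) + w2/2) (- (w1/2) - w2/2)) f =
     - contour_integral (linepath (w1/2 - w2/2) (w1/2 + w2/2)) (\<lambda>t. f (t - w1))"
  proof -
    have "contour_integral (linepath (- (w1/2) + w2/2) (- (w1/2) - w2/2)) f = - contour_integral (linepath (- (w1/2) - w2/2) (- (w1/2) + w2/2)) f"
      by (rule contour_integral_reverse_linepath) (use c(4) in \<open>simp add: side4_def closed_segment_commute\<close>)
    also have "contour_integral (linepath (- (w1/2) - w2/2) (- (w1/2) + w2/2)) f =
      contour_integral (linepath ((w1/2 - w2/2) + - w1) ((w1/2 + w2/2) + - w1)) f"
      by (simp add: field_simps)
    finally show ?thesis by (simp only: contour_integral_linepath_shift) simp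
  qed
  finally show "contour_integral bp f =
    contour_integral (linepath (- (w1/2) - w2/2) (w1/2 - w2/2)) f - contour_integral (linepath (- (w1/2) - w2/2) (w1/2 - w2/2)) (\<lambda>t. f (t + w2))
    + (contour_integral (linepath (w1/2 - w2/2) (w1/2 + w2/2)) f - contour_integral (linepath (w1/2 - w2/2) (w1/2 + w2/2)) (\<lambda>t. f (t - w1)))"
    by simp
qed

text \<open>The part of the cell outside the open cell lies on two lines. Off them the point
  \<open>- v\<close> avoids the contour for all lattice translates of \<open>v\<close>.\<close>

lemma AE_icell: "AE z in lborel. z \<in> cell \<longrightarrow> z \<in> icell"
proof -
  have h: "AE z in lborel. xc z \<noteq> - 1/2" "AE z in lborel. yc z \<noteq> - 1/2"
  proof -
    define p where "p = Complex (Im w2 / area) (- (Re w2 / area))"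
    define q where "q = Complex (- (Im w1 / area)) (Re w1 / area)"
    have "p \<noteq> 0" using w2_nz area_gt_0 by (auto simp: p_def complex_eq_iff)
    moreover have xp: "xc z = p \<bullet> z" for z
      using area_gt_0 by (simp add: xc_def p_def inner_complex_def field_simps)
    ultimately have "negligible {z. p \<bullet> z = - 1/2}" by (intro negligible_hyperplane) simp
    then have "{z. p \<bullet> z = - 1/2} \<in> null_sets lebesgue" by (simp add: negligible_iff_null_sets)
    moreover have "{z. p \<bullet> z = - 1/2} \<in> sets borel" by (simp add: closed_hyperplane borel_closed)
    ultimately have "{z. p \<bullet> z = - 1/2} \<in> null_sets lborel" by (simp add: null_sets_completion_iff)
    then show "AE z in lborel. xc z \<noteq> - 1/2" by (auto simp: xp intro: AE_I')
    have "q \<noteq> 0" using w1_nz area_gt_0 by (auto simp: q_def complex_eq_iff)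
    moreover have yp: "yc z = q \<bullet> z" for z
      using area_gt_0 by (simp add: yc_def q_def inner_complex_def field_simps)
    ultimately have "negligible {z. q \<bullet> z = - 1/2}" by (intro negligible_hyperplane) simp
    then have "{z. q \<bullet> z = - 1/2} \<in> null_sets lebesgue" by (simp add: negligible_iff_null_sets)
    moreover have "{z. q \<bullet> z = - 1/2} \<in> sets borel" by (simp add: closed_hyperplane borel_closed)
    ultimately have "{z. q \<bullet> z = - 1/2} \<in> null_sets lborel" by (simp add: null_sets_completion_iff)
    then show "AE z in lborel. yc z \<noteq> - 1/2" by (auto simp: yp intro: AE_I')
  qed
  then show ?thesis by eventually_elim (auto simp: cell_def icell_def)
qed

end

section \<open>Residues of the kernel\<close>

context quasi_periodic
begin

text \<open>The closed cell contains no lattice point other than 0, and \<open>k 0\<close> is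
  nonzero.\<close>

lemma k_nz_ccell: "t \<in> ccell \<Longrightarrow> k t \<noteq> 0"
proof
  assume t: "t \<in> ccell" "k t = 0"
  then obtain m where m: "t = lp m" using k_nz by blast
  have "\<bar>real_of_int (fst m)\<bar> \<le> 1/2" "\<bar>real_of_int (snd m)\<bar> \<le> 1/2" using t by (auto simp: ccell_def m)
  then have "fst m = 0" "snd m = 0" by linarith+
  then have "m = 0" by (simp add: prod_eq_iff)
  then show False using t m k0 by simp
qed

lemma side_nz: "t \<in> path_image bp \<Longrightarrow> t \<noteq> 0"
proof
  assume t: "t \<in> path_image bp" "t = 0"
  have "0 \<in> icell" by (simp add: icell_def)
  then show False using t bp_disjoint_icell by blast
qed

lemma s_nz_bp: "t \<in> path_image bp \<Longrightarrow> s t \<noteq> 0"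
  using k_nz_ccell bp_ccell side_nz by (auto simp: s_eq)

lemma cauchy_bp:
  assumes "f holomorphic_on ccell"
  shows "contour_integral bp f = 0" "f contour_integrable_on bp"
  using Cauchy_theorem_convex_simple[OF assms convex_ccell valid_bp(1) bp_ccell valid_bp(2)]
  by (auto simp: contour_integral_unique has_contour_integral_integrable)

text \<open>Up to the factor 2 pi i \<open>W\<close>, the Taylor coefficient of \<open>1 / k\<close>
  at 0 of index \<open>i\<close>.\<close>

definition \<kappa> :: "nat \<Rightarrow> complex" where
  "\<kappa> i = contour_integral bp (\<lambda>t. 1 / (k t * t ^ Suc i))"

text \<open>This is used with \<open>c = lin z v\<close>, which is affine in \<open>cnj z\<close>, and yields the polyanalytic structure in \<open>z\<close>.\<close>

lemma exp_coeff_polynomial: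
  obtains d :: "nat \<Rightarrow> nat \<Rightarrow> complex" where
    "\<And>l c. contour_integral bp (\<lambda>t. exp (c * t) / (k t * t ^ Suc l)) = (\<Sum>j\<le>l. d l j * c ^ j)"
proof -
  have "\<exists>d. \<forall>c. contour_integral bp (\<lambda>t. exp (c * t) / (k t * t ^ Suc l)) = (\<Sum>j\<le>l. d j * c ^ j)" for l
  proof -
    \<comment> \<open>The terms of degree above \<open>l\<close> cancel the pole at 0 and integrate
      to zero by Cauchy's theorem; only a polynomial of degree at most \<open>l\<close> in
      \<open>c\<close> is left.\<close>
    obtain d and r :: "complex \<Rightarrow> complex" where r: "r holomorphic_on UNIV"
      "\<And>x. exp x = (\<Sum>j<Suc l. d j * x ^ j) + x ^ Suc l * r x" using exp_taylor_remainder by blast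
    show ?thesis
    proof (intro exI allI)
      fix c
      have "(\<lambda>t. c * t) holomorphic_on ccell" by (intro holomorphic_intros)
      from holomorphic_on_compose_gen[OF this r(1)] have holr: "(\<lambda>t. r (c * t)) holomorphic_on ccell"
        by (simp add: o_def)
      have holrk: "(\<lambda>t. c ^ Suc l * r (c * t) / k t) holomorphic_on ccell"
        using k_nz_ccell by (intro holomorphic_intros holr holomorphic_on_subset[OF hol_k]) auto
      have ci: "(\<lambda>t. 1 / (k t * t ^ Suc i)) contour_integrable_on bp" for i
        by (intro contour_integral_bp(2) continuous_intros continuous_on_subset[OF cont_k])
           (use side_nz k_nz_ccell bp_ccell in auto)
      have "contour_integral bp (\<lambda>t. exp (c * t) / (k t * t ^ Suc l)) =
        contour_integral bp (\<lambda>t. (\<Sum>j\<le>l. (d j * c ^ j) * (1 / (k t * t ^ Suc (l - j)))) + c ^ Suc l * r (c * t) / k t)"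
      proof (rule contour_integral_eq)
        fix t assume t: "t \<in> path_image bp"
        have t0: "t \<noteq> 0" "k t \<noteq> 0" using side_nz[OF t] k_nz_ccell bp_ccell t by auto
        have tj: "t ^ j / t ^ Suc l = 1 / t ^ Suc (l - j)" if "j \<le> l" for j
        proof -
          have "t ^ Suc l = t ^ j * t ^ Suc (l - j)" using that by (simp flip: power_add)
          then show ?thesis using t0 by simp
        qed
        have "exp (c * t) / (k t * t ^ Suc l) = (\<Sum>j<Suc l. d j * c ^ j / k t * (t ^ j / t ^ Suc l)) + (c * t) ^ Suc l * r (c * t) / (k t * t ^ Suc l)"
          unfolding r(2)[of "c * t"] by (simp add: add_divide_distrib sum_divide_distrib power_mult_distrib mult.assoc del: sum.lessThan_Suc)
        also have "(\<Sum>j<Suc l. d j * c ^ j / k t * (t ^ j / t ^ Suc l)) = (\<Sum>j\<le>l. (d j * c ^ j) * (1 / (k t * t ^ Suc (l - j))))"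
          unfolding lessThan_Suc_atMost by (intro sum.cong refl) (simp only: tj atMost_iff, simp)
        also have "(c * t) ^ Suc l * r (c * t) / (k t * t ^ Suc l) = c ^ Suc l * r (c * t) / k t"
          using t0 by (simp only: power_mult_distrib) simp
        finally show "exp (c * t) / (k t * t ^ Suc l) = (\<Sum>j\<le>l. (d j * c ^ j) * (1 / (k t * t ^ Suc (l - j)))) + c ^ Suc l * r (c * t) / k t" .
      qed
      also have "\<dots> = (\<Sum>j\<le>l. (d j * c ^ j) * \<kappa> (l - j)) + 0"
      proof -
        have "contour_integral bp (\<lambda>t. \<Sum>j\<le>l. (d j * c ^ j) * (1 / (k t * t ^ Suc (l - j)))) =
          (\<Sum>j\<le>l. contour_integral bp (\<lambda>t. (d j * c ^ j) * (1 / (k t * t ^ Suc (l - j)))))"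
          by (rule contour_integral_sum; (rule contour_integrable_lmul[OF ci] | simp))
        moreover have "(\<lambda>t. \<Sum>j\<le>l. (d j * c ^ j) * (1 / (k t * t ^ Suc (l - j)))) contour_integrable_on bp"
          by (intro contour_integrable_sum contour_integrable_lmul ci) auto
        ultimately show ?thesis
          using contour_integral_add[OF _ cauchy_bp(2)[OF holrk]] contour_integral_lmul[OF ci] cauchy_bp(1)[OF holrk]
          by (simp only: \<kappa>_def)
      qed
      also have "\<dots> = (\<Sum>j\<le>l. (d j * \<kappa> (l - j)) * c ^ j)" by (simp add: mult_ac)
      finally show "contour_integral bp (\<lambda>t. exp (c * t) / (k t * t ^ Suc l)) = (\<Sum>j\<le>l. (d j * \<kappa> (l - j)) * c ^ j)" .
    qed
  qed
  then show thesis using that by metis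
qed

text \<open>The contribution of the pole at \<open>t = 0\<close>, with \<open>c\<close> standing for
  the exponent. The contour integrals do not involve \<open>v\<close>, so \<open>R v c\<close> makes
  sense for every \<open>v\<close>, also where \<open>- v\<close> meets the contour.\<close>

definition R :: "complex \<Rightarrow> complex \<Rightarrow> complex" where
  "R v c = - k (- v) * (\<Sum>l<n. (- v) ^ l * contour_integral bp (\<lambda>t. exp (c * t) / (k t * t ^ Suc l)))"

text \<open>Partial fractions: \<open>(- v) ^ n / (t ^ n * (t + v))\<close> is
  \<open>1 / (t + v)\<close> minus the sum of \<open>(- v) ^ l / t ^ Suc l\<close> over
  \<open>l < n\<close>. The first part is evaluated by Cauchy's formula at \<open>- v\<close>, the
  others make up \<open>R\<close>.\<close>

lemma contour_residues:
  assumes v: "- v \<in> icell \<or> - v \<notin> ccell"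
  shows "contour_integral bp (\<lambda>t. s (- v) * exp (c * t) / (s t * (t + v))) =
    R v c + (if - v \<in> icell then 2 * of_real pi * \<i> * W * exp (- (c * v)) else 0)"
proof -
  define E where "E = (\<lambda>t. exp (c * t) / k t)"
  have holE: "E holomorphic_on ccell"
    unfolding E_def using k_nz_ccell by (intro holomorphic_intros holomorphic_on_subset[OF hol_k]) auto
  have vb: "- v \<notin> path_image bp" using v bp_disjoint_icell bp_ccell by auto
  have pole: "((\<lambda>t. E t / (t - (- v))) has_contour_integral (if - v \<in> icell then 2 * of_real pi * \<i> * W * E (- v) else 0)) bp"
  proof (cases "- v \<in> icell")
    case True
    have "((\<lambda>t. E t / (t - (- v))) has_contour_integral (2 * pi * \<i> * winding_number bp (- v) * E (- v))) bp"
      using holE icell_interior[OF True] valid_bp vb bp_ccell convex_ccell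
      by (intro Cauchy_integral_formula_convex_simple[where S = ccell]) auto
    then show ?thesis using True by (simp add: winding_bp)
  next
    case False
    then have nv: "- v \<notin> ccell" using v by blast
    have ne: "t - (- v) \<noteq> 0" if "t \<in> ccell" for t using that nv by (metis right_minus_eq)
    have "(\<lambda>t. E t / (t - (- v))) holomorphic_on ccell"
      by (intro holomorphic_intros holE ne)
    from Cauchy_theorem_convex_simple[OF this convex_ccell valid_bp(1) bp_ccell valid_bp(2)] show ?thesis
      using False by simp
  qed
  have ci: "(\<lambda>t. exp (c * t) / (k t * t ^ Suc l)) contour_integrable_on bp" for l
    by (intro contour_integral_bp(2) continuous_intros continuous_on_subset[OF cont_k])
       (use side_nz k_nz_ccell bp_ccell in auto)
  have "contour_integral bp (\<lambda>t. s (- v) * exp (c * t) / (s t * (t + v))) =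
    contour_integral bp (\<lambda>t. k (- v) * (E t / (t - (- v))) + (\<Sum>l<n. (- k (- v) * (- v) ^ l) * (exp (c * t) / (k t * t ^ Suc l))))"
  proof (rule contour_integral_eq)
    fix t assume t: "t \<in> path_image bp"
    have t0: "t \<noteq> 0" "k t \<noteq> 0" using side_nz[OF t] k_nz_ccell bp_ccell t by auto
    have tv: "t + v \<noteq> 0" using t vb by (metis add_eq_0_iff2)
    have "(- v) ^ n - t ^ n = (- v - t) * (\<Sum>l<n. t ^ (n - Suc l) * (- v) ^ l)"
      by (rule power_diff_sumr2)
    then have p: "(- v) ^ n = t ^ n - (t + v) * (\<Sum>l<n. t ^ (n - Suc l) * (- v) ^ l)"
      by (simp add: algebra_simps)
    have tl: "t ^ (n - Suc l) / t ^ n = 1 / t ^ Suc l" if "l < n" for l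
    proof -
      have "n = (n - Suc l) + Suc l" using that by simp
      then have "t ^ n = t ^ (n - Suc l) * t ^ Suc l" by (metis power_add)
      then show ?thesis using t0 by simp
    qed
    have "(- v) ^ n / (t ^ n * (t + v)) = 1 / (t + v) - (\<Sum>l<n. t ^ (n - Suc l) * (- v) ^ l) / t ^ n"
      unfolding p using t0 tv by (simp add: diff_divide_distrib)
    also have "(\<Sum>l<n. t ^ (n - Suc l) * (- v) ^ l) / t ^ n = (\<Sum>l<n. (- v) ^ l * (1 / t ^ Suc l))"
      unfolding sum_divide_distrib by (intro sum.cong refl) (metis lessThan_iff mult.commute times_divide_eq_right tl)
    finally have q: "(- v) ^ n / (t ^ n * (t + v)) = 1 / (t + v) - (\<Sum>l<n. (- v) ^ l * (1 / t ^ Suc l))" .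
    have "s (- v) * exp (c * t) / (s t * (t + v)) = k (- v) * E t * ((- v) ^ n / (t ^ n * (t + v)))"
      by (simp add: s_eq E_def mult_ac)
    also have "\<dots> = k (- v) * (E t / (t - (- v))) + (\<Sum>l<n. (- k (- v) * (- v) ^ l) * (exp (c * t) / (k t * t ^ Suc l)))"
      unfolding q by (simp add: E_def algebra_simps sum_distrib_left sum_negf)
    finally show "s (- v) * exp (c * t) / (s t * (t + v)) = k (- v) * (E t / (t - (- v))) + (\<Sum>l<n. (- k (- v) * (- v) ^ l) * (exp (c * t) / (k t * t ^ Suc l)))" .
  qed
  also have "\<dots> = k (- v) * contour_integral bp (\<lambda>t. E t / (t - (- v))) +
      (\<Sum>l<n. (- k (- v) * (- v) ^ l) * contour_integral bp (\<lambda>t. exp (c * t) / (k t * t ^ Suc l)))"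
  proof -
    have i1: "(\<lambda>t. E t / (t - (- v))) contour_integrable_on bp" using pole by (rule has_contour_integral_integrable)
    have i2: "(\<lambda>t. \<Sum>l<n. (- k (- v) * (- v) ^ l) * (exp (c * t) / (k t * t ^ Suc l))) contour_integrable_on bp"
      by (intro contour_integrable_sum contour_integrable_lmul ci) auto
    have "contour_integral bp (\<lambda>t. \<Sum>l<n. (- k (- v) * (- v) ^ l) * (exp (c * t) / (k t * t ^ Suc l))) =
       (\<Sum>l<n. contour_integral bp (\<lambda>t. (- k (- v) * (- v) ^ l) * (exp (c * t) / (k t * t ^ Suc l))))"
      by (rule contour_integral_sum; (rule contour_integrable_lmul[OF ci] | simp))
    then show ?thesis
      using contour_integral_add[OF contour_integrable_lmul[OF i1] i2] contour_integral_lmul[OF i1] contour_integral_lmul[OF ci]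
      by (simp only:)
  qed
  also have "contour_integral bp (\<lambda>t. E t / (t - (- v))) = (if - v \<in> icell then 2 * of_real pi * \<i> * W * E (- v) else 0)"
    using pole by (rule contour_integral_unique)
  also have "(\<Sum>l<n. (- k (- v) * (- v) ^ l) * contour_integral bp (\<lambda>t. exp (c * t) / (k t * t ^ Suc l))) = R v c"
    by (simp add: R_def sum_distrib_left mult.assoc sum_negf)
  finally show ?thesis
    using k_nz_ccell[of "- v"] v by (auto simp: E_def icell_def ccell_def)
qed

text \<open>The prefactor in \<open>v\<close> is arranged so that shifting \<open>t\<close> by a
  period has the same effect as shifting \<open>v\<close>, see \<open>J_period\<close>.\<close>

definition J :: "complex \<Rightarrow> complex \<Rightarrow> complex \<Rightarrow> complex" where
  "J \<zeta> v t = exp (- (of_real pi * (\<zeta> * cnj v)) - of_real (pi * \<beta>) * (v * cnj v)) *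
     (s (- v) * exp (- of_real pi * (of_real \<beta> * cnj v + cnj \<zeta>) * t) / (s t * (t + v)))"

text \<open>The quasi-periodicity factor of \<open>s\<close> at \<open>t\<close> is traded for the
  one at \<open>- v\<close>. The phase drops out of the quotient, and the Gaussian prefactor absorbs
  the rest up to \<open>chi \<zeta> (lp m)\<close>, which is 1 at the nodes.\<close>

lemma J_period:
  assumes \<zeta>: "chi \<zeta> (lp m) = 1" and t: "s t \<noteq> 0" "s (t + lp m) \<noteq> 0"
  shows "J \<zeta> v (t + lp m) = J \<zeta> (v + lp m) t"
proof -
  from quasi[of m] obtain \<epsilon> where \<epsilon>: "cmod \<epsilon> = 1" "\<And>w. s (w + lp m) =
       \<epsilon> * exp (of_real (pi * \<beta>) * (cnj (lp m) * w + (cmod (lp m))\<^sup>2 / 2)) * s w"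
    unfolding \<beta>_def by blast
  define l where "l = lp m"
  define a where "a = (\<lambda>w. of_real (pi * \<beta>) * (cnj l * w + of_real ((cmod l)\<^sup>2 / 2)))"
  have sl: "s (w + l) = \<epsilon> * exp (a w) * s w" for w using \<epsilon>(2)[of w] by (simp add: l_def a_def)
  have \<epsilon>0: "\<epsilon> \<noteq> 0" using \<epsilon>(1) by auto
  have n: "complex_of_real ((cmod l)\<^sup>2 / 2) = l * cnj l / 2"
    by (simp only: of_real_divide complex_norm_square) simp
  have "s (- v) / s (t + l) = exp (a (- v - l) - a t) * (s (- (v + l)) / s t)"
    using sl[of "- v - l"] sl[of t] \<epsilon>0 by (simp add: exp_diff)
  note ratio = this
  have "J \<zeta> v (t + l) = exp (- (of_real pi * (\<zeta> * cnj v)) - of_real (pi * \<beta>) * (v * cnj v)) *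
      exp (- of_real pi * (of_real \<beta> * cnj v + cnj \<zeta>) * (t + l)) * (s (- v) / s (t + l)) / (t + l + v)"
    unfolding J_def by (simp only: times_divide_times_eq times_divide_eq_right times_divide_eq_left divide_divide_eq_left mult_ac)
  then have "J \<zeta> v (t + l) = exp (- (of_real pi * (\<zeta> * cnj v)) - of_real (pi * \<beta>) * (v * cnj v)) *
      exp (- of_real pi * (of_real \<beta> * cnj v + cnj \<zeta>) * (t + l)) * exp (a (- v - l) - a t) * (s (- (v + l)) / s t) / (t + l + v)"
    unfolding ratio by (simp only: mult.assoc)
  also have "exp (- (of_real pi * (\<zeta> * cnj v)) - of_real (pi * \<beta>) * (v * cnj v)) *
      exp (- of_real pi * (of_real \<beta> * cnj v + cnj \<zeta>) * (t + l)) * exp (a (- v - l) - a t) =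
     exp (of_real pi * (cnj l * \<zeta> - l * cnj \<zeta>)) * (exp (- (of_real pi * (\<zeta> * cnj (v + l))) - of_real (pi * \<beta>) * ((v + l) * cnj (v + l))) *
      exp (- of_real pi * (of_real \<beta> * cnj (v + l) + cnj \<zeta>) * t))"
    unfolding exp_add[symmetric] a_def n
    by (rule arg_cong[where f = exp]) (simp add: algebra_simps)
  also have "exp (of_real pi * (cnj l * \<zeta> - l * cnj \<zeta>)) = 1"
    using \<zeta> by (simp add: chi_def l_def)
  finally have "J \<zeta> v (t + l) = exp (- (of_real pi * (\<zeta> * cnj (v + l))) - of_real (pi * \<beta>) * ((v + l) * cnj (v + l))) *
      exp (- of_real pi * (of_real \<beta> * cnj (v + l) + cnj \<zeta>) * t) * (s (- (v + l)) / s t) / (t + l + v)"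
    by (simp only: mult_1)
  also have "t + l + v = t + (v + l)" by simp
  finally show ?thesis
    unfolding J_def l_def[symmetric]
    by (simp only: times_divide_times_eq times_divide_eq_right times_divide_eq_left divide_divide_eq_left mult_ac)
qed

end

text \<open>Integer translates of \<open>y\<close> stay away from plus and minus one half by the
  same margin as \<open>y\<close> itself; this keeps the pole \<open>t = - v\<close> at a uniform
  distance from the contour.\<close>

lemma abs_half_add_int_ge:
  fixes y :: real
  assumes "\<bar>y\<bar> < 1/2" "\<bar>h\<bar> = 1/2"
  shows "1/2 - \<bar>y\<bar> \<le> \<bar>h + (y + of_int j)\<bar>"
proof -
  consider "j \<ge> 1" | "j = 0" | "j \<le> - 1" by linarith
  then show ?thesis
  proof cases
    case 1
    then have "real_of_int j \<ge> 1" by simp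
    then show ?thesis using assms by linarith
  next
    case 2
    then show ?thesis using assms by simp
  next
    case 3
    then have "real_of_int j \<le> - 1" by linarith
    then show ?thesis using assms by linarith
  qed
qed

lemma has_sum_diff:
  fixes f g :: "'a \<Rightarrow> complex"
  assumes "(f has_sum a) A" "(g has_sum b) A"
  shows "((\<lambda>x. f x - g x) has_sum (a - b)) A"
  using has_sum_add[OF assms(1) has_sum_uminusI[OF assms(2)]] by simp

section \<open>Summing the contour integrals over lattice translates\<close>

context quasi_periodic
begin

definition pref :: "complex \<Rightarrow> complex \<Rightarrow> complex" where
  "pref z v = exp (- (of_real pi * (z * cnj v)) - of_real (pi * \<beta>) * (v * cnj v))"

definition lin :: "complex \<Rightarrow> complex \<Rightarrow> complex" where
  "lin z v = - of_real pi * (of_real \<beta> * cnj v + cnj z)"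

lemma J_eq: "J z v t = pref z v * (s (- v) * exp (lin z v * t) / (s t * (t + v)))"
  by (simp add: J_def pref_def lin_def)

lemma norm_pref_le: "cmod (pref z v) \<le> exp (pi * cmod z * cmod v - pi * \<beta> * (cmod v)\<^sup>2)"
proof -
  have n: "v * cnj v = of_real ((cmod v)\<^sup>2)" by (simp only: complex_norm_square)
  have "cmod (pref z v) = exp (- (pi * Re (z * cnj v)) - pi * \<beta> * (cmod v)\<^sup>2)"
    unfolding pref_def n norm_exp_eq_Re by (simp add: algebra_simps)
  also have "- Re (z * cnj v) \<le> cmod z * cmod v"
    using abs_Re_le_cmod[of "z * cnj v"] by (simp add: norm_mult)
  then have "exp (- (pi * Re (z * cnj v)) - pi * \<beta> * (cmod v)\<^sup>2) \<le> exp (pi * cmod z * cmod v - pi * \<beta> * (cmod v)\<^sup>2)"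
    using mult_left_mono[of "- Re (z * cnj v)" "cmod z * cmod v" pi] by (simp del: times_complex.sel complex_cnj)
  finally show ?thesis .
qed

text \<open>\<open>s (- v)\<close> uses up half of the Gaussian in \<open>pref\<close>. The
  remaining numerator grows at most like an exponential linear in \<open>cmod v\<close>, so the
  other half dominates it.\<close>

lemma J_bound:
  obtains K where "K > 0"
    "\<And>v t \<delta>. t \<in> path_image bp \<Longrightarrow> \<delta> > 0 \<Longrightarrow> cmod (t + v) \<ge> \<delta> \<Longrightarrow> cmod (J z v t) \<le> K / \<delta> * invquart v"
proof -
  obtain C where C: "C > 0" "\<And>w. cmod (s w) \<le> C * gauss w" using s_bound by blast
  have "compact (path_image bp)" by (intro compact_path_image valid_path_imp_path valid_bp)
  moreover have "path_image bp \<noteq> {}" by simp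
  moreover have "continuous_on (path_image bp) (\<lambda>t. cmod (s t))"
    by (intro continuous_intros continuous_on_subset[OF cont_s]) auto
  ultimately obtain t0 where t0: "t0 \<in> path_image bp" "\<And>t. t \<in> path_image bp \<Longrightarrow> cmod (s t0) \<le> cmod (s t)"
    using continuous_attains_inf[of "path_image bp" "\<lambda>t. cmod (s t)"] by blast
  define \<sigma> where "\<sigma> = cmod (s t0)"
  have \<sigma>: "\<sigma> > 0" using s_nz_bp[OF t0(1)] by (simp add: \<sigma>_def)
  \<comment> \<open>Collects the exponents linear in \<open>cmod v\<close>, from \<open>pref\<close>
    and from \<open>exp (lin z v * t)\<close> with \<open>cmod t \<le> diam\<close>.\<close>
  define A where "A = pi * cmod z + pi * \<beta> * diam"
  have B: "pi * \<beta> / 2 > 0" using \<beta>_pos by simp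
  obtain K0 where K0: "K0 > 0" "\<And>v. exp (A * cmod v - pi * \<beta> / 2 * (cmod v)\<^sup>2) \<le> K0 * invquart v"
    using exp_linear_gauss_le_invquart[OF B, where A = A] by blast
  define K where "K = C * exp (pi * cmod z * diam) / \<sigma> * K0"
  have K: "K > 0" using C \<sigma> K0 by (simp add: K_def)
  have "cmod (J z v t) \<le> K / \<delta> * invquart v" if t: "t \<in> path_image bp" and \<delta>: "\<delta> > 0" "cmod (t + v) \<ge> \<delta>" for v t \<delta>
  proof -
    have td: "cmod t \<le> diam" using norm_ccell bp_ccell t by blast
    have "cmod (exp (lin z v * t)) \<le> exp (cmod (lin z v * t))" by (rule norm_exp)
    also have "cmod (lin z v * t) \<le> (pi * (\<beta> * cmod v + cmod z)) * diam"
    proof -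
      have "cmod (lin z v) = pi * cmod (of_real \<beta> * cnj v + cnj z)" by (simp add: lin_def norm_mult)
      also have "\<dots> \<le> pi * (\<beta> * cmod v + cmod z)"
        using \<beta>_pos by (intro mult_left_mono norm_triangle_mono) (auto simp: norm_mult)
      finally show ?thesis unfolding norm_mult using td \<beta>_pos by (intro mult_mono) auto
    qed
    finally have e: "cmod (exp (lin z v * t)) \<le> exp ((pi * (\<beta> * cmod v + cmod z)) * diam)" by simp
    have g: "gauss (- v) = exp (pi * \<beta> / 2 * (cmod v)\<^sup>2)" by (simp add: gauss_def)
    have "cmod (J z v t) = cmod (pref z v) * (cmod (s (- v)) * cmod (exp (lin z v * t)) / (cmod (s t) * cmod (t + v)))"
      by (simp add: J_eq norm_mult norm_divide)
    also have "\<dots> \<le> exp (pi * cmod z * cmod v - pi * \<beta> * (cmod v)\<^sup>2) *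
       ((C * gauss (- v)) * exp ((pi * (\<beta> * cmod v + cmod z)) * diam) / (\<sigma> * \<delta>))"
      using \<sigma> \<delta> t0(2)[OF t] C
      by (intro mult_mono norm_pref_le frac_le e C(2) mult_nonneg_nonneg divide_nonneg_pos mult_pos_pos) (auto simp: \<sigma>_def gauss_def)
    also have "\<dots> = C * exp (pi * cmod z * diam) / \<sigma> / \<delta> * exp (A * cmod v - pi * \<beta> / 2 * (cmod v)\<^sup>2)"
    proof -
      have "exp (pi * cmod z * cmod v - pi * \<beta> * (cmod v)\<^sup>2) * (exp (pi * \<beta> / 2 * (cmod v)\<^sup>2) * exp ((pi * (\<beta> * cmod v + cmod z)) * diam)) =
        exp (pi * cmod z * diam) * exp (A * cmod v - pi * \<beta> / 2 * (cmod v)\<^sup>2)"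
        unfolding exp_add[symmetric] by (rule arg_cong[where f = exp]) (simp add: A_def field_simps)
      then show ?thesis unfolding g using \<sigma> \<delta> by (simp add: field_simps)
    qed
    also have "\<dots> \<le> C * exp (pi * cmod z * diam) / \<sigma> / \<delta> * (K0 * invquart v)"
      using C \<sigma> \<delta> by (intro mult_left_mono K0(2)) auto
    also have "\<dots> = K / \<delta> * invquart v" by (simp add: K_def)
    finally show ?thesis .
  qed
  then show thesis using that K by blast
qed

lemma s_period_nz: "s t \<noteq> 0 \<Longrightarrow> s (t + lp m) \<noteq> 0"
  using norm_s_period[of t m] gauss_ge_1[of t] by auto

text \<open>By \<open>J_period\<close> the integrals over opposite sides are the same function of
  \<open>v\<close> at neighbouring lattice points. The sums converge absolutely, so reindexing
  cancels them.\<close>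

lemma sum_J:
  assumes \<zeta>: "\<And>m. chi \<zeta> (lp m) = 1" and u: "u \<in> icell"
  shows "((\<lambda>m. contour_integral bp (J \<zeta> (u + lp m))) has_sum 0) UNIV"
    "\<And>m. (\<lambda>t. s (- (u + lp m)) * exp (lin \<zeta> (u + lp m) * t) / (s t * (t + (u + lp m)))) contour_integrable_on bp"
proof -
  \<comment> \<open>A lower bound for \<open>cmod (t + v)\<close> on the contour, valid for all
    translates: the margin of \<open>u\<close> to the boundary in coordinates, converted by the
    bound \<open>diam / area\<close> on the coordinates.\<close>
  define \<delta> where "\<delta> = area / diam * (1/2 - max \<bar>xc u\<bar> \<bar>yc u\<bar>)"
  have diam0: "diam > 0" using w1_nz w2_nz by (simp add: diam_def add_pos_pos)
  have \<delta>: "\<delta> > 0" using u area_gt_0 diam0 by (auto simp: \<delta>_def icell_def)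
  have tv: "cmod (t + (u + lp m)) \<ge> \<delta>" if t: "t \<in> path_image bp" for t m
  proof -
    define y where "y = t + (u + lp m)"
    have le: "\<bar>xc y\<bar> \<le> diam / area * cmod y" "\<bar>yc y\<bar> \<le> diam / area * cmod y"
    proof -
      have "cmod w2 * cmod y \<le> diam * cmod y" "cmod w1 * cmod y \<le> diam * cmod y"
        unfolding diam_def by (intro mult_right_mono; simp)+
      then have "cmod w2 * cmod y / area \<le> diam * cmod y / area" "cmod w1 * cmod y / area \<le> diam * cmod y / area"
        using area_gt_0 by (intro divide_right_mono; simp)+
      then show "\<bar>xc y\<bar> \<le> diam / area * cmod y" "\<bar>yc y\<bar> \<le> diam / area * cmod y"
        using abs_xc_le[of y] abs_yc_le[of y] by simp_all
    qed
    have "1/2 - max \<bar>xc u\<bar> \<bar>yc u\<bar> \<le> diam / area * cmod y"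
    proof (cases "t \<in> side1 \<union> side3")
      case True
      then have "yc t = - 1/2 \<or> yc t = 1/2" using side_coords(1,3)[of t] by blast
      then have "\<bar>yc t\<bar> = 1/2" by auto
      then have "1/2 - \<bar>yc u\<bar> \<le> \<bar>yc y\<bar>"
        using abs_half_add_int_ge[of "yc u" "yc t" "snd m"] u by (simp add: y_def icell_def)
      then show ?thesis using le(2) by linarith
    next
      case False
      then have "xc t = 1/2 \<or> xc t = - 1/2" using t side_coords(2,4)[of t] unfolding path_image_bp by blast
      then have "\<bar>xc t\<bar> = 1/2" by auto
      then have "1/2 - \<bar>xc u\<bar> \<le> \<bar>xc y\<bar>"
        using abs_half_add_int_ge[of "xc u" "xc t" "fst m"] u by (simp add: y_def icell_def)
      then show ?thesis using le(1) by linarith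
    qed
    then have "\<delta> \<le> area / diam * (diam / area * cmod y)"
      unfolding \<delta>_def using area_gt_0 diam0 by (intro mult_left_mono) auto
    also have "\<dots> = cmod y" using area_gt_0 diam0 by simp
    finally show ?thesis by (simp add: y_def)
  qed
  have tv0: "t + (u + lp m) \<noteq> 0" if "t \<in> path_image bp" for t m using tv[OF that, of m] \<delta> by auto
  have cont: "continuous_on (path_image bp) (\<lambda>t. s (- (u + lp m)) * exp (lin \<zeta> (u + lp m) * t) / (s t * (t + (u + lp m))))" for m
    by (intro continuous_intros continuous_on_subset[OF cont_s]) (use s_nz_bp tv0 in auto)
  show "(\<lambda>t. s (- (u + lp m)) * exp (lin \<zeta> (u + lp m) * t) / (s t * (t + (u + lp m)))) contour_integrable_on bp" for m
    by (rule contour_integral_bp(2)[OF cont])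
  have contJ: "continuous_on (path_image bp) (J \<zeta> (u + lp m))" for m
    unfolding J_eq[abs_def] by (intro continuous_on_mult continuous_on_const cont)
  obtain K where K: "K > 0"
    "\<And>v t \<delta>. t \<in> path_image bp \<Longrightarrow> \<delta> > 0 \<Longrightarrow> cmod (t + v) \<ge> \<delta> \<Longrightarrow> cmod (J \<zeta> v t) \<le> K / \<delta> * invquart v"
    using J_bound[of \<zeta>] by blast
  have Jb: "cmod (J \<zeta> (u + lp m) t) \<le> K / \<delta> * invquart (u + lp m)" if "t \<in> path_image bp" for t m
    by (rule K(2)[OF that \<delta> tv[OF that]])
  have has: "\<exists>X. ((\<lambda>m. contour_integral (linepath p q) (J \<zeta> (u + lp m))) has_sum X) UNIV"
    if pq: "closed_segment p q \<subseteq> path_image bp" for p q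
  proof -
    obtain C where C: "\<And>z. (\<lambda>m. invquart (z + lp m)) summable_on UNIV" using invquart_translates by blast
    have "(\<lambda>m. norm (contour_integral (linepath p q) (J \<zeta> (u + lp m)))) summable_on UNIV"
    proof (rule summable_on_comparison_test)
      show "(\<lambda>m. K / \<delta> * invquart (u + lp m) * cmod (q - p)) summable_on UNIV"
        by (intro summable_on_cmult_left summable_on_cmult_right C)
      fix m
      have ci: "J \<zeta> (u + lp m) contour_integrable_on linepath p q"
        by (rule contour_integrable_continuous_linepath[OF continuous_on_subset[OF contJ pq]])
      show "norm (contour_integral (linepath p q) (J \<zeta> (u + lp m))) \<le> K / \<delta> * invquart (u + lp m) * cmod (q - p)"
      proof (rule contour_integral_bound_linepath[OF ci])
        show "0 \<le> K / \<delta> * invquart (u + lp m)" using K(1) \<delta> invquart_pos[of "u + lp m"] by simp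
        show "cmod (J \<zeta> (u + lp m) t) \<le> K / \<delta> * invquart (u + lp m)" if "t \<in> closed_segment p q" for t
          using that pq by (intro Jb) auto
      qed
    qed simp
    then have "(\<lambda>m. contour_integral (linepath p q) (J \<zeta> (u + lp m))) summable_on UNIV" by (rule abs_summable_summable)
    then show ?thesis by (auto simp: summable_on_def)
  qed
  have shift: "((\<lambda>m. f (u + lp m + lp j)) has_sum X) UNIV" if "((\<lambda>m. f (u + lp m)) has_sum X) UNIV" for f :: "complex \<Rightarrow> complex" and X j
  proof -
    have "bij (\<lambda>m. m + j)" by (rule bij_betwI[where g = "\<lambda>m. m - j"]) auto
    from has_sum_reindex_bij_betw[OF this, of "\<lambda>m. f (u + lp m)" X] that show ?thesis
      by (simp add: lp_add add.assoc)
  qed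
  define p1 q1 p2 q2 where "p1 = - (w1/2) - w2/2" and "q1 = w1/2 - w2/2" and "p2 = w1/2 - w2/2" and "q2 = w1/2 + w2/2"
  define S1 where "S1 = (\<lambda>v. contour_integral (linepath p1 q1) (J \<zeta> v))"
  define S2 where "S2 = (\<lambda>v. contour_integral (linepath p2 q2) (J \<zeta> v))"
  have sub: "closed_segment p1 q1 \<subseteq> path_image bp" "closed_segment p2 q2 \<subseteq> path_image bp"
    by (auto simp: path_image_bp side1_def side2_def p1_def q1_def p2_def q2_def)
  obtain X1 where X1: "((\<lambda>m. S1 (u + lp m)) has_sum X1) UNIV" using has[OF sub(1)] unfolding S1_def by blast
  obtain X2 where X2: "((\<lambda>m. S2 (u + lp m)) has_sum X2) UNIV" using has[OF sub(2)] unfolding S2_def by blast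
  have tr: "contour_integral (linepath p q) (\<lambda>t. J \<zeta> v (t + lp j)) = contour_integral (linepath p q) (J \<zeta> (v + lp j))"
    if "closed_segment p q \<subseteq> path_image bp" for p q v j
  proof (rule contour_integral_eq)
    fix t assume "t \<in> path_image (linepath p q)"
    then have t: "t \<in> path_image bp" using that by auto
    show "J \<zeta> v (t + lp j) = J \<zeta> (v + lp j) t"
      using s_nz_bp[OF t] s_period_nz by (intro J_period \<zeta>) auto
  qed
  have "contour_integral bp (J \<zeta> (u + lp m)) =
    S1 (u + lp m) - S1 (u + lp m + lp (0, 1)) + (S2 (u + lp m) - S2 (u + lp m + lp (-1, 0)))" for m
    using contour_integral_bp(1)[OF contJ, of m] tr[OF sub(1), of "u + lp m" "(0, 1)"] tr[OF sub(2), of "u + lp m" "(-1, 0)"]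
    by (simp add: S1_def S2_def p1_def q1_def p2_def q2_def lp_def)
  moreover have "((\<lambda>m. S1 (u + lp m) - S1 (u + lp m + lp (0, 1)) + (S2 (u + lp m) - S2 (u + lp m + lp (-1, 0)))) has_sum (X1 - X1 + (X2 - X2))) UNIV"
    by (intro has_sum_add has_sum_diff X1 X2 shift)
  ultimately show "((\<lambda>m. contour_integral bp (J \<zeta> (u + lp m))) has_sum 0) UNIV" by simp
qed

text \<open>Of all the translates only \<open>m = 0\<close> puts \<open>- v\<close> inside the
  contour, so the vanishing total of the contour integrals leaves minus one residue.\<close>

lemma sum_pref_R:
  assumes \<zeta>: "\<And>m. chi \<zeta> (lp m) = 1" and u: "u \<in> icell"
  shows "((\<lambda>m. pref \<zeta> (u + lp m) * R (u + lp m) (lin \<zeta> (u + lp m))) has_sum (- (2 * of_real pi * \<i> * W) * chi (- \<zeta>) u)) UNIV"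
proof -
  define c where "c = 2 * of_real pi * \<i> * W * chi (- \<zeta>) u"
  \<comment> \<open>At the pole \<open>t = - u\<close> the terms with \<open>\<beta>\<close> cancel
    and the exponents combine to a pure character.\<close>
  have pe: "pref \<zeta> u * exp (- (lin \<zeta> u * u)) = chi (- \<zeta>) u"
    unfolding pref_def lin_def chi_def exp_add[symmetric] by (rule arg_cong[where f = exp]) (simp add: algebra_simps)
  have eq: "pref \<zeta> (u + lp m) * R (u + lp m) (lin \<zeta> (u + lp m)) = contour_integral bp (J \<zeta> (u + lp m)) - (if m = 0 then c else 0)" for m
  proof -
    define v where "v = u + lp m"
    have int: "\<bar>of_int (fst m) + xc u\<bar> \<le> 1/2 \<Longrightarrow> \<bar>of_int (snd m) + yc u\<bar> \<le> 1/2 \<Longrightarrow> m = 0"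
    proof -
      assume a: "\<bar>of_int (fst m) + xc u\<bar> \<le> 1/2" "\<bar>of_int (snd m) + yc u\<bar> \<le> 1/2"
      have "\<bar>xc u\<bar> < 1/2" "\<bar>yc u\<bar> < 1/2" using u by (auto simp: icell_def)
      with a have "fst m = 0" "snd m = 0" by linarith+
      then show "m = 0" by (simp add: prod_eq_iff)
    qed
    have xy: "\<bar>xc (- v)\<bar> = \<bar>of_int (fst m) + xc u\<bar>" "\<bar>yc (- v)\<bar> = \<bar>of_int (snd m) + yc u\<bar>"
      by (simp_all add: v_def add.commute abs_minus_commute)
    have iff1: "m = 0" if "- v \<in> ccell"
      using that by (intro int) (simp_all only: ccell_def mem_Collect_eq xy)
    have iff2: "- v \<in> icell \<longleftrightarrow> m = 0"
    proof
      assume "- v \<in> icell"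
      then show "m = 0" by (intro int) (simp_all only: icell_def mem_Collect_eq xy less_imp_le)
    next
      assume "m = 0"
      then show "- v \<in> icell" using u by (simp only: icell_def mem_Collect_eq xy) simp
    qed
    have "- v \<in> icell \<or> - v \<notin> ccell" using iff1 iff2 by blast
    note cr = contour_residues[OF this, of "lin \<zeta> v"]
    have "contour_integral bp (J \<zeta> v) = pref \<zeta> v * contour_integral bp (\<lambda>t. s (- v) * exp (lin \<zeta> v * t) / (s t * (t + v)))"
      unfolding J_eq[abs_def] v_def by (rule contour_integral_lmul[OF sum_J(2)[OF \<zeta> u]])
    also have "\<dots> = pref \<zeta> v * R v (lin \<zeta> v) + (if m = 0 then c else 0)"
      unfolding cr using pe iff2 by (auto simp: c_def v_def algebra_simps)
    finally show ?thesis by (simp add: v_def)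
  qed
  have "((\<lambda>m::int \<times> int. if m = 0 then c else 0) has_sum c) UNIV"
    by (rule has_sum_finite_neutralI[of "{0}"]) auto
  then have "((\<lambda>m. contour_integral bp (J \<zeta> (u + lp m)) - (if m = 0 then c else 0)) has_sum (0 - c)) UNIV"
    by (intro has_sum_diff sum_J(1) \<zeta> u)
  then show ?thesis by (simp add: eq c_def)
qed

lemma integral_pref_R:
  assumes \<zeta>: "\<And>m. chi \<zeta> (lp m) = 1" and int: "integrable lborel (\<lambda>v. pref \<zeta> v * R v (lin \<zeta> v))"
  shows "(LINT v|lborel. pref \<zeta> v * R v (lin \<zeta> v)) = (if \<zeta> = 0 then - (2 * of_real pi * \<i> * W) * of_real vol else 0)"
proof -
  define g where "g = (\<lambda>v. pref \<zeta> v * R v (lin \<zeta> v))"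
  have "(LINT v|lborel. g v) = (LINT v:cell|lborel. - (2 * of_real pi * \<i> * W) * chi (- \<zeta>) v)"
  proof (rule integral_unfold)
    show "integrable lborel g" using int by (simp add: g_def)
    show "AE u in lborel. u \<in> cell \<longrightarrow> ((\<lambda>m. g (u + lp m)) has_sum (- (2 * of_real pi * \<i> * W) * chi (- \<zeta>) u)) UNIV \<and>
      (\<lambda>m. norm (g (u + lp m))) summable_on UNIV"
      using AE_icell
    proof eventually_elim
      case (elim u)
      show ?case
      proof
        assume "u \<in> cell"
        then have h: "((\<lambda>m. g (u + lp m)) has_sum (- (2 * of_real pi * \<i> * W) * chi (- \<zeta>) u)) UNIV"
          unfolding g_def using elim by (intro sum_pref_R \<zeta>) auto
        moreover have "(\<lambda>m. norm (g (u + lp m))) summable_on UNIV"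
          using has_sum_imp_summable[OF h] by (simp only: summable_on_iff_abs_summable_on_complex)
        ultimately show "((\<lambda>m. g (u + lp m)) has_sum (- (2 * of_real pi * \<i> * W) * chi (- \<zeta>) u)) UNIV \<and>
          (\<lambda>m. norm (g (u + lp m))) summable_on UNIV" ..
      qed
    qed
    show "(\<lambda>v. - (2 * of_real pi * \<i> * W) * chi (- \<zeta>) v) \<in> borel_measurable borel"
      by (intro borel_measurable_continuous_onI continuous_intros)
  qed
  also have "\<dots> = - (2 * of_real pi * \<i> * W) * (LINT v:cell|lborel. chi (- \<zeta>) v)" by (rule set_integral_mult_right)
  also have "(LINT v:cell|lborel. chi (- \<zeta>) v) = (if \<zeta> = 0 then of_real vol else 0)"
  proof (cases "\<zeta> = 0")
    case True
    then show ?thesis using emeasure_cell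
      by (simp add: set_integral_const vol_def set_lebesgue_integral_def scaleR_conv_of_real)
  next
    case False
    have "chi (- \<zeta>) (lp m) = 1" for m
      using chi_add_left[of "\<zeta>" "- \<zeta>" "lp m"] \<zeta>[of m] by simp
    then show ?thesis using integral_chi_cell[of "- \<zeta>"] False by simp
  qed
  finally show ?thesis by (simp add: g_def)
qed

end

section \<open>Sufficiency\<close>

text \<open>Growth that any Gaussian absorbs; closure under sums and products covers the explicit
  polynomials in \<open>v\<close> and \<open>cnj v\<close> of \<open>R_polyanalytic\<close>.\<close>

definition tempered :: "(complex \<Rightarrow> complex) \<Rightarrow> bool" where
  "tempered f \<longleftrightarrow> continuous_on UNIV f \<and> (\<exists>C N. C \<ge> 0 \<and> (\<forall>v. cmod (f v) \<le> C * (1 + cmod v) ^ N))"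

lemma tempered_const: "tempered (\<lambda>v. c)"
  unfolding tempered_def by (intro conjI exI[of _ "cmod c"] exI[of _ 0]) auto

lemma tempered_mult:
  assumes "tempered f" "tempered g"
  shows "tempered (\<lambda>v. f v * g v)"
proof -
  obtain C N where f: "C \<ge> 0" "\<And>v. cmod (f v) \<le> C * (1 + cmod v) ^ N" using assms(1) unfolding tempered_def by blast
  obtain D M where g: "D \<ge> 0" "\<And>v. cmod (g v) \<le> D * (1 + cmod v) ^ M" using assms(2) unfolding tempered_def by blast
  have "cmod (f v * g v) \<le> (C * D) * (1 + cmod v) ^ (N + M)" for v
  proof -
    have "cmod (f v * g v) \<le> (C * (1 + cmod v) ^ N) * (D * (1 + cmod v) ^ M)"
      unfolding norm_mult using f g by (intro mult_mono) auto
    then show ?thesis by (simp add: power_add mult_ac)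
  qed
  moreover have "continuous_on UNIV (\<lambda>v. f v * g v)" using assms unfolding tempered_def by (intro continuous_on_mult) auto
  ultimately show ?thesis unfolding tempered_def using f(1) g(1) by (intro conjI exI[of _ "C * D"] exI[of _ "N + M"]) auto
qed

lemma tempered_add:
  assumes "tempered f" "tempered g"
  shows "tempered (\<lambda>v. f v + g v)"
proof -
  obtain C N where f: "C \<ge> 0" "\<And>v. cmod (f v) \<le> C * (1 + cmod v) ^ N" using assms(1) unfolding tempered_def by blast
  obtain D M where g: "D \<ge> 0" "\<And>v. cmod (g v) \<le> D * (1 + cmod v) ^ M" using assms(2) unfolding tempered_def by blast
  have "cmod (f v + g v) \<le> (C + D) * (1 + cmod v) ^ (N + M)" for v
  proof -
    have "(1 + cmod v) ^ N \<le> (1 + cmod v) ^ (N + M)" "(1 + cmod v) ^ M \<le> (1 + cmod v) ^ (N + M)"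
      by (intro power_increasing; simp)+
    then have "C * (1 + cmod v) ^ N + D * (1 + cmod v) ^ M \<le> C * (1 + cmod v) ^ (N + M) + D * (1 + cmod v) ^ (N + M)"
      using f(1) g(1) by (intro add_mono mult_left_mono) auto
    then show ?thesis using norm_triangle_ineq[of "f v" "g v"] f(2)[of v] g(2)[of v] by (simp add: algebra_simps)
  qed
  moreover have "continuous_on UNIV (\<lambda>v. f v + g v)" using assms unfolding tempered_def by (intro continuous_on_add) auto
  ultimately show ?thesis unfolding tempered_def using f(1) g(1) by (intro conjI exI[of _ "C + D"] exI[of _ "N + M"]) auto
qed

lemma tempered_cnj: "tempered cnj" and tempered_minus: "tempered uminus"
proof -
  have "cmod v \<le> 1 * (1 + cmod v) ^ 1" for v by simp
  moreover have "continuous_on UNIV cnj" "continuous_on UNIV (uminus :: complex \<Rightarrow> complex)"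
    by (auto intro!: continuous_intros)
  ultimately show "tempered cnj" "tempered uminus"
    unfolding tempered_def by (auto intro!: exI[of _ 1])
qed

lemma tempered_power: "tempered f \<Longrightarrow> tempered (\<lambda>v. f v ^ j)"
  by (induction j) (auto intro: tempered_const tempered_mult)

lemma tempered_sum: "(\<And>i. i \<in> A \<Longrightarrow> tempered (f i)) \<Longrightarrow> tempered (\<lambda>v. \<Sum>i\<in>A. f i v)"
  by (induction A rule: infinite_finite_induct) (auto intro: tempered_const tempered_add)

lemma norm_exp_minus_1_le: "cmod (exp w - 1) \<le> cmod w * exp (cmod w)"
proof -
  have "cmod (exp w - 1) \<le> exp \<bar>Re w\<bar> * cmod w"
    using Taylor_exp[of w 0] by simp
  also have "\<dots> \<le> exp (cmod w) * cmod w" by (intro mult_right_mono) (auto simp: abs_Re_le_cmod)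
  finally show ?thesis by (simp add: mult.commute)
qed

text \<open>The kernel contributes at most \<open>exp (pi * cmod z * cmod v)\<close>, which Young's
  inequality splits between a Gaussian in \<open>z\<close> and part of the decay of
  \<open>\<Phi>\<close>. Holomorphy is differentiation under the integral, tested on
  sequences.\<close>

lemma (in complex_lattice) gauss_transform:
  fixes \<Phi> :: "complex \<Rightarrow> complex" and \<beta> :: real
  assumes \<beta>: "\<beta> > 1" and cont: "continuous_on UNIV \<Phi>"
    and bound: "\<And>v. cmod (\<Phi> v) \<le> C * (1 + cmod v) ^ N * exp (- (pi * \<beta> / 2) * (cmod v)\<^sup>2)"
  shows "\<And>z. integrable lborel (\<lambda>v. exp (- (of_real pi * (z * cnj v))) * \<Phi> v)"
    and "(\<lambda>z. LINT v|lborel. exp (- (of_real pi * (z * cnj v))) * \<Phi> v) holomorphic_on UNIV"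
    and "\<exists>D. \<forall>z. cmod (LINT v|lborel. exp (- (of_real pi * (z * cnj v))) * \<Phi> v) \<le> D * exp (pi / (1 + \<beta>) * (cmod z)\<^sup>2)"
proof -
  have C: "C \<ge> 0" using bound[of 0] by (simp add: order_trans[OF norm_ge_zero])
  have B: "pi * \<beta> / 2 > 0" using \<beta> by simp
  have [measurable]: "\<Phi> \<in> borel_measurable borel" using cont by (rule borel_measurable_continuous_onI)
  have ne: "cmod (exp (- (of_real pi * (z * cnj v)))) \<le> exp (pi * cmod z * cmod v)" for z v
  proof -
    have "cmod (exp (- (of_real pi * (z * cnj v)))) \<le> exp (cmod (- (of_real pi * (z * cnj v))))" by (rule norm_exp)
    then show ?thesis by (simp add: norm_mult mult.assoc)
  qed
  have \<Phi>b: "exp (A * cmod v) * cmod (\<Phi> v) \<le> C * exp ((A + real N) * cmod v - pi * \<beta> / 2 * (cmod v)\<^sup>2)" for A v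
  proof -
    have "cmod (\<Phi> v) \<le> C * exp (real N * cmod v) * exp (- (pi * \<beta> / 2) * (cmod v)\<^sup>2)"
      using power_le_exp[of "cmod v" N] C by (intro order_trans[OF bound] mult_right_mono mult_left_mono) auto
    then have "exp (A * cmod v) * cmod (\<Phi> v) \<le> exp (A * cmod v) * (C * exp (real N * cmod v) * exp (- (pi * \<beta> / 2) * (cmod v)\<^sup>2))"
      by (intro mult_left_mono) auto
    also have "\<dots> = C * exp (A * cmod v + real N * cmod v + - (pi * \<beta> / 2) * (cmod v)\<^sup>2)"
      by (simp only: exp_add mult_ac)
    finally show ?thesis by (simp add: algebra_simps)
  qed
  have dom: "integrable lborel (\<lambda>v. exp (A * cmod v) * cmod (\<Phi> v))" for A
  proof -
    obtain K where K: "K > 0" "\<And>v. exp ((A + real N) * cmod v - pi * \<beta> / 2 * (cmod v)\<^sup>2) \<le> K * invquart v"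
      using exp_linear_gauss_le_invquart[OF B, where A = "A + real N"] by blast
    show ?thesis
    proof (rule Bochner_Integration.integrable_bound)
      show "integrable lborel (\<lambda>v. C * (K * invquart v))"
        by (intro Bochner_Integration.integrable_mult_right integrable_invquart)
      show "AE v in lborel. norm (exp (A * cmod v) * cmod (\<Phi> v)) \<le> norm (C * (K * invquart v))"
      proof (rule AE_I2)
        fix v
        have "exp (A * cmod v) * cmod (\<Phi> v) \<le> C * (K * invquart v)"
          using \<Phi>b[of A v] mult_left_mono[OF K(2)[of v] C] by linarith
        from order_trans[OF this abs_ge_self]
        show "norm (exp (A * cmod v) * cmod (\<Phi> v)) \<le> norm (C * (K * invquart v))"
          by (simp add: abs_mult)
      qed
    qed measurable
  qed
  have meas: "(\<lambda>v. exp (- (of_real pi * (z * cnj v))) * \<Phi> v) \<in> borel_measurable borel" for z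
    by (intro borel_measurable_continuous_onI continuous_intros cont)
  show int: "integrable lborel (\<lambda>v. exp (- (of_real pi * (z * cnj v))) * \<Phi> v)" for z
  proof (rule Bochner_Integration.integrable_bound[OF dom[of "pi * cmod z"]])
    show "AE v in lborel. norm (exp (- (of_real pi * (z * cnj v))) * \<Phi> v) \<le> norm (exp (pi * cmod z * cmod v) * cmod (\<Phi> v))"
      using ne[of z] by (intro AE_I2) (simp add: norm_mult mult_right_mono)
  qed (use meas in simp)
  show "\<exists>D. \<forall>z. cmod (LINT v|lborel. exp (- (of_real pi * (z * cnj v))) * \<Phi> v) \<le> D * exp (pi / (1 + \<beta>) * (cmod z)\<^sup>2)"
  proof -
    have B': "pi * (\<beta> - 1) / 4 > 0" using \<beta> by simp
    obtain K where K: "K > 0" "\<And>v. exp (real N * cmod v - pi * (\<beta> - 1) / 4 * (cmod v)\<^sup>2) \<le> K * invquart v"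
      using exp_linear_gauss_le_invquart[OF B', where A = "real N"] by blast
    define D where "D = C * K * (LINT v|lborel. invquart v)"
    have "cmod (LINT v|lborel. exp (- (of_real pi * (z * cnj v))) * \<Phi> v) \<le> D * exp (pi / (1 + \<beta>) * (cmod z)\<^sup>2)" for z
    proof -
      have pw: "cmod (exp (- (of_real pi * (z * cnj v))) * \<Phi> v) \<le> (C * exp (pi / (1 + \<beta>) * (cmod z)\<^sup>2) * K) * invquart v" for v
      proof -
        define x y where "x = cmod z" and "y = cmod v"
        \<comment> \<open>The weight \<open>1 + \<beta>\<close> lies strictly between
          \<open>2\<close> and \<open>2 * \<beta>\<close>: the first makes
          \<open>pi / (1 + \<beta>)\<close> less than \<open>pi / 2\<close>, the second leaves
          \<open>pi * (\<beta> - 1) / 4\<close> of the decay in \<open>v\<close> for the polynomial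
          factor.\<close>
        have "0 \<le> pi / (1 + \<beta>) * (x - (1 + \<beta>) / 2 * y)\<^sup>2" using \<beta> by simp
        also have "\<dots> = pi / (1 + \<beta>) * x\<^sup>2 + pi * (1 + \<beta>) / 4 * y\<^sup>2 - pi * x * y"
          using \<beta> by (simp add: power2_eq_square field_simps)
        finally have q: "pi * x * y \<le> pi / (1 + \<beta>) * x\<^sup>2 + pi * (1 + \<beta>) / 4 * y\<^sup>2" by simp
        have "cmod (exp (- (of_real pi * (z * cnj v))) * \<Phi> v) \<le> exp (pi * x * y) * cmod (\<Phi> v)"
          unfolding norm_mult x_def y_def by (intro mult_right_mono ne) auto
        also have "\<dots> \<le> C * exp ((pi * x + real N) * y - pi * \<beta> / 2 * y\<^sup>2)"
          using \<Phi>b[of "pi * x" v] by (simp add: y_def)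
        also have "\<dots> \<le> C * exp (pi / (1 + \<beta>) * x\<^sup>2 + (real N * y - pi * (\<beta> - 1) / 4 * y\<^sup>2))"
        proof -
          have "pi * (1 + \<beta>) / 4 * y\<^sup>2 = pi * \<beta> / 2 * y\<^sup>2 - pi * (\<beta> - 1) / 4 * y\<^sup>2" by (simp add: field_simps)
          moreover have "(pi * x + real N) * y = pi * x * y + real N * y" by (simp add: algebra_simps)
          ultimately have "(pi * x + real N) * y - pi * \<beta> / 2 * y\<^sup>2 \<le> pi / (1 + \<beta>) * x\<^sup>2 + (real N * y - pi * (\<beta> - 1) / 4 * y\<^sup>2)"
            using q by linarith
          then show ?thesis using C by (intro mult_left_mono) auto
        qed
        also have "\<dots> \<le> C * (exp (pi / (1 + \<beta>) * x\<^sup>2) * (K * invquart v))"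
          unfolding exp_add using K(2)[of v] C by (intro mult_left_mono) (auto simp: y_def)
        finally show ?thesis by (simp add: x_def mult_ac)
      qed
      have "cmod (LINT v|lborel. exp (- (of_real pi * (z * cnj v))) * \<Phi> v) \<le> (LINT v|lborel. cmod (exp (- (of_real pi * (z * cnj v))) * \<Phi> v))"
        by (rule integral_norm_bound)
      also have "\<dots> \<le> (LINT v|lborel. (C * exp (pi / (1 + \<beta>) * (cmod z)\<^sup>2) * K) * invquart v)"
        by (intro integral_mono integrable_norm int Bochner_Integration.integrable_mult_right integrable_invquart pw)
      also have "\<dots> = D * exp (pi / (1 + \<beta>) * (cmod z)\<^sup>2)" by (simp add: D_def mult_ac)
      finally show ?thesis .
    qed
    then show ?thesis by blast
  qed
  define \<psi> where "\<psi> = (\<lambda>z. LINT v|lborel. exp (- (of_real pi * (z * cnj v))) * \<Phi> v)"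
  define \<psi>' where "\<psi>' = (\<lambda>z. LINT v|lborel. - of_real pi * cnj v * exp (- (of_real pi * (z * cnj v))) * \<Phi> v)"
  have "(\<psi> has_field_derivative \<psi>' z) (at z)" for z
    unfolding has_field_derivative_iff tendsto_at_iff_sequentially
  proof (intro allI impI)
    fix X :: "nat \<Rightarrow> complex" assume X: "\<forall>i. X i \<in> UNIV - {z}" "X \<longlonglongrightarrow> z"
    have "(\<lambda>i. X i - z) \<longlonglongrightarrow> 0" using X(2) by (simp add: LIM_zero)
    then have "Bseq (\<lambda>i. X i - z)" by (intro convergent_imp_Bseq) (auto simp: convergent_def)
    then obtain M where M: "M > 0" "\<And>i. cmod (X i - z) \<le> M" unfolding Bseq_def by blast
    define q where "q = (\<lambda>i v. (exp (- (of_real pi * (X i * cnj v))) - exp (- (of_real pi * (z * cnj v)))) / (X i - z) * \<Phi> v)"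
    \<comment> \<open>Three exponents: the kernel at \<open>z\<close>, the increment along the
      bounded sequence, and a factor \<open>pi * cmod v\<close> estimated by its
      exponential.\<close>
    define A where "A = pi * cmod z + pi * M + pi"
    have "(\<lambda>i. LINT v|lborel. q i v) \<longlonglongrightarrow> \<psi>' z"
      unfolding \<psi>'_def
    proof (rule integral_dominated_convergence)
      show "integrable lborel (\<lambda>v. exp (A * cmod v) * cmod (\<Phi> v))" by (rule dom)
      show "(\<lambda>v. - of_real pi * cnj v * exp (- (of_real pi * (z * cnj v))) * \<Phi> v) \<in> borel_measurable lborel"
        using borel_measurable_continuous_onI[of "\<lambda>v. - of_real pi * cnj v * exp (- (of_real pi * (z * cnj v))) * \<Phi> v"]
        by (simp add: continuous_intros cont)
      show "q i \<in> borel_measurable lborel" for i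
      proof -
        have "continuous_on UNIV (q i)" unfolding q_def
          using X(1) by (intro continuous_intros cont) auto
        then show ?thesis using borel_measurable_continuous_onI by simp
      qed
      show "AE v in lborel. (\<lambda>i. q i v) \<longlonglongrightarrow> - of_real pi * cnj v * exp (- (of_real pi * (z * cnj v))) * \<Phi> v"
      proof (rule AE_I2)
        fix v
        have "((\<lambda>z. exp (- (of_real pi * (z * cnj v)))) has_field_derivative (- of_real pi * cnj v * exp (- (of_real pi * (z * cnj v))))) (at z)"
          by (auto intro!: derivative_eq_intros)
        then have "((\<lambda>y. (exp (- (of_real pi * (y * cnj v))) - exp (- (of_real pi * (z * cnj v)))) / (y - z)) \<circ> X) \<longlonglongrightarrow>
           - of_real pi * cnj v * exp (- (of_real pi * (z * cnj v)))"
          unfolding has_field_derivative_iff tendsto_at_iff_sequentially using X by blast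
        then show "(\<lambda>i. q i v) \<longlonglongrightarrow> - of_real pi * cnj v * exp (- (of_real pi * (z * cnj v))) * \<Phi> v"
          unfolding q_def by (intro tendsto_mult tendsto_const) (simp add: o_def)
      qed
      show "AE v in lborel. norm (q i v) \<le> exp (A * cmod v) * cmod (\<Phi> v)" for i
      proof (rule AE_I2)
        fix v
        define h where "h = X i - z"
        have h: "h \<noteq> 0" "cmod h \<le> M" using X(1) M(2)[of i] by (auto simp: h_def)
        define w where "w = - (of_real pi * (h * cnj v))"
        have w: "cmod w = pi * cmod h * cmod v" by (simp add: w_def norm_mult)
        have "exp (- (of_real pi * (X i * cnj v))) = exp (- (of_real pi * (z * cnj v))) * exp w"
          unfolding exp_add[symmetric] by (rule arg_cong[where f = exp]) (simp add: w_def h_def algebra_simps)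
        then have qe: "q i v = exp (- (of_real pi * (z * cnj v))) * ((exp w - 1) / h) * \<Phi> v"
          by (simp add: q_def h_def[symmetric] algebra_simps diff_divide_distrib)
        have "cmod ((exp w - 1) / h) \<le> cmod w * exp (cmod w) / cmod h"
          unfolding norm_divide by (intro divide_right_mono norm_exp_minus_1_le) auto
        also have "\<dots> = pi * cmod v * exp (pi * cmod h * cmod v)" using h by (simp add: w)
        also have "\<dots> \<le> exp (pi * cmod v) * exp (pi * M * cmod v)"
        proof (intro mult_mono)
          show "pi * cmod v \<le> exp (pi * cmod v)" using exp_ge_add_one_self[of "pi * cmod v"] by linarith
          show "exp (pi * cmod h * cmod v) \<le> exp (pi * M * cmod v)" using h by (simp add: mult_right_mono)
        qed auto
        finally have "norm (q i v) \<le> exp (pi * cmod z * cmod v) * (exp (pi * cmod v) * exp (pi * M * cmod v)) * cmod (\<Phi> v)"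
          unfolding qe norm_mult by (intro mult_right_mono mult_mono ne) auto
        also have "\<dots> = exp (A * cmod v) * cmod (\<Phi> v)"
          by (simp add: A_def exp_add[symmetric] algebra_simps)
        finally show "norm (q i v) \<le> exp (A * cmod v) * cmod (\<Phi> v)" .
      qed
    qed
    moreover have "(LINT v|lborel. q i v) = (\<psi> (X i) - \<psi> z) / (X i - z)" for i
    proof -
      have "(LINT v|lborel. q i v) = (LINT v|lborel. (exp (- (of_real pi * (X i * cnj v))) * \<Phi> v - exp (- (of_real pi * (z * cnj v))) * \<Phi> v) / (X i - z))"
        by (simp add: q_def left_diff_distrib diff_divide_distrib)
      also have "\<dots> = (\<psi> (X i) - \<psi> z) / (X i - z)"
        unfolding \<psi>_def integral_divide_zero by (simp only: Bochner_Integration.integral_diff[OF int int])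
      finally show ?thesis .
    qed
    ultimately show "((\<lambda>y. (\<psi> y - \<psi> z) / (y - z)) \<circ> X) \<longlonglongrightarrow> \<psi>' z" by (simp add: o_def)
  qed
  then show "(\<lambda>z. LINT v|lborel. exp (- (of_real pi * (z * cnj v))) * \<Phi> v) holomorphic_on UNIV"
    unfolding \<psi>_def[symmetric] holomorphic_on_def field_differentiable_def by (metis UNIV_I has_field_derivative_at_within)
qed

lemma polyanalytic_weyl_shift:
  "(\<Sum>j<n. cnj (z - l) ^ j * \<psi> j (z - l)) * exp (of_real pi * (cnj l * z - (cmod l)\<^sup>2 / 2)) =
   (\<Sum>p<n. cnj z ^ p * ((\<Sum>j<n. of_nat (j choose p) * cnj (- l) ^ (j - p) * \<psi> j (z - l)) * exp (of_real pi * (cnj l * z - (cmod l)\<^sup>2 / 2))))"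
  using polyanalytic_shift[where z = z and a = "- l" and q = \<psi> and n = n]
  by (simp add: sum_distrib_right mult.assoc)

lemma cmod_weyl: "cmod (exp (of_real pi * (cnj l * z - (cmod l)\<^sup>2 / 2))) = exp (pi / 2 * (cmod z)\<^sup>2) * exp (- (pi / 2) * (cmod (z - l))\<^sup>2)"
proof -
  have "Re (of_real pi * (cnj l * z - (cmod l)\<^sup>2 / 2)) = pi * (Re (cnj l * z) - (cmod l)\<^sup>2 / 2)"
    by (simp add: algebra_simps)
  also have "\<dots> = pi / 2 * (cmod z)\<^sup>2 + - (pi / 2) * (cmod (z - l))\<^sup>2"
    unfolding cmod_diff_square by (simp add: field_simps)
  finally show ?thesis by (simp only: norm_exp_eq_Re exp_add)
qed

lemma has_sum_finite_sum:
  fixes f :: "'i \<Rightarrow> 'b \<Rightarrow> complex"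
  assumes "\<And>i. i \<in> I \<Longrightarrow> (f i has_sum s i) A"
  shows "((\<lambda>m. \<Sum>i\<in>I. f i m) has_sum (\<Sum>i\<in>I. s i)) A"
  using assms by (induction I rule: infinite_finite_induct) (auto intro!: has_sum_add)

text \<open>Cauchy-Schwarz with each weight split into two square roots; this is the Schur-type
  estimate behind the norm bound in \<open>interpolation_from_delta\<close>.\<close>

lemma weighted_sum_square_le:
  fixes x w :: "'a \<Rightarrow> real"
  assumes x: "\<And>i. x i \<ge> 0" and w: "\<And>i. w i \<ge> 0"
    and sw: "w summable_on UNIV" "infsum w UNIV \<le> C"
    and sx: "((\<lambda>i. (x i)\<^sup>2 * w i) has_sum S) UNIV" and xw: "((\<lambda>i. x i * w i) has_sum T) UNIV"
  shows "T\<^sup>2 \<le> C * S"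
proof -
  have C0: "C \<ge> 0" using infsum_nonneg[of UNIV w] w sw(2) by (meson order_trans)
  have S0: "S \<ge> 0" by (rule has_sum_nonneg[OF sx]) (simp add: w)
  have "T \<le> sqrt (C * S)"
  proof (rule has_sum_le_finite_sums[OF xw])
    fix F :: "'a set" assume F: "finite F"
    have "(\<Sum>i\<in>F. x i * w i)\<^sup>2 = (\<Sum>i\<in>F. (x i * sqrt (w i)) * sqrt (w i))\<^sup>2"
      by (rule arg_cong[where f = "\<lambda>x. x\<^sup>2"], rule sum.cong) (simp_all add: mult.assoc w)
    also have "\<dots> \<le> (\<Sum>i\<in>F. (x i * sqrt (w i))\<^sup>2) * (\<Sum>i\<in>F. (sqrt (w i))\<^sup>2)"
      by (rule Cauchy_Schwarz_ineq_sum)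
    also have "\<dots> = (\<Sum>i\<in>F. (x i)\<^sup>2 * w i) * (\<Sum>i\<in>F. w i)"
      by (simp add: power_mult_distrib w)
    also have "\<dots> \<le> S * C"
    proof (intro mult_mono)
      show "(\<Sum>i\<in>F. (x i)\<^sup>2 * w i) \<le> S"
        by (rule finite_sum_le_has_sum[OF sx]) (auto simp: w F)
      have "(\<Sum>i\<in>F. w i) \<le> infsum w UNIV" by (rule finite_sum_le_infsum[OF sw(1)]) (auto simp: w F)
      then show "(\<Sum>i\<in>F. w i) \<le> C" using sw(2) by simp
    qed (auto simp: S0 w intro!: sum_nonneg)
    finally show "(\<Sum>i\<in>F. x i * w i) \<le> sqrt (C * S)" by (simp add: real_le_rsqrt mult.commute)
  qed
  moreover have "T \<ge> 0" by (rule has_sum_nonneg[OF xw]) (simp add: x w)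
  ultimately have "T\<^sup>2 \<le> (sqrt (C * S))\<^sup>2" by (intro power_mono) auto
  then show ?thesis using C0 S0 by simp
qed

section \<open>Interpolation by superposed Weyl translates\<close>

context complex_lattice
begin

text \<open>Weyl translation by a node moves the delta function \<open>F0\<close> to that node and
  preserves the polyanalytic order, so superposing with coefficients
  \<open>\<alpha> m / F0 0\<close> gives the prescribed values. The margin \<open>pi / 2 - a\<close>
  lets the norm estimate be made with the kernel \<open>invquart (z - lp m)\<close>.\<close>

lemma interpolation_from_delta:
  fixes n :: nat and \<psi> :: "nat \<Rightarrow> complex \<Rightarrow> complex" and \<alpha> :: "int \<times> int \<Rightarrow> complex"
  defines "F0 \<equiv> \<lambda>z. \<Sum>p<n. cnj z ^ p * \<psi> p z"
  assumes c: "0 \<le> a" "a < pi / 2" and hol: "\<And>p. p < n \<Longrightarrow> \<psi> p holomorphic_on UNIV"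
    and bound: "\<And>p z. p < n \<Longrightarrow> cmod (\<psi> p z) \<le> D * exp (a * (cmod z)\<^sup>2)"
    and zero: "\<And>m. m \<noteq> 0 \<Longrightarrow> F0 (lp m) = 0" and nz: "F0 0 \<noteq> 0"
    and \<alpha>: "(\<lambda>m. (cmod (\<alpha> m))\<^sup>2) summable_on UNIV"
  obtains \<phi> where "\<And>k. k < n \<Longrightarrow> \<phi> k holomorphic_on UNIV"
    "integrable lborel (\<lambda>z. (cmod (\<Sum>k<n. cnj z ^ k * \<phi> k z))\<^sup>2 * exp (- pi * (cmod z)\<^sup>2))"
    "\<And>m. (\<Sum>k<n. cnj (lp m) ^ k * \<phi> k (lp m)) = \<alpha> m * of_real (exp (pi / 2 * (cmod (lp m))\<^sup>2))"
proof -
  have "n > 0" using nz by (cases n) (auto simp: F0_def)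
  then have D: "D \<ge> 0" using bound[of 0 0] by (simp add: order_trans[OF norm_ge_zero])
  define b where "b = pi / 2 - a"
  have b: "b > 0" using c by (simp add: b_def)
  define x where "x = (\<lambda>m. cmod (\<alpha> m / F0 0))"
  have x0: "x m \<ge> 0" for m by (simp add: x_def)
  have sx2: "(\<lambda>m. (x m)\<^sup>2) summable_on UNIV"
    unfolding x_def norm_divide power_divide using summable_on_cmult_left[OF \<alpha>, of "inverse ((cmod (F0 0))\<^sup>2)"]
    by (simp add: divide_inverse)
  obtain X where X: "X \<ge> 0" "\<And>m. x m \<le> X"
  proof
    define Y where "Y = (\<Sum>\<^sub>\<infinity>m. (x m)\<^sup>2)"
    show "sqrt Y \<ge> 0" by (simp add: Y_def infsum_nonneg)
    show "x m \<le> sqrt Y" for m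
      using finite_sum_le_infsum[OF sx2, of "{m}"] by (simp add: Y_def real_le_rsqrt)
  qed
  define e where "e = (\<lambda>l z. exp (of_real pi * (cnj l * z - (cmod l)\<^sup>2 / 2)))"
  define B where "B = (\<lambda>p l z. (\<Sum>j<n. of_nat (j choose p) * cnj (- l) ^ (j - p) * \<psi> j (z - l)) * e l z)"
  \<comment> \<open>The polyanalytic coefficients of the translates are summed separately, so that
    each \<open>\<phi> p\<close> is a locally uniform limit of holomorphic functions.\<close>
  define t where "t = (\<lambda>p m z. \<alpha> m / F0 0 * B p (lp m) z)"
  have holt: "t p m holomorphic_on UNIV" for p m
  proof -
    have "(\<lambda>z. \<psi> j (z + - lp m)) holomorphic_on UNIV" if "j < n" for j
      by (rule holomorphic_on_shift[OF hol[OF that]])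
    then show ?thesis unfolding t_def B_def e_def by (intro holomorphic_intros) auto
  qed
  have e_norm: "cmod (e l z) = exp (pi / 2 * (cmod z)\<^sup>2) * exp (- (pi / 2) * (cmod (z - l))\<^sup>2)" for l z
    unfolding e_def by (rule cmod_weyl)
  have \<psi>e: "cmod (\<psi> j (z - l)) * cmod (e l z) \<le> D * exp (pi / 2 * (cmod z)\<^sup>2) * exp (- b * (cmod (z - l))\<^sup>2)" if "j < n" for j l z
  proof -
    have "cmod (\<psi> j (z - l)) * cmod (e l z) \<le> (D * exp (a * (cmod (z - l))\<^sup>2)) * cmod (e l z)"
      by (intro mult_right_mono bound that) auto
    also have "\<dots> = D * exp (pi / 2 * (cmod z)\<^sup>2) * (exp (a * (cmod (z - l))\<^sup>2) * exp (- (pi / 2) * (cmod (z - l))\<^sup>2))"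
      by (simp only: e_norm mult_ac)
    also have "exp (a * (cmod (z - l))\<^sup>2) * exp (- (pi / 2) * (cmod (z - l))\<^sup>2) = exp (- b * (cmod (z - l))\<^sup>2)"
      unfolding exp_add[symmetric] by (simp add: b_def algebra_simps)
    finally show ?thesis .
  qed
  \<comment> \<open>Half of \<open>b\<close> because \<open>(cmod l)\<^sup>2 \<le> 2 * (cmod (z -
    l))\<^sup>2 + 2 * (cmod z)\<^sup>2\<close> trades decay in \<open>z - l\<close> for decay in
    \<open>l\<close> when \<open>z\<close> is bounded.\<close>
  obtain K1 where K1: "K1 > 0" "\<And>z. exp (real n * cmod z - (b / 2) * (cmod z)\<^sup>2) \<le> K1 * invquart z"
    using exp_linear_gauss_le_invquart[of "b / 2" "real n"] b by (metis half_gt_zero)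
  have major: "\<exists>M. M summable_on UNIV \<and> (\<forall>m. \<forall>z\<in>cball 0 r. cmod (t p m z) \<le> M m)" for r p
  proof -
    define L where "L = X * (\<Sum>j<n. real (j choose p)) * D * exp (pi / 2 * r\<^sup>2) * exp (b * r\<^sup>2) * K1"
    have "cmod (t p m z) \<le> L * invquart (lp m)" if z: "z \<in> cball 0 r" for m z
    proof -
      define l where "l = lp m"
      have r: "cmod z \<le> r" using z by simp
      have "cmod (B p l z) \<le> (\<Sum>j<n. real (j choose p) * (cmod l ^ (j - p) * (cmod (\<psi> j (z - l)) * cmod (e l z))))"
      proof -
        have "cmod (B p l z) \<le> (\<Sum>j<n. cmod (of_nat (j choose p) * cnj (- l) ^ (j - p) * \<psi> j (z - l))) * cmod (e l z)"
          unfolding B_def norm_mult[of _ "e l z"] by (intro mult_right_mono norm_sum) simp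
        then show ?thesis by (simp add: norm_mult norm_power sum_distrib_right mult.assoc)
      qed
      also have "\<dots> \<le> (\<Sum>j<n. real (j choose p) * ((1 + cmod l) ^ n * (D * exp (pi / 2 * (cmod z)\<^sup>2) * exp (- b * (cmod (z - l))\<^sup>2))))"
      proof (intro sum_mono mult_left_mono, rule mult_mono)
        fix j assume j: "j \<in> {..<n}"
        have "cmod l ^ (j - p) \<le> (1 + cmod l) ^ (j - p)" by (intro power_mono) auto
        also have "\<dots> \<le> (1 + cmod l) ^ n" using j by (intro power_increasing) auto
        finally show "cmod l ^ (j - p) \<le> (1 + cmod l) ^ n" .
        show "cmod (\<psi> j (z - l)) * cmod (e l z) \<le> D * exp (pi / 2 * (cmod z)\<^sup>2) * exp (- b * (cmod (z - l))\<^sup>2)"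
          using \<psi>e[of j z l] j by simp
      qed auto
      also have "\<dots> = (\<Sum>j<n. real (j choose p)) * D * exp (pi / 2 * (cmod z)\<^sup>2) * ((1 + cmod l) ^ n * exp (- b * (cmod (z - l))\<^sup>2))"
        unfolding sum_distrib_right by (intro sum.cong) (simp_all add: mult_ac)
      also have "\<dots> \<le> (\<Sum>j<n. real (j choose p)) * D * exp (pi / 2 * r\<^sup>2) * (exp (b * r\<^sup>2) * (K1 * invquart l))"
      proof (rule mult_mono)
        have "exp (pi / 2 * (cmod z)\<^sup>2) \<le> exp (pi / 2 * r\<^sup>2)" using r by (simp add: power_mono)
        then show "(\<Sum>j<n. real (j choose p)) * D * exp (pi / 2 * (cmod z)\<^sup>2) \<le> (\<Sum>j<n. real (j choose p)) * D * exp (pi / 2 * r\<^sup>2)"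
          using D by (intro mult_left_mono mult_nonneg_nonneg sum_nonneg) auto
        have "(cmod l)\<^sup>2 \<le> 2 * (cmod (l - z))\<^sup>2 + 2 * (cmod z)\<^sup>2"
          using square_cmod_add_le[of "l - z" z] by simp
        moreover have "(cmod z)\<^sup>2 \<le> r\<^sup>2" using r by (intro power_mono) auto
        ultimately have "b * (cmod l)\<^sup>2 \<le> b * (2 * (cmod (z - l))\<^sup>2 + 2 * r\<^sup>2)"
          using b by (intro mult_left_mono) (auto simp: norm_minus_commute)
        then have "- b * (cmod (z - l))\<^sup>2 \<le> b * r\<^sup>2 + - (b / 2) * (cmod l)\<^sup>2" by (simp add: algebra_simps)
        then have "(1 + cmod l) ^ n * exp (- b * (cmod (z - l))\<^sup>2) \<le> exp (real n * cmod l) * exp (b * r\<^sup>2 + - (b / 2) * (cmod l)\<^sup>2)"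
          by (intro mult_mono power_le_exp) auto
        also have "\<dots> = exp (b * r\<^sup>2) * exp (real n * cmod l - (b / 2) * (cmod l)\<^sup>2)"
          unfolding exp_add[symmetric] by (simp add: algebra_simps)
        also have "\<dots> \<le> exp (b * r\<^sup>2) * (K1 * invquart l)" by (intro mult_left_mono K1(2)) auto
        finally show "(1 + cmod l) ^ n * exp (- b * (cmod (z - l))\<^sup>2) \<le> exp (b * r\<^sup>2) * (K1 * invquart l)" .
      qed (use D in \<open>auto intro!: mult_nonneg_nonneg sum_nonneg\<close>)
      finally have Bb: "cmod (B p l z) \<le> (\<Sum>j<n. real (j choose p)) * D * exp (pi / 2 * r\<^sup>2) * (exp (b * r\<^sup>2) * (K1 * invquart l))" .
      have "cmod (t p m z) = x m * cmod (B p l z)" by (simp add: t_def x_def l_def norm_mult norm_divide)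
      also have "\<dots> \<le> X * ((\<Sum>j<n. real (j choose p)) * D * exp (pi / 2 * r\<^sup>2) * (exp (b * r\<^sup>2) * (K1 * invquart l)))"
        by (intro mult_mono X Bb) auto
      finally show ?thesis by (simp add: L_def l_def mult_ac)
    qed
    moreover have "(\<lambda>m. L * invquart (lp m)) summable_on UNIV"
      by (intro summable_on_cmult_right invquart_summable)
    ultimately show ?thesis by blast
  qed
  define \<phi> where "\<phi> = (\<lambda>p z. \<Sum>\<^sub>\<infinity>m. t p m z)"
  have has_t: "((\<lambda>m. t p m z) has_sum \<phi> p z) UNIV" for p z
  proof -
    obtain M where M: "M summable_on UNIV" "\<And>m. cmod (t p m z) \<le> M m"
      using major[of "cmod z" p] by (metis mem_cball_0 order.refl)
    have "(\<lambda>m. norm (t p m z)) summable_on UNIV"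
      by (rule summable_on_comparison_test[OF M(1)]) (use M(2) in auto)
    from has_sum_infsum[OF abs_summable_summable[OF this]] show ?thesis unfolding \<phi>_def .
  qed
  have hol\<phi>: "\<phi> p holomorphic_on UNIV" for p
  proof -
    have "\<phi> p holomorphic_on ball 0 r" for r
    proof -
      obtain M where M: "M summable_on UNIV" "\<And>m z. z \<in> cball 0 r \<Longrightarrow> cmod (t p m z) \<le> M m"
        using major[of r p] by blast
      have ul: "uniform_limit (cball 0 r) (\<lambda>Y z. \<Sum>m\<in>Y. t p m z) (\<phi> p) (finite_subsets_at_top UNIV)"
        unfolding \<phi>_def using M by (intro Weierstrass_m_test_general) auto
      show ?thesis
      proof (rule holomorphic_uniform_limit[OF _ ul])
        show "\<forall>\<^sub>F Y in finite_subsets_at_top UNIV. continuous_on (cball 0 r) (\<lambda>z. \<Sum>m\<in>Y. t p m z) \<and>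
           (\<lambda>z. \<Sum>m\<in>Y. t p m z) holomorphic_on ball 0 r"
          by (intro always_eventually allI conjI holomorphic_on_imp_continuous_on holomorphic_on_sum
              holomorphic_on_subset[OF holt]) auto
      qed auto
    qed
    then have "\<phi> p field_differentiable (at z)" for z
      using holomorphic_on_imp_differentiable_at[of "\<phi> p" "ball 0 (cmod z + 1)" z] by simp
    then show ?thesis by (simp add: holomorphic_on_def field_differentiable_at_within)
  qed
  define F where "F = (\<lambda>z. \<Sum>k<n. cnj z ^ k * \<phi> k z)"
  have tsum: "(\<Sum>k<n. cnj z ^ k * t k m z) = \<alpha> m / F0 0 * (F0 (z - lp m) * e (lp m) z)" for m z
    using polyanalytic_weyl_shift[where n = n and z = z and l = "lp m" and \<psi> = \<psi>]
    by (simp add: t_def B_def e_def F0_def sum_distrib_left mult_ac)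
  have hasF: "((\<lambda>m. \<alpha> m / F0 0 * (F0 (z - lp m) * e (lp m) z)) has_sum F z) UNIV" for z
    unfolding tsum[symmetric] F_def by (intro has_sum_finite_sum has_sum_cmult_right has_t)
  have val: "F (lp j) = \<alpha> j * of_real (exp (pi / 2 * (cmod (lp j))\<^sup>2))" for j
  proof -
    have ee: "e (lp j) (lp j) = of_real (exp (pi / 2 * (cmod (lp j))\<^sup>2))"
    proof -
      have "cnj (lp j) * lp j - (cmod (lp j))\<^sup>2 / 2 = of_real ((cmod (lp j))\<^sup>2 / 2)"
        by (simp only: of_real_divide complex_norm_square) simp
      then have "of_real pi * (cnj (lp j) * lp j - (cmod (lp j))\<^sup>2 / 2) = complex_of_real (pi / 2 * (cmod (lp j))\<^sup>2)"
        by (simp only: of_real_mult[symmetric]) simp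
      then show ?thesis by (simp only: e_def exp_of_real)
    qed
    have "\<alpha> m / F0 0 * (F0 (lp j - lp m) * e (lp m) (lp j)) = 0" if "m \<noteq> j" for m
      using zero[of "j - m"] that by (simp add: lp_diff)
    then have "((\<lambda>m. \<alpha> m / F0 0 * (F0 (lp j - lp m) * e (lp m) (lp j))) has_sum (\<alpha> j / F0 0 * (F0 (lp j - lp j) * e (lp j) (lp j)))) UNIV"
      by (intro has_sum_finite_neutralI[of "{j}"]) auto
    then have "F (lp j) = \<alpha> j / F0 0 * (F0 (lp j - lp j) * e (lp j) (lp j))"
      using hasF has_sum_unique by blast
    then show ?thesis using nz by (simp add: ee)
  qed
  obtain K2 where K2: "K2 > 0" "\<And>z. exp (real n * cmod z - b * (cmod z)\<^sup>2) \<le> K2 * invquart z"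
    using exp_linear_gauss_le_invquart[of b "real n"] b by metis
  define Q where "Q = real n * D * K2"
  have Q: "Q \<ge> 0" using D K2 by (simp add: Q_def)
  have F0b: "cmod (F0 z) * exp (- (pi / 2) * (cmod z)\<^sup>2) \<le> Q * invquart z" for z
  proof -
    have "cmod (F0 z) \<le> (\<Sum>p<n. cmod z ^ p * cmod (\<psi> p z))"
      unfolding F0_def by (intro order_trans[OF norm_sum]) (simp add: norm_mult norm_power)
    also have "\<dots> \<le> (\<Sum>p<n. exp (real n * cmod z) * (D * exp (a * (cmod z)\<^sup>2)))"
    proof (intro sum_mono mult_mono bound)
      fix p assume p: "p \<in> {..<n}"
      have "cmod z ^ p \<le> (1 + cmod z) ^ p" by (intro power_mono) auto
      also have "\<dots> \<le> (1 + cmod z) ^ n" using p by (intro power_increasing) auto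
      also have "\<dots> \<le> exp (real n * cmod z)" by (rule power_le_exp) simp
      finally show "cmod z ^ p \<le> exp (real n * cmod z)" .
    qed auto
    finally have "cmod (F0 z) * exp (- (pi / 2) * (cmod z)\<^sup>2) \<le> (real n * (exp (real n * cmod z) * (D * exp (a * (cmod z)\<^sup>2)))) * exp (- (pi / 2) * (cmod z)\<^sup>2)"
      by (intro mult_right_mono) auto
    also have "\<dots> = real n * D * exp (real n * cmod z - b * (cmod z)\<^sup>2)"
    proof -
      have "exp (real n * cmod z) * exp (a * (cmod z)\<^sup>2) * exp (- (pi / 2) * (cmod z)\<^sup>2) = exp (real n * cmod z - b * (cmod z)\<^sup>2)"
        unfolding exp_add[symmetric] by (simp add: b_def algebra_simps)
      from this[symmetric] show ?thesis by (simp add: mult_ac)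
    qed
    also have "\<dots> \<le> real n * D * (K2 * invquart z)" using D by (intro mult_left_mono K2(2)) auto
    finally show ?thesis by (simp add: Q_def mult_ac)
  qed
  obtain C where C: "C \<ge> 0" "\<And>z. (\<lambda>m. invquart (z + lp m)) summable_on UNIV" "\<And>z. (\<Sum>\<^sub>\<infinity>m. invquart (z + lp m)) \<le> C"
    using invquart_translates by blast
  have bijm: "bij (uminus :: int \<times> int \<Rightarrow> _)" by (rule bij_uminus)
  have C': "(\<lambda>m. invquart (z - lp m)) summable_on UNIV" "(\<Sum>\<^sub>\<infinity>m. invquart (z - lp m)) \<le> C" for z
    using C(2,3)[of z] summable_on_reindex_bij_betw[OF bijm, of "\<lambda>m. invquart (z - lp m)"]
      infsum_reindex_bij_betw[OF bijm, of "\<lambda>m. invquart (z - lp m)"] by (simp_all add: lp_minus)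
  have iq0: "invquart z \<ge> 0" for z by (rule less_imp_le[OF invquart_pos])
  have iq1: "invquart z \<le> 1" for z
    unfolding invquart_def by (simp add: divide_le_eq_1 one_le_power)
  \<comment> \<open>Up to a constant \<open>S\<close> bounds the weighted square of \<open>F\<close>
    pointwise. The integral of each term is proportional to \<open>(x m)\<^sup>2\<close>, so square
    summable data give an integrable bound.\<close>
  define S where "S = (\<lambda>z. \<Sum>\<^sub>\<infinity>m. (x m)\<^sup>2 * invquart (z - lp m))"
  have sS: "(\<lambda>m. (x m)\<^sup>2 * invquart (z - lp m)) summable_on UNIV" for z
    by (rule summable_on_comparison_test[OF sx2]) (use iq1 iq0 in \<open>auto intro!: mult_left_le mult_nonneg_nonneg\<close>)
  have F_le: "(cmod (F z))\<^sup>2 * exp (- pi * (cmod z)\<^sup>2) \<le> Q\<^sup>2 * C * S z" for z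
  proof -
    have sxw: "(\<lambda>m. x m * invquart (z - lp m)) summable_on UNIV"
    proof (rule summable_on_comparison_test)
      show "(\<lambda>m. X * invquart (z - lp m)) summable_on UNIV" by (intro summable_on_cmult_right C')
    qed (use X x0 iq0 in \<open>auto intro!: mult_right_mono mult_nonneg_nonneg\<close>)
    define T where "T = (\<Sum>\<^sub>\<infinity>m. x m * invquart (z - lp m))"
    have T2: "T\<^sup>2 \<le> C * S z"
      by (rule weighted_sum_square_le[of x "\<lambda>m. invquart (z - lp m)"])
         (use x0 iq0 C' sS sxw in \<open>auto simp: T_def S_def\<close>)
    have term_le: "cmod (\<alpha> m / F0 0 * (F0 (z - lp m) * e (lp m) z)) \<le> Q * exp (pi / 2 * (cmod z)\<^sup>2) * (x m * invquart (z - lp m))" for m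
    proof -
      have "cmod (\<alpha> m / F0 0 * (F0 (z - lp m) * e (lp m) z)) =
        x m * exp (pi / 2 * (cmod z)\<^sup>2) * (cmod (F0 (z - lp m)) * exp (- (pi / 2) * (cmod (z - lp m))\<^sup>2))"
        by (simp only: norm_mult x_def e_norm mult_ac)
      also have "\<dots> \<le> x m * exp (pi / 2 * (cmod z)\<^sup>2) * (Q * invquart (z - lp m))"
        by (intro mult_left_mono F0b) (simp add: x0)
      finally show ?thesis by (simp only: mult_ac)
    qed
    have sn: "(\<lambda>m. Q * exp (pi / 2 * (cmod z)\<^sup>2) * (x m * invquart (z - lp m))) summable_on UNIV"
      by (intro summable_on_cmult_right sxw)
    have "cmod (F z) \<le> (\<Sum>\<^sub>\<infinity>m. Q * exp (pi / 2 * (cmod z)\<^sup>2) * (x m * invquart (z - lp m)))"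
      by (rule norm_infsum_le[OF hasF has_sum_infsum[OF sn] term_le])
    also have "\<dots> = Q * exp (pi / 2 * (cmod z)\<^sup>2) * T"
      unfolding T_def by (rule infsum_cmult_right) (rule sxw)
    finally have "(cmod (F z))\<^sup>2 \<le> (Q * exp (pi / 2 * (cmod z)\<^sup>2) * T)\<^sup>2" by (intro power_mono) auto
    also have "\<dots> = Q\<^sup>2 * (exp (pi / 2 * (cmod z)\<^sup>2))\<^sup>2 * T\<^sup>2" by (simp only: power_mult_distrib)
    also have "(exp (pi / 2 * (cmod z)\<^sup>2))\<^sup>2 = exp (pi * (cmod z)\<^sup>2)" by (simp flip: exp_double)
    finally have "(cmod (F z))\<^sup>2 * exp (- pi * (cmod z)\<^sup>2) \<le> (Q\<^sup>2 * exp (pi * (cmod z)\<^sup>2) * T\<^sup>2) * exp (- pi * (cmod z)\<^sup>2)"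
      by (intro mult_right_mono) auto
    also have "\<dots> = Q\<^sup>2 * T\<^sup>2" by (simp add: exp_minus)
    also have "\<dots> \<le> Q\<^sup>2 * (C * S z)" by (intro mult_left_mono T2) auto
    finally show ?thesis by (simp only: mult.assoc)
  qed
  have S_suminf: "S z = (\<Sum>i. (x (enum i))\<^sup>2 * invquart (z - lp (enum i)))"
    "summable (\<lambda>i. (x (enum i))\<^sup>2 * invquart (z - lp (enum i)))" for z
  proof -
    have "((\<lambda>i. (x (enum i))\<^sup>2 * invquart (z - lp (enum i))) has_sum S z) UNIV"
      unfolding S_def using has_sum_infsum[OF sS[of z]] by (subst has_sum_reindex_bij_betw[OF bij_enum])
    from has_sum_imp_sums[OF this] show "S z = (\<Sum>i. (x (enum i))\<^sup>2 * invquart (z - lp (enum i)))"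
      "summable (\<lambda>i. (x (enum i))\<^sup>2 * invquart (z - lp (enum i)))" by (simp_all add: sums_iff)
  qed
  have iq_int: "integrable lborel (\<lambda>z. invquart (z - l))" "(LINT z|lborel. invquart (z - l)) = (LINT z|lborel. invquart z)" for l
  proof -
    have m: "invquart \<in> borel_measurable borel" by (intro borel_measurable_continuous_onI continuous_intros)
    show "integrable lborel (\<lambda>z. invquart (z - l))"
      using integrable_lborel_shift[OF m, of "- l"] integrable_invquart by (simp add: add.commute)
    show "(LINT z|lborel. invquart (z - l)) = (LINT z|lborel. invquart z)"
      using integral_lborel_shift[OF m, of "- l"] by (simp add: add.commute)
  qed
  have sxe: "summable (\<lambda>i. (x (enum i))\<^sup>2)"
  proof (rule summable_on_imp_summable)
    show "(\<lambda>i. (x (enum i))\<^sup>2) summable_on UNIV"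
      using summable_on_reindex_bij_betw[OF bij_enum, of "\<lambda>m. (x m)\<^sup>2"] sx2 by simp
  qed
  have intS: "integrable lborel S"
    unfolding S_suminf(1)[abs_def]
  proof (rule integrable_suminf)
    show "integrable lborel (\<lambda>z. (x (enum i))\<^sup>2 * invquart (z - lp (enum i)))" for i
      by (intro Bochner_Integration.integrable_mult_right iq_int)
    show "AE z in lborel. summable (\<lambda>i. norm ((x (enum i))\<^sup>2 * invquart (z - lp (enum i))))"
      using S_suminf(2) iq0 by (intro AE_I2) (simp add: abs_mult abs_of_nonneg)
    have "(LINT z|lborel. norm ((x (enum i))\<^sup>2 * invquart (z - lp (enum i)))) = (x (enum i))\<^sup>2 * (LINT z|lborel. invquart z)" for i
      using iq0 by (simp add: abs_mult abs_of_nonneg iq_int(2))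
    then show "summable (\<lambda>i. LINT z|lborel. norm ((x (enum i))\<^sup>2 * invquart (z - lp (enum i))))"
      using summable_mult2[OF sxe] by simp
  qed
  have contF: "continuous_on UNIV F" unfolding F_def by (intro continuous_on_polyanalytic hol\<phi>)
  have intF: "integrable lborel (\<lambda>z. (cmod (F z))\<^sup>2 * exp (- pi * (cmod z)\<^sup>2))"
  proof (rule Bochner_Integration.integrable_bound[OF Bochner_Integration.integrable_mult_right[OF intS, of "Q\<^sup>2 * C"]])
    have "continuous_on UNIV (\<lambda>z. (cmod (F z))\<^sup>2 * exp (- pi * (cmod z)\<^sup>2))" by (intro continuous_intros contF)
    then show "(\<lambda>z. (cmod (F z))\<^sup>2 * exp (- pi * (cmod z)\<^sup>2)) \<in> borel_measurable lborel"
      using borel_measurable_continuous_onI by simp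
    show "AE z in lborel. norm ((cmod (F z))\<^sup>2 * exp (- pi * (cmod z)\<^sup>2)) \<le> norm (Q\<^sup>2 * C * S z)"
    proof (intro AE_I2)
      fix z
      have "norm ((cmod (F z))\<^sup>2 * exp (- pi * (cmod z)\<^sup>2)) = (cmod (F z))\<^sup>2 * exp (- pi * (cmod z)\<^sup>2)" by simp
      also have "\<dots> \<le> norm (Q\<^sup>2 * C * S z)" unfolding real_norm_def by (rule order_trans[OF F_le abs_ge_self])
      finally show "norm ((cmod (F z))\<^sup>2 * exp (- pi * (cmod z)\<^sup>2)) \<le> norm (Q\<^sup>2 * C * S z)" .
    qed
  qed
  show thesis
    by (rule that[of \<phi>]) (use hol\<phi> intF val in \<open>auto simp: F_def\<close>)
qed

end

section \<open>The delta function for density below \<open>n\<close>\<close>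

context quasi_periodic
begin

text \<open>Outside the unit disc \<open>cmod (k w)\<close> is at most \<open>cmod (s w)\<close>;
  inside it compactness applies.\<close>

lemma k_bound: obtains C where "C > 0" "\<And>w. cmod (k w) \<le> C * gauss w"
proof -
  obtain C1 where C1: "C1 > 0" "\<And>w. cmod (s w) \<le> C1 * gauss w" using s_bound by blast
  have "bounded (k ` cball 0 1)"
    by (intro compact_imp_bounded compact_continuous_image continuous_on_subset[OF cont_k]) auto
  then obtain B where B: "B > 0" "\<And>w. cmod w \<le> 1 \<Longrightarrow> cmod (k w) \<le> B"
    unfolding bounded_pos by auto
  have "cmod (k w) \<le> (C1 + B) * gauss w" for w
  proof (cases "cmod w \<le> 1")
    case True
    have "B * 1 \<le> (C1 + B) * gauss w" using gauss_ge_1[of w] B C1 by (intro mult_mono) auto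
    then show ?thesis using B(2)[OF True] by simp
  next
    case False
    then have "1 \<le> cmod w ^ n" by (intro one_le_power) simp
    then have "cmod (k w) \<le> cmod w ^ n * cmod (k w)" by (simp add: mult_le_cancel_right1)
    also have "\<dots> = cmod (s w)" by (simp add: s_eq norm_mult norm_power)
    also have "\<dots> \<le> C1 * gauss w" by (rule C1(2))
    also have "\<dots> \<le> (C1 + B) * gauss w" using gauss_ge_1[of w] B by (intro mult_right_mono) auto
    finally show ?thesis .
  qed
  then show thesis using that[of "C1 + B"] C1 B by simp
qed

text \<open>\<open>lin z v\<close> is affine in \<open>cnj z\<close> and enters with powers
  \<open>j \<le> l < n\<close>, so \<open>R\<close> has degree below \<open>n\<close> in
  \<open>cnj z\<close>. The factor \<open>k (- v)\<close> is kept apart because it carries Gaussian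
  growth, whereas \<open>Q p\<close> is polynomial in \<open>v\<close> and
  \<open>cnj v\<close>.\<close>

lemma R_polyanalytic:
  obtains Q where "\<And>p. tempered (Q p)" "\<And>v z. R v (lin z v) = (\<Sum>p<n. cnj z ^ p * (- k (- v) * Q p v))"
proof -
  obtain d where d: "\<And>l c. contour_integral bp (\<lambda>t. exp (c * t) / (k t * t ^ Suc l)) = (\<Sum>j\<le>l. d l j * c ^ j)"
    using exp_coeff_polynomial by blast
  define Q where "Q = (\<lambda>p v. \<Sum>l<n. \<Sum>j\<le>l. (- v) ^ l * (d l j * (- of_real pi) ^ j * of_nat (j choose p) * (of_real \<beta> * cnj v) ^ (j - p)))"
  have "tempered (Q p)" for p
    unfolding Q_def
    by (intro tempered_sum tempered_mult tempered_power tempered_const tempered_cnj tempered_minus)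
  moreover have "R v (lin z v) = (\<Sum>p<n. cnj z ^ p * (- k (- v) * Q p v))" for v z
  proof -
    have pw: "lin z v ^ j = (\<Sum>p<n. cnj z ^ p * ((- of_real pi) ^ j * of_nat (j choose p) * (of_real \<beta> * cnj v) ^ (j - p)))" if "j < n" for j
    proof -
      have "lin z v ^ j = (- of_real pi) ^ j * (cnj z + of_real \<beta> * cnj v) ^ j"
        unfolding lin_def power_mult_distrib[symmetric] by (simp add: add.commute)
      also have "(cnj z + of_real \<beta> * cnj v) ^ j = (\<Sum>p\<le>j. of_nat (j choose p) * cnj z ^ p * (of_real \<beta> * cnj v) ^ (j - p))"
        by (rule binomial_ring)
      also have "\<dots> = (\<Sum>p<n. of_nat (j choose p) * cnj z ^ p * (of_real \<beta> * cnj v) ^ (j - p))"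
        using that by (intro sum.mono_neutral_left) (auto simp: not_le binomial_eq_0)
      finally show ?thesis by (simp add: sum_distrib_left mult_ac)
    qed
    have "R v (lin z v) = - k (- v) * (\<Sum>l<n. \<Sum>j\<le>l. (- v) ^ l * (d l j * lin z v ^ j))"
      unfolding R_def d by (simp only: sum_distrib_left)
    also have "(\<Sum>l<n. \<Sum>j\<le>l. (- v) ^ l * (d l j * lin z v ^ j)) =
      (\<Sum>l<n. \<Sum>j\<le>l. \<Sum>p<n. cnj z ^ p * ((- v) ^ l * (d l j * (- of_real pi) ^ j * of_nat (j choose p) * (of_real \<beta> * cnj v) ^ (j - p))))"
      by (intro sum.cong refl) (simp add: pw sum_distrib_left mult_ac)
    also have "\<dots> = (\<Sum>l<n. \<Sum>p<n. \<Sum>j\<le>l. cnj z ^ p * ((- v) ^ l * (d l j * (- of_real pi) ^ j * of_nat (j choose p) * (of_real \<beta> * cnj v) ^ (j - p))))"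
      by (intro sum.cong refl sum.swap)
    also have "\<dots> = (\<Sum>p<n. \<Sum>l<n. \<Sum>j\<le>l. cnj z ^ p * ((- v) ^ l * (d l j * (- of_real pi) ^ j * of_nat (j choose p) * (of_real \<beta> * cnj v) ^ (j - p))))"
      by (rule sum.swap)
    also have "\<dots> = (\<Sum>p<n. cnj z ^ p * Q p v)"
      by (simp add: Q_def sum_distrib_left)
    finally show ?thesis by (simp add: sum_distrib_left mult_ac sum_negf)
  qed
  ultimately show thesis using that by blast
qed

lemma delta_function_exists:
  assumes dens: "area < real n"
  obtains \<psi> a D where "0 \<le> a" "a < pi / 2" "\<And>p. \<psi> p holomorphic_on UNIV"
    "\<And>p z. p < n \<Longrightarrow> cmod (\<psi> p z) \<le> D * exp (a * (cmod z)\<^sup>2)"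
    "\<And>\<zeta>. \<forall>m. chi \<zeta> (lp m) = 1 \<Longrightarrow> \<zeta> \<noteq> 0 \<Longrightarrow> (\<Sum>p<n. cnj \<zeta> ^ p * \<psi> p \<zeta>) = 0"
    "(\<Sum>p<n. cnj 0 ^ p * \<psi> p 0) \<noteq> 0"
proof -
  have \<beta>1: "\<beta> > 1" using dens area_gt_0 by (simp add: \<beta>_def)
  obtain Q where Q: "\<And>p. tempered (Q p)" "\<And>v z. R v (lin z v) = (\<Sum>p<n. cnj z ^ p * (- k (- v) * Q p v))"
    using R_polyanalytic by blast
  obtain Ck where Ck: "Ck > 0" "\<And>w. cmod (k w) \<le> Ck * gauss w" using k_bound by blast
  \<comment> \<open>Of the Gaussian with exponent \<open>pi * \<beta>\<close> the factor
    \<open>k (- v)\<close> consumes half, leaving the decay required by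
    \<open>gauss_transform\<close>.\<close>
  define \<Phi> where "\<Phi> = (\<lambda>p v. exp (- (of_real (pi * \<beta>) * (v * cnj v))) * (- k (- v) * Q p v))"
  have cont\<Phi>: "continuous_on UNIV (\<Phi> p)" for p
    unfolding \<Phi>_def using Q(1)[of p]
    by (intro continuous_intros continuous_on_compose2[OF cont_k]) (auto simp: tempered_def)
  have bound\<Phi>: "\<exists>C N. \<forall>v. cmod (\<Phi> p v) \<le> C * (1 + cmod v) ^ N * exp (- (pi * \<beta> / 2) * (cmod v)\<^sup>2)" for p
  proof -
    obtain C N where C: "C \<ge> 0" "\<And>v. cmod (Q p v) \<le> C * (1 + cmod v) ^ N"
      using Q(1)[of p] unfolding tempered_def by blast
    have "cmod (\<Phi> p v) \<le> (Ck * C) * (1 + cmod v) ^ N * exp (- (pi * \<beta> / 2) * (cmod v)\<^sup>2)" for v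
    proof -
      have n: "v * cnj v = of_real ((cmod v)\<^sup>2)" by (simp only: complex_norm_square)
      have "cmod (exp (- (of_real (pi * \<beta>) * (v * cnj v)))) = exp (- (pi * \<beta>) * (cmod v)\<^sup>2)"
        unfolding n norm_exp_eq_Re by simp
      then have "cmod (\<Phi> p v) = exp (- (pi * \<beta>) * (cmod v)\<^sup>2) * (cmod (k (- v)) * cmod (Q p v))"
        by (simp only: \<Phi>_def norm_mult norm_minus_cancel)
      also have "\<dots> \<le> exp (- (pi * \<beta>) * (cmod v)\<^sup>2) * ((Ck * gauss (- v)) * (C * (1 + cmod v) ^ N))"
        using Ck(1) C(1) by (intro mult_left_mono mult_mono Ck(2) C(2)) (auto simp: gauss_def)
      also have "\<dots> = (Ck * C) * (1 + cmod v) ^ N * (exp (- (pi * \<beta>) * (cmod v)\<^sup>2) * exp (pi * \<beta> / 2 * (cmod v)\<^sup>2))"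
        by (simp add: gauss_def mult_ac)
      also have "exp (- (pi * \<beta>) * (cmod v)\<^sup>2) * exp (pi * \<beta> / 2 * (cmod v)\<^sup>2) = exp (- (pi * \<beta> / 2) * (cmod v)\<^sup>2)"
        unfolding exp_add[symmetric] by (simp add: field_simps)
      finally show ?thesis .
    qed
    then show ?thesis by blast
  qed
  define \<psi> where "\<psi> = (\<lambda>p z. LINT v|lborel. exp (- (of_real pi * (z * cnj v))) * \<Phi> p v)"
  have int: "integrable lborel (\<lambda>v. exp (- (of_real pi * (z * cnj v))) * \<Phi> p v)"
    and hol: "\<psi> p holomorphic_on UNIV"
    and bd: "\<exists>D. \<forall>z. cmod (\<psi> p z) \<le> D * exp (pi / (1 + \<beta>) * (cmod z)\<^sup>2)" for p z
  proof -
    obtain C N where b: "\<And>v. cmod (\<Phi> p v) \<le> C * (1 + cmod v) ^ N * exp (- (pi * \<beta> / 2) * (cmod v)\<^sup>2)"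
      using bound\<Phi>[of p] by blast
    note g = gauss_transform[OF \<beta>1 cont\<Phi> b]
    show "integrable lborel (\<lambda>v. exp (- (of_real pi * (z * cnj v))) * \<Phi> p v)" by (rule g(1))
    show "\<psi> p holomorphic_on UNIV" unfolding \<psi>_def by (rule g(2))
    show "\<exists>D. \<forall>z. cmod (\<psi> p z) \<le> D * exp (pi / (1 + \<beta>) * (cmod z)\<^sup>2)" unfolding \<psi>_def by (rule g(3))
  qed
  from bd obtain D where D: "\<And>p z. cmod (\<psi> p z) \<le> D p * exp (pi / (1 + \<beta>) * (cmod z)\<^sup>2)" by metis
  have D': "cmod (\<psi> p z) \<le> (\<Sum>p<n. \<bar>D p\<bar>) * exp (pi / (1 + \<beta>) * (cmod z)\<^sup>2)" if "p < n" for p z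
  proof -
    have "D p \<le> \<bar>D p\<bar>" by simp
    also have "\<bar>D p\<bar> \<le> (\<Sum>p<n. \<bar>D p\<bar>)" using that by (intro member_le_sum) auto
    finally show ?thesis by (intro order_trans[OF D] mult_right_mono) auto
  qed
  \<comment> \<open>Pulling the powers of \<open>cnj z\<close> out of the integral presents it as a
    polyanalytic function with the holomorphic coefficients \<open>\<psi> p\<close>.\<close>
  have pe: "pref z v * R v (lin z v) = (\<Sum>p<n. cnj z ^ p * (exp (- (of_real pi * (z * cnj v))) * \<Phi> p v))" for z v
  proof -
    have "pref z v = exp (- (of_real pi * (z * cnj v))) * exp (- (of_real (pi * \<beta>) * (v * cnj v)))"
      by (simp add: pref_def flip: exp_add)
    then show ?thesis by (simp add: Q(2) \<Phi>_def sum_distrib_left mult_ac)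
  qed
  have intp: "integrable lborel (\<lambda>v. pref z v * R v (lin z v))" for z
    unfolding pe by (intro Bochner_Integration.integrable_sum Bochner_Integration.integrable_mult_right int)
  have F0: "(\<Sum>p<n. cnj z ^ p * \<psi> p z) = (LINT v|lborel. pref z v * R v (lin z v))" for z
    unfolding pe \<psi>_def using int by (subst Bochner_Integration.integral_sum) auto
  show thesis
  proof (rule that[of "pi / (1 + \<beta>)" \<psi> "\<Sum>p<n. \<bar>D p\<bar>"])
    show "0 \<le> pi / (1 + \<beta>)" using \<beta>1 by simp
    show "pi / (1 + \<beta>) < pi / 2" using \<beta>1 by (intro divide_strict_left_mono) auto
    show "\<psi> p holomorphic_on UNIV" for p by (rule hol)
    show "cmod (\<psi> p z) \<le> (\<Sum>p<n. \<bar>D p\<bar>) * exp (pi / (1 + \<beta>) * (cmod z)\<^sup>2)" if "p < n" for p z by (rule D'[OF that])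
    show "(\<Sum>p<n. cnj \<zeta> ^ p * \<psi> p \<zeta>) = 0" if "\<forall>m. chi \<zeta> (lp m) = 1" "\<zeta> \<noteq> 0" for \<zeta>
      unfolding F0 using integral_pref_R[OF that(1)[rule_format] intp] that(2) by simp
    have "(\<Sum>p<n. cnj 0 ^ p * \<psi> p 0) = - (2 * of_real pi * \<i> * W) * of_real vol"
      unfolding F0 using integral_pref_R[OF _ intp, of 0] by simp
    then show "(\<Sum>p<n. cnj 0 ^ p * \<psi> p 0) \<noteq> 0" using W_nz vol_pos by simp
  qed
qed

end

section \<open>The theorem for a lattice given by a matrix\<close>

lemma chi_swap: "chi \<nu> z = cnj (chi z \<nu>)"
  by (simp add: chi_eq_cis cis_cnj algebra_simps)

text \<open>The columns of \<open>A\<close> generate the lattice; for a negative determinant they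
  are exchanged to restore positive orientation.\<close>

lemma Gamma_lattice_eq_range:
  assumes "invertible A"
  obtains w1 w2 where "complex_lattice w1 w2" "complex_lattice.area w1 w2 = \<bar>det A\<bar>"
    "Gamma_lattice A = range (complex_lattice.lp w1 w2)"
proof -
  define p q where "p = Complex (A $ 1 $ 1) (A $ 2 $ 1)" and "q = Complex (A $ 1 $ 2) (A $ 2 $ 2)"
  have d: "Im (cnj p * q) = det A" "Im (cnj q * p) = - det A"
    by (simp_all add: p_def q_def det_2 algebra_simps)
  have d0: "det A \<noteq> 0" using assms by (simp add: invertible_det_nz)
  have G: "Gamma_lattice A = range (\<lambda>(a, b). of_int a * p + of_int b * q)"
  proof -
    have "Complex ((A *v vector [real_of_int a, real_of_int b]) $ 1) ((A *v vector [real_of_int a, real_of_int b]) $ 2) =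
      of_int a * p + of_int b * q" for a b
      by (simp add: matrix_vector_mult_def sum_2 p_def q_def complex_eq_iff mult.commute)
    then show ?thesis
      unfolding Gamma_lattice_def lattice_def by (force simp: image_iff)
  qed
  show thesis
  proof (cases "det A > 0")
    case True
    then interpret L: complex_lattice p q by unfold_locales (simp only: d)
    have "L.area = \<bar>det A\<bar>" unfolding L.area_def using True d by simp
    moreover have "Gamma_lattice A = range L.lp" by (simp add: G L.lp_def[abs_def] case_prod_unfold)
    ultimately show thesis using that L.complex_lattice_axioms by blast
  next
    case False
    then have "det A < 0" using d0 by simp
    then interpret L: complex_lattice q p by unfold_locales (simp only: d; simp)
    have "L.area = \<bar>det A\<bar>" unfolding L.area_def using \<open>det A < 0\<close> d by simp
    moreover have "Gamma_lattice A = range L.lp"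
    proof -
      have "(\<lambda>(a, b). of_int a * p + of_int b * q) = L.lp \<circ> prod.swap"
        by (auto simp: L.lp_def add.commute)
      then have "Gamma_lattice A = L.lp ` range prod.swap" by (simp only: G image_comp)
      then show ?thesis by (simp only: surj_swap)
    qed
    ultimately show thesis using that L.complex_lattice_axioms by blast
  qed
qed

theorem theorem6:
  fixes n :: nat and A :: "real^2^2"
  assumes "n \<ge> 1" and "invertible A"
  shows "interpolating (Gamma_lattice A) n \<longleftrightarrow> lattice_density A < real n"
proof -
  obtain w1 w2 where lat: "complex_lattice w1 w2" and ar: "complex_lattice.area w1 w2 = \<bar>det A\<bar>"
    and G: "Gamma_lattice A = range (complex_lattice.lp w1 w2)"
    using Gamma_lattice_eq_range[OF assms(2)] by blast
  interpret L: complex_lattice w1 w2 by (rule lat)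
  \<comment> \<open>The sigma function is built on the dual lattice, whose area is the density of
    the given one; dualising twice returns the nodes \<open>L.lp m\<close>.\<close>
  interpret M: complex_lattice "w1 / of_real L.area" "w2 / of_real L.area" by (rule L.dual_lattice)
  have M_lp: "M.lp m = L.lp m / of_real L.area" for m
    by (simp add: M.lp_def L.lp_def add_divide_distrib)
  have M_area: "M.area = 1 / L.area"
  proof -
    have "M.area = Im (cnj w1 * w2) / L.area / L.area"
      by (simp add: M.area_def Im_divide_of_real diff_divide_distrib)
    also have "Im (cnj w1 * w2) = L.area" by (simp only: L.area_def)
    finally show ?thesis using L.area_gt_0 by simp
  qed
  have dual: "M.lp m / of_real M.area = L.lp m" for m
    using L.area_gt_0 by (simp add: M_lp M_area)
  obtain s k where sk: "k holomorphic_on UNIV" "\<And>w. s w = w ^ n * k w" "k 0 \<noteq> 0"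
    "\<And>w. w \<notin> range M.lp \<Longrightarrow> k w \<noteq> 0"
    "\<And>m. \<exists>\<epsilon>. cmod \<epsilon> = 1 \<and> (\<forall>w. s (w + M.lp m) =
       \<epsilon> * exp (of_real (pi * (real n / M.area)) * (cnj (M.lp m) * w + (cmod (M.lp m))\<^sup>2 / 2)) * s w)"
    by (rule M.sigma_power_exists[of n]) (rule that)
  interpret Q: quasi_periodic "w1 / of_real L.area" "w2 / of_real L.area" s k n
    by unfold_locales (use assms(1) sk in auto)
  have dens: "lattice_density A = M.area" unfolding M_area unfolding ar lattice_density_def ..
  show ?thesis
  proof
    assume interp: "interpolating (Gamma_lattice A) n"
    show "lattice_density A < real n"
    proof (rule ccontr)
      assume "\<not> lattice_density A < real n"
      then have le: "real n \<le> M.area" by (simp add: dens)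
      \<comment> \<open>Square summable data supported at 0; a function interpolating them is the
        delta function excluded by \<open>no_delta_function\<close>.\<close>
      define \<alpha> where "\<alpha> = (\<lambda>z::complex. if z = 0 then (1::complex) else 0)"
      have "(\<lambda>z. (cmod (\<alpha> z))\<^sup>2) summable_on Gamma_lattice A"
      proof -
        have "(\<lambda>z. (cmod (\<alpha> z))\<^sup>2) summable_on {0}" by simp
        then show ?thesis
          by (rule summable_on_cong_neutral[THEN iffD1, rotated 3]) (auto simp: \<alpha>_def G intro!: image_eqI[of _ _ 0])
      qed
      then obtain F :: "complex \<Rightarrow> complex" where F: "F \<in> poly_fock n" "\<And>z. z \<in> Gamma_lattice A \<Longrightarrow> exp (- (pi / 2) * (cmod z)\<^sup>2) * F z = \<alpha> z"
        using interp unfolding interpolating_def by blast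
      obtain \<phi> where \<phi>: "\<And>k. k < n \<Longrightarrow> \<phi> k holomorphic_on UNIV" "\<And>z. F z = (\<Sum>k<n. cnj z ^ k * \<phi> k z)"
        using F(1) unfolding poly_fock_def by blast
      have int: "integrable lborel (\<lambda>z. (cmod (F z))\<^sup>2 * exp (- pi * (cmod z)\<^sup>2))"
        using F(1) unfolding poly_fock_def by blast
      have F0: "F (L.lp m) = (if m = 0 then 1 else 0)" for m
        using F(2)[of "L.lp m"] by (auto simp: G \<alpha>_def)
      show False
      proof (rule Q.no_delta_function[of \<phi>])
        show "real n \<le> M.area" by (rule le)
        show "integrable lborel (\<lambda>z. (cmod (\<Sum>k<n. cnj z ^ k * \<phi> k z))\<^sup>2 * exp (- pi * (cmod z)\<^sup>2))"
          using int by (simp add: \<phi>(2))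
        show "(\<Sum>k<n. cnj (M.lp m / of_real M.area) ^ k * \<phi> k (M.lp m / of_real M.area)) = 0" if "m \<noteq> 0" for m
          unfolding dual \<phi>(2)[symmetric] using F0[of m] that by simp
        show "(\<Sum>k<n. cnj 0 ^ k * \<phi> k 0) \<noteq> 0"
          unfolding \<phi>(2)[symmetric] using F0[of 0] by simp
      qed (rule \<phi>(1))
    qed
  next
    assume "lattice_density A < real n"
    then have lt: "M.area < real n" by (simp add: dens)
    obtain \<psi> a D where \<psi>: "0 \<le> a" "a < pi / 2" "\<And>p. \<psi> p holomorphic_on UNIV"
      "\<And>p z. p < n \<Longrightarrow> cmod (\<psi> p z) \<le> D * exp (a * (cmod z)\<^sup>2)"
      "\<And>\<zeta>. \<forall>m. chi \<zeta> (M.lp m) = 1 \<Longrightarrow> \<zeta> \<noteq> 0 \<Longrightarrow> (\<Sum>p<n. cnj \<zeta> ^ p * \<psi> p \<zeta>) = 0"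
      "(\<Sum>p<n. cnj 0 ^ p * \<psi> p 0) \<noteq> 0"
      by (rule Q.delta_function_exists[OF lt]) (rule that)
    \<comment> \<open>The nodes pair trivially with \<open>M\<close>, so the delta function vanishes
      at every node other than 0.\<close>
    have chi1: "chi (L.lp m) (M.lp j) = 1" for m j
      using L.chi_dual_lp[of j m] chi_swap[of "L.lp m" "M.lp j"] by (simp add: M_lp)
    show "interpolating (Gamma_lattice A) n"
      unfolding interpolating_def
    proof (intro allI impI)
      fix \<alpha> :: "complex \<Rightarrow> complex"
      assume "(\<lambda>z. (cmod (\<alpha> z))\<^sup>2) summable_on Gamma_lattice A"
      then have \<alpha>: "(\<lambda>m. (cmod (\<alpha> (L.lp m)))\<^sup>2) summable_on UNIV"
        unfolding G by (subst (asm) summable_on_reindex[OF L.inj_lp]) (simp add: o_def)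
      have z: "(\<Sum>p<n. cnj (L.lp m) ^ p * \<psi> p (L.lp m)) = 0" if "m \<noteq> 0" for m
        using that by (intro \<psi>(5) allI chi1) simp
      obtain \<phi> where \<phi>: "\<And>k. k < n \<Longrightarrow> \<phi> k holomorphic_on UNIV"
        "integrable lborel (\<lambda>z. (cmod (\<Sum>k<n. cnj z ^ k * \<phi> k z))\<^sup>2 * exp (- pi * (cmod z)\<^sup>2))"
        "\<And>m. (\<Sum>k<n. cnj (L.lp m) ^ k * \<phi> k (L.lp m)) = \<alpha> (L.lp m) * of_real (exp (pi / 2 * (cmod (L.lp m))\<^sup>2))"
        by (rule L.interpolation_from_delta[OF \<psi>(1,2,3,4) z \<psi>(6) \<alpha>], assumption, assumption) (rule that)
      define F where "F = (\<lambda>z. \<Sum>k<n. cnj z ^ k * \<phi> k z)"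
      have "F \<in> poly_fock n" unfolding poly_fock_def F_def using \<phi>(1,2) by blast
      moreover have "exp (- (pi / 2) * (cmod z)\<^sup>2) * F z = \<alpha> z" if "z \<in> Gamma_lattice A" for z
      proof -
        from that obtain m where m: "z = L.lp m" unfolding G by blast
        have "exp (- (pi / 2) * (cmod z)\<^sup>2) * exp (pi / 2 * (cmod z)\<^sup>2) = 1" by (simp flip: exp_add)
        then have "complex_of_real (exp (- (pi / 2) * (cmod z)\<^sup>2)) * of_real (exp (pi / 2 * (cmod z)\<^sup>2)) = 1"
          by (metis of_real_1 of_real_mult)
        then show ?thesis unfolding F_def m \<phi>(3) by (simp only: mult.left_commute[of _ "\<alpha> _"] mult_1_right)
      qed
      ultimately show "\<exists>F\<in>poly_fock n. \<forall>z\<in>Gamma_lattice A. exp (- (pi / 2) * (cmod z)\<^sup>2) * F z = \<alpha> z" by blast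
    qed
  qed
qed

end
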